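(* Let $\Omega\subset\mathbb{R}^n$ be an open set. Let $g\in L^{p-1}_{sp}(\mathbb{R}^n)$ and $h\in L^{p-1}_{sp}(\mathbb{R}^n)$ be such that $h\le g$ in $\mathbb{R}^n$. Let $\{u_j\}$ be a sequence of weak supersolutions in $\Omega$ such that $h\le u_j\le g$ almost everywhere in $\mathbb{R}^n$ for every $j$, and such that $u_j$ is uniformly (in $j$) locally essentially bounded from above in $\Omega$. Suppose that $u_j$ converges to a function $u$ pointwise almost everywhere in $\mathbb{R}^n$ as $j\to\infty$. Then $u$ is a weak supersolution in $\Omega$ as well.
   Context: Standing assumptions: $n\ge1$ is an integer, $s\in(0,1)$, $p\in(1,\infty)$, $\Lambda\ge1$, and $K:\mathbb{R}^n\times\mathbb{R}^n\to[0,\infty)$ is a measurable symmetric kernel ($K(x,y)=K(y,x)$) with $\Lambda^{-1}\le K(x,y)|x-y|^{n+sp}\le\Lambda$ for a.e. $x,y\in\mathbb{R}^n$. $D\Subset\Omega$ means that $\overline D$ is a compact subset of $\Omega$; $u_-:=\max\{-u,0\}$. "Uniformly locally essentially bounded from above in $\Omega$" means: for every open $D\Subset\Omega$ there is $M<\infty$ with $u_j\le M$ a.e. in $D$ for all $j$. $W^{s,p}(U)$ consists of $v\in L^p(U)$ with $\int_U\int_U\frac{|v(x)-v(y)|^p}{|x-y|^{n+sp}}\,dx\,dy<\infty$; $v\in W^{s,p}_{\rm loc}(\Omega)$ means $v\in W^{s,p}(D)$ for every open $D\Subset\Omega$. The tail space is $L^{p-1}_{sp}(\mathbb{R}^n):=\{f\in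 L^{p-1}_{\rm loc}(\mathbb{R}^n):\int_{\mathbb{R}^n}|f(x)|^{p-1}(1+|x|)^{-n-sp}\,dx<\infty\}$. A weak supersolution in $\Omega$ is a measurable function $u$ on $\mathbb{R}^n$ with $u\in W^{s,p}_{\rm loc}(\Omega)$, $u_-\in L^{p-1}_{sp}(\mathbb{R}^n)$, and $$\int_{\mathbb{R}^n}\int_{\mathbb{R}^n}|u(x)-u(y)|^{p-2}(u(x)-u(y))(\eta(x)-\eta(y))K(x,y)\,dx\,dy\ge0$$ for every nonnegative $\eta\in C_0^\infty(\Omega)$. *)

theory Defs
  imports "HOL-Analysis.Analysis"
begin

definition compactly_inside :: "'a::topological_space set \<Rightarrow> 'a set \<Rightarrow> bool" where
  "compactly_inside D \<Omega> \<longleftrightarrow> compact (closure D) \<and> closure D \<subseteq> \<Omega>"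

fun Ck :: "nat \<Rightarrow> ('a::real_normed_vector \<Rightarrow> real) \<Rightarrow> bool" where
  "Ck 0 f \<longleftrightarrow> continuous_on UNIV f"
| "Ck (Suc k) f \<longleftrightarrow> (\<forall>x. f differentiable (at x)) \<and>
     (\<forall>v. Ck k (\<lambda>x. frechet_derivative f (at x) v))"

definition test_functions :: "'a::euclidean_space set \<Rightarrow> ('a \<Rightarrow> real) set" where
  "test_functions \<Omega> = {\<eta>. (\<forall>k. Ck k \<eta>) \<and> compactly_inside {x. \<eta> x \<noteq> 0} \<Omega>}"

(* The weight is infinite on the diagonal mathematically and 0 here (division by 0);
   the diagonal is a null set of the product. *)
definition sobolev :: "real \<Rightarrow> real \<Rightarrow> 'a::euclidean_space set \<Rightarrow> ('a \<Rightarrow> real) set" where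
  "sobolev s p U = {v. v \<in> borel_measurable (lebesgue_on U)
     \<and> (\<integral>\<^sup>+x\<in>U. ennreal (\<bar>v x\<bar> powr p) \<partial>lebesgue) < \<infinity>
     \<and> (\<integral>\<^sup>+z\<in>U \<times> U. ennreal (\<bar>v (fst z) - v (snd z)\<bar> powr p
          / norm (fst z - snd z) powr (real DIM('a) + s * p)) \<partial>lebesgue) < \<infinity>}"

definition sobolev_loc :: "real \<Rightarrow> real \<Rightarrow> 'a::euclidean_space set \<Rightarrow> ('a \<Rightarrow> real) set" where
  "sobolev_loc s p \<Omega> = {v. \<forall>D. open D \<and> compactly_inside D \<Omega> \<longrightarrow> v \<in> sobolev s p D}"

definition tail_space :: "real \<Rightarrow> real \<Rightarrow> ('a::euclidean_space \<Rightarrow> real) set" where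
  "tail_space s p = {f. f \<in> borel_measurable lebesgue
     \<and> (\<forall>D. open D \<and> compactly_inside D UNIV \<longrightarrow>
          (\<integral>\<^sup>+x\<in>D. ennreal (\<bar>f x\<bar> powr (p - 1)) \<partial>lebesgue) < \<infinity>)
     \<and> (\<integral>\<^sup>+x. ennreal (\<bar>f x\<bar> powr (p - 1)
          * (1 + norm x) powr (- real DIM('a) - s * p)) \<partial>lebesgue) < \<infinity>}"

definition admissible_kernel ::
    "real \<Rightarrow> real \<Rightarrow> real \<Rightarrow> ('a::euclidean_space \<Rightarrow> 'a \<Rightarrow> real) \<Rightarrow> bool" where
  "admissible_kernel s p \<Lambda> K \<longleftrightarrow>
     (\<lambda>z. K (fst z) (snd z)) \<in> borel_measurable lebesgue
     \<and> (\<forall>x y. 0 \<le> K x y) \<and> (\<forall>x y. K x y = K y x)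
     \<and> (AE z in lebesgue.
          inverse \<Lambda> \<le> K (fst z) (snd z) * norm (fst z - snd z) powr (real DIM('a) + s * p)
          \<and> K (fst z) (snd z) * norm (fst z - snd z) powr (real DIM('a) + s * p) \<le> \<Lambda>)"

definition energy_integrand ::
    "real \<Rightarrow> ('a::euclidean_space \<Rightarrow> 'a \<Rightarrow> real) \<Rightarrow> ('a \<Rightarrow> real) \<Rightarrow> ('a \<Rightarrow> real) \<Rightarrow> 'a \<times> 'a \<Rightarrow> real"
  where
  "energy_integrand p K u \<eta> = (\<lambda>(x, y).
     \<bar>u x - u y\<bar> powr (p - 2) * (u x - u y) * (\<eta> x - \<eta> y) * K x y)"

(* Integrability is stated because the Bochner integral of a nonintegrable function is 0.
   The membership conditions on u bound the positive part of the integrand only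
   (the positive part of u may grow arbitrarily outside \<Omega>), so the double integral exists in
   [-\<infinity>, \<infinity>) and is nonnegative exactly if the integrand is integrable with
   nonnegative integral. *)
definition weak_supersolution ::
    "real \<Rightarrow> real \<Rightarrow> ('a::euclidean_space \<Rightarrow> 'a \<Rightarrow> real) \<Rightarrow> 'a set \<Rightarrow> ('a \<Rightarrow> real) \<Rightarrow> bool" where
  "weak_supersolution s p K \<Omega> u \<longleftrightarrow>
     u \<in> borel_measurable lebesgue
     \<and> u \<in> sobolev_loc s p \<Omega>
     \<and> (\<lambda>x. max (- u x) 0) \<in> tail_space s p
     \<and> (\<forall>\<eta> \<in> test_functions \<Omega>. (\<forall>x. 0 \<le> \<eta> x) \<longrightarrow>
          integrable lebesgue (energy_integrand p K u \<eta>)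
          \<and> 0 \<le> integral\<^sup>L lebesgue (energy_integrand p K u \<eta>))"

definition unif_loc_ess_bdd_above :: "'a::euclidean_space set \<Rightarrow> (nat \<Rightarrow> 'a \<Rightarrow> real) \<Rightarrow> bool" where
  "unif_loc_ess_bdd_above \<Omega> u \<longleftrightarrow>
     (\<forall>D. open D \<and> compactly_inside D \<Omega> \<longrightarrow>
        (\<exists>M::real. \<forall>j. AE x in lebesgue. x \<in> D \<longrightarrow> u j x \<le> M))"

end

theory Submission
  imports Defs
begin

text \<open>Mollification makes the defining inequality of a supersolution available for all nonnegative
  compactly supported test functions of class \<open>W\<^sup>s\<^sup>,\<^sup>p\<close>. If \<open>u \<le> M\<close> near a compact set, testing with
  \<open>\<eta> = w \<psi>\<^sup>m\<close>, where \<open>w = M - u \<ge> 0\<close> and \<open>\<psi>\<close> is a Lipschitz cutoff, gives a Caccioppoli estimate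
  \<open>X \<le> a (Y + 1)\<close> between the weighted energy \<open>X\<close> of \<open>w\<close> on the pairs with \<open>\<bar>x - y\<bar>\<close> small relative
  to \<open>\<psi>\<close> and the weighted norm \<open>Y = \<integral> \<bar>w\<bar>\<^sup>p \<psi>\<^bsup>m-p\<^esup>\<close>. Since the bounds \<open>h \<le> u\<^sub>j \<le> g\<close> control only \<open>L\<^bsup>p-1\<^esup>\<close>
  norms, \<open>Y\<close> has to be absorbed: averaging \<open>\<bar>w\<bar>\<close> over balls of radius \<open>\<theta> \<psi>\<^bsup>1/s\<^esup>\<close> yields
  \<open>Y \<le> \<epsilon> X + C\<close> with \<open>C\<close> depending on \<open>\<epsilon>\<close> and the \<open>L\<^bsup>p-1\<^esup>\<close> bound only. This replaces both the local
  boundedness theory for supersolutions and an iteration over radii, and it bounds \<open>u\<^sub>j\<close> in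
  \<open>W\<^sup>s\<^sup>,\<^sup>p\<close> locally, uniformly in \<open>j\<close>. Fatou's lemma puts the limit into \<open>W\<^sup>s\<^sup>,\<^sup>p\<close> locally; the energies
  converge by uniform integrability near the support of the test function and by domination away from it.\<close>

section \<open>Elementary inequalities\<close>

text \<open>The powers of the cutoff are dictated by scaling. Differences of \<psi> cost \<psi>^(-p)
  on near pairs, and the kernel costs \<psi>^(-n-sp) on far pairs. Averaging over a ball of radius r
  puts the factor r^(sp) in front of the energy. With r = \<theta> \<psi>^(1/s) this factor is
  \<theta>^(sp) \<psi>^p, so the loss \<psi>^(-p) is repaid exactly and \<theta> stays available as
  a small parameter. The remaining negative powers of \<psi> fall on terms of lower order in w, and
  a large exponent m swallows them. Absorbing Y into X needs both to be finite beforehand. This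
  comes from the membership of each single supersolution in the local Sobolev space, which also
  makes w \<psi>^m an admissible test function; the resulting constants do not see its norm there.
  Far from the support of the cutoff w has no sign, and only the tail integral of its majorant is
  available. The far estimate is therefore arranged so that the distant point enters with the power
  p - 1 only. Double integrals are computed for Borel representatives over \<open>lborel\<close>,
  where Fubini is at hand, and carried over to Lebesgue measure through almost everywhere
  equality.\<close>

lemmas ennreal_collect = ennreal_mult[symmetric] ennreal_plus[symmetric]

lemma powr_add_le:
  fixes a b q :: real
  assumes "0 \<le> a" "0 \<le> b" "0 \<le> q"
  shows "(a + b) powr q \<le> 2 powr q * (a powr q + b powr q)"
proof -
  have "(a + b) powr q \<le> (2 * max a b) powr q"
    using assms by (intro powr_mono2) auto
  also have "\<dots> = 2 powr q * max a b powr q"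
    using assms by (simp add: powr_mult)
  also have "max a b powr q \<le> a powr q + b powr q"
    by (auto simp: max_def)
  finally show ?thesis by simp
qed

lemma powr_abs_diff_le:
  fixes a b q :: real
  assumes "0 \<le> q"
  shows "\<bar>a - b\<bar> powr q \<le> 2 powr q * (\<bar>a\<bar> powr q + \<bar>b\<bar> powr q)"
proof -
  have "\<bar>a - b\<bar> powr q \<le> (\<bar>a\<bar> + \<bar>b\<bar>) powr q"
    using assms by (intro powr_mono2) auto
  also have "\<dots> \<le> 2 powr q * (\<bar>a\<bar> powr q + \<bar>b\<bar> powr q)"
    using assms by (intro powr_add_le) auto
  finally show ?thesis .
qed

lemma powr_minus_one_mult:
  fixes a p :: real
  assumes "0 \<le> a"
  shows "a powr (p - 1) * a = a powr p"
  using assms by (cases "a = 0") (auto simp: powr_diff)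

text \<open>The alternative \<open>b \<le> \<epsilon> * a\<close> or
  \<open>a \<le> b / \<epsilon>\<close> takes the place of convexity: in each case one of the two
  terms on the right suffices.\<close>

lemma young_powr:
  fixes a b p \<epsilon> :: real
  assumes "1 < p" "0 < \<epsilon>" "0 \<le> a" "0 \<le> b"
  shows "a powr (p - 1) * b \<le> \<epsilon> * a powr p + \<epsilon> powr (1 - p) * b powr p"
proof (cases "b \<le> \<epsilon> * a")
  case True
  have "a powr (p - 1) * b \<le> a powr (p - 1) * (\<epsilon> * a)"
    using True by (intro mult_left_mono) auto
  also have "\<dots> = \<epsilon> * a powr p"
    using powr_minus_one_mult[OF \<open>0 \<le> a\<close>, of p] by (simp add: mult_ac)
  finally show ?thesis
    using assms by (simp add: add_increasing2)
next
  case False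
  then have "a \<le> b / \<epsilon>"
    using assms by (simp add: field_simps)
  then have "a powr (p - 1) * b \<le> (b / \<epsilon>) powr (p - 1) * b"
    using assms by (intro mult_right_mono powr_mono2) auto
  also have "\<dots> = \<epsilon> powr (1 - p) * (b powr (p - 1) * b)"
    using assms by (simp add: powr_divide powr_diff field_simps)
  also have "\<dots> = \<epsilon> powr (1 - p) * b powr p"
    using powr_minus_one_mult[OF \<open>0 \<le> b\<close>] by simp
  finally show ?thesis
    using assms by (simp add: add_increasing)
qed

text \<open>\<open>young_powr\<close> with parameter \<epsilon>^(-1/(p-1)). Both forms occur because
  the small coefficient has to fall on the function that varies along the sequence: the test
  function during mollification, the supersolution in the final limit.\<close>

lemma young_powr':
  fixes a b p \<epsilon> :: real
  assumes "1 < p" "0 < \<epsilon>" "0 \<le> a" "0 \<le> b"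
  shows "a powr (p - 1) * b \<le> \<epsilon> powr (- 1 / (p - 1)) * a powr p + \<epsilon> * b powr p"
proof -
  define t where "t = \<epsilon> powr (- 1 / (p - 1))"
  have e: "- 1 / (p - 1) * (1 - p) = 1" using assms by (simp add: field_simps)
  have t: "0 < t" "t powr (1 - p) = \<epsilon>"
    using assms unfolding t_def powr_powr e by auto
  show ?thesis
    using young_powr[OF \<open>1 < p\<close> t(1) assms(3,4)] t(2) by (simp add: t_def)
qed

text \<open>The nonlinearity of the fractional p-Laplacian. Since \<open>0 powr a\<close> is 0 for
  every \<open>a\<close>, its value at 0 is 0 also for p < 2, which is the continuous
  extension.\<close>

definition signed_pow :: "real \<Rightarrow> real \<Rightarrow> real" where
  "signed_pow p t = \<bar>t\<bar> powr (p - 2) * t"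

lemma energy_integrand_eq:
  "energy_integrand p K u \<eta> z =
     signed_pow p (u (fst z) - u (snd z)) * (\<eta> (fst z) - \<eta> (snd z)) * K (fst z) (snd z)"
  by (simp add: energy_integrand_def signed_pow_def case_prod_beta)

lemma signed_pow_nonneg: "0 \<le> t \<Longrightarrow> signed_pow p t = t powr (p - 1)"
  by (cases "t = 0") (auto simp: signed_pow_def powr_minus_one_mult[of t "p - 1", simplified])

lemma signed_pow_minus: "signed_pow p (- t) = - signed_pow p t"
  by (simp add: signed_pow_def)

lemma signed_pow_nonpos: "t \<le> 0 \<Longrightarrow> signed_pow p t = - ((- t) powr (p - 1))"
  using signed_pow_nonneg[of "- t" p] by (simp add: signed_pow_minus)

lemma abs_signed_pow: "\<bar>signed_pow p t\<bar> = \<bar>t\<bar> powr (p - 1)"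
  by (cases "0 \<le> t") (auto simp: signed_pow_nonneg signed_pow_nonpos)

lemma continuous_signed_pow:
  assumes "1 < p"
  shows "continuous_on UNIV (signed_pow p)"
proof -
  have eq: "signed_pow p = (\<lambda>t. max t 0 powr (p - 1) - max (- t) 0 powr (p - 1))"
    by (rule ext) (auto simp: signed_pow_nonneg signed_pow_nonpos max_def)
  show ?thesis
    unfolding eq using assms by (intro continuous_intros continuous_on_powr') auto
qed

lemma signed_pow_measurable [measurable]:
  "1 < p \<Longrightarrow> signed_pow p \<in> borel_measurable borel"
  by (intro borel_measurable_continuous_onI continuous_signed_pow)

lemma powr_diff_le:
  fixes a b m :: real
  assumes "1 \<le> m" "0 < a" "0 < b" "a \<le> c" "b \<le> c"
  shows "\<bar>a powr m - b powr m\<bar> \<le> m * c powr (m - 1) * \<bar>a - b\<bar>"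
proof -
  have *: "x powr m - y powr m \<le> m * c powr (m - 1) * (x - y)"
    if "0 < y" "y < x" "x \<le> c" for x y
  proof -
    have "\<exists>z. z > y \<and> z < x \<and> x powr m - y powr m = (x - y) * (m * z powr (m - 1))"
      using that
      by (intro MVT2) (auto intro!: derivative_eq_intros simp: powr_diff)
    then obtain z where z: "y < z" "z < x" "x powr m - y powr m = (x - y) * (m * z powr (m - 1))"
      by blast
    have "z powr (m - 1) \<le> c powr (m - 1)"
      using z that assms by (intro powr_mono2) auto
    then show ?thesis
      using z assms that by (simp add: mult.commute mult_left_mono)
  qed
  show ?thesis
  proof (cases a b rule: linorder_cases)
    case less
    then have "a powr m \<le> b powr m" using assms by (intro powr_mono2) auto
    then show ?thesis using *[of a b] less assms by auto
  next
    case greater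
    then have "b powr m \<le> a powr m" using assms by (intro powr_mono2) auto
    then show ?thesis using *[of b a] greater assms by auto
  qed simp
qed

text \<open>The hypotheses on \<open>d\<close> keep \<alpha> and \<beta> within a factor 2 of each
  other. The product is expanded so that the difference of the weights multiplies the smaller of
  \<open>a\<close> and \<open>b\<close>. The error then involves \<open>a\<close> and \<alpha> only,
  so that after integration it depends on the first variable of the pair alone.\<close>

lemma caccioppoli_near:
  fixes p m :: real
  assumes "1 < p" "1 \<le> m"
  obtains c C where "0 < c" "0 \<le> C"
    "\<And>a b \<alpha> \<beta> d. \<lbrakk>0 \<le> a; 0 \<le> b; 0 < \<alpha>; 0 < \<beta>; \<bar>\<alpha> - \<beta>\<bar> \<le> d; d \<le> max \<alpha> \<beta> / 2\<rbrakk> \<Longrightarrow>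
       c * \<bar>a - b\<bar> powr p * \<alpha> powr m - C * (a powr p * \<alpha> powr (m - p) * d powr p)
       \<le> signed_pow p (a - b) * (a * \<alpha> powr m - b * \<beta> powr m)"
proof
  define c :: real where "c = 2 powr (- m) / 2"
  define D :: real where "D = m * 2 powr (m - 1)"
  show "0 < c" by (simp add: c_def)
  show "0 \<le> c powr (1 - p) * D powr p" by simp
  fix a b \<alpha> \<beta> d :: real
  assume h: "0 \<le> a" "0 \<le> b" "0 < \<alpha>" "0 < \<beta>" "\<bar>\<alpha> - \<beta>\<bar> \<le> d" "d \<le> max \<alpha> \<beta> / 2"
  define t where "t = \<bar>a - b\<bar>"
  have ab: "\<alpha> / 2 \<le> \<beta>" "\<beta> \<le> 2 * \<alpha>" using h by (auto simp: max_def split: if_splits)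
  have D: "\<bar>\<alpha> powr m - \<beta> powr m\<bar> \<le> D * \<alpha> powr (m - 1) * d"
  proof -
    have "\<bar>\<alpha> powr m - \<beta> powr m\<bar> \<le> m * (2 * \<alpha>) powr (m - 1) * \<bar>\<alpha> - \<beta>\<bar>"
      using assms h ab by (intro powr_diff_le) auto
    also have "\<dots> \<le> m * (2 * \<alpha>) powr (m - 1) * d"
      using h assms by (intro mult_left_mono) auto
    also have "\<dots> = D * \<alpha> powr (m - 1) * d"
      using h by (simp add: D_def powr_mult)
    finally show ?thesis .
  qed
  have low: "2 * c * \<alpha> powr m \<le> \<beta> powr m"
  proof -
    have "(\<alpha> / 2) powr m \<le> \<beta> powr m" using ab h assms by (intro powr_mono2) auto
    then show ?thesis using h by (simp add: c_def powr_divide powr_minus field_simps)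
  qed
  have low': "2 * c * \<alpha> powr m \<le> \<alpha> powr m"
    using assms by (simp add: c_def powr_minus mult_left_le_one_le
        ge_one_powr_ge_zero inverse_le_1_iff)
  have tt: "t powr (p - 1) * t = t powr p" by (rule powr_minus_one_mult) (simp add: t_def)
  have main: "2 * c * \<alpha> powr m * t powr p - t powr (p - 1) * (a * (D * \<alpha> powr (m - 1) * d))
      \<le> signed_pow p (a - b) * (a * \<alpha> powr m - b * \<beta> powr m)"
  proof (cases "b \<le> a")
    case True
    have "signed_pow p (a - b) * (a * \<alpha> powr m - b * \<beta> powr m)
        = t powr p * \<alpha> powr m + t powr (p - 1) * (b * (\<alpha> powr m - \<beta> powr m))"
      using True unfolding tt[symmetric] by (simp add: signed_pow_nonneg t_def algebra_simps)
    moreover have "b * - (\<alpha> powr m - \<beta> powr m) \<le> a * (D * \<alpha> powr (m - 1) * d)"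
      using True h abs_le_D2[OF D] abs_ge_zero[THEN order_trans, OF D]
      by (meson mult_left_mono mult_right_mono order_trans)
    then have "t powr (p - 1) * (b * - (\<alpha> powr m - \<beta> powr m))
        \<le> t powr (p - 1) * (a * (D * \<alpha> powr (m - 1) * d))"
      by (intro mult_left_mono) auto
    moreover have "2 * c * \<alpha> powr m * t powr p \<le> \<alpha> powr m * t powr p"
      using low' by (intro mult_right_mono) auto
    ultimately show ?thesis by (simp add: algebra_simps)
  next
    case False
    have "signed_pow p (a - b) * (a * \<alpha> powr m - b * \<beta> powr m)
        = t powr p * \<beta> powr m + t powr (p - 1) * (a * (\<beta> powr m - \<alpha> powr m))"
      using False unfolding tt[symmetric] by (simp add: signed_pow_nonpos t_def algebra_simps)
    moreover have "a * (\<alpha> powr m - \<beta> powr m) \<le> a * (D * \<alpha> powr (m - 1) * d)"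
      using h abs_le_D1[OF D] by (intro mult_left_mono) auto
    then have "t powr (p - 1) * (a * (\<alpha> powr m - \<beta> powr m))
        \<le> t powr (p - 1) * (a * (D * \<alpha> powr (m - 1) * d))"
      by (rule mult_left_mono) auto
    moreover have "2 * c * \<alpha> powr m * t powr p \<le> \<beta> powr m * t powr p"
      using low by (intro mult_right_mono) auto
    ultimately show ?thesis by (simp add: algebra_simps)
  qed
  \<comment> \<open>Young's inequality with parameter \<open>c\<close> spends half of the
    coefficient \<open>2 * c\<close> of the good term on the cross term. Factoring out \<alpha>^m
    first is what produces the weight \<alpha>^(m-p).\<close>
  have "t powr (p - 1) * (D * a * d / \<alpha>) \<le> c * t powr p + c powr (1 - p) * (D * a * d / \<alpha>) powr p"
    using assms h \<open>0 < c\<close> by (intro young_powr) (auto simp: t_def D_def)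
  then have "\<alpha> powr m * (t powr (p - 1) * (D * a * d / \<alpha>))
      \<le> \<alpha> powr m * (c * t powr p + c powr (1 - p) * (D * a * d / \<alpha>) powr p)"
    by (rule mult_left_mono) auto
  also have "\<dots> = c * \<alpha> powr m * t powr p
      + c powr (1 - p) * (\<alpha> powr m * (D * a * d / \<alpha>) powr p)"
    by (simp add: algebra_simps)
  also have "\<alpha> powr m * (D * a * d / \<alpha>) powr p = D powr p * (a powr p * \<alpha> powr (m - p) * d powr p)"
    using h assms by (simp add: powr_divide powr_mult powr_diff D_def)
  also have "\<alpha> powr m * (t powr (p - 1) * (D * a * d / \<alpha>))
      = t powr (p - 1) * (a * (D * \<alpha> powr (m - 1) * d))"
    using h by (simp add: powr_diff)
  finally show "c * \<bar>a - b\<bar> powr p * \<alpha> powr m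
        - c powr (1 - p) * D powr p * (a powr p * \<alpha> powr (m - p) * d powr p)
      \<le> signed_pow p (a - b) * (a * \<alpha> powr m - b * \<beta> powr m)"
    using main unfolding t_def[symmetric] by (simp add: algebra_simps)
qed

text \<open>Each half of the product is negative only when its own value is positive and below the
  other one; then the gap is at most the other value. The loss is thus linear in the value next to
  the weight and of order p - 1 in the distant value, which is what tail integrals can bound. The
  signs of \<open>a\<close> and \<open>b\<close> are free because nothing is known about them away
  from the cutoff.\<close>

lemma caccioppoli_far:
  fixes p a b P Q :: real
  assumes "1 < p" "0 \<le> P" "0 \<le> Q"
  shows "- (\<bar>b\<bar> powr (p - 1) * (max a 0 * P) + \<bar>a\<bar> powr (p - 1) * (max b 0 * Q))
    \<le> signed_pow p (a - b) * (max a 0 * P - max b 0 * Q)"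
proof -
  have *: "- (\<bar>y\<bar> powr (p - 1) * (max x 0 * R)) \<le> signed_pow p (x - y) * (max x 0 * R)"
    if "0 \<le> R" for x y R :: real
  proof (cases "0 < x \<and> x < y")
    case True
    have "(y - x) powr (p - 1) \<le> \<bar>y\<bar> powr (p - 1)"
      using True assms by (intro powr_mono2) auto
    then have "(y - x) powr (p - 1) * (max x 0 * R) \<le> \<bar>y\<bar> powr (p - 1) * (max x 0 * R)"
      using that by (intro mult_right_mono) auto
    then show ?thesis using True by (simp add: signed_pow_nonpos)
  next
    case False
    then consider "x \<le> 0" | "y \<le> x" "0 < x" by linarith
    then show ?thesis
    proof cases
      case 2
      then have "0 \<le> signed_pow p (x - y) * (max x 0 * R)"
        using that by (simp add: signed_pow_nonneg)
      moreover have "0 \<le> \<bar>y\<bar> powr (p - 1) * (max x 0 * R)" using that by simp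
      ultimately show ?thesis by linarith
    qed (simp add: max_def)
  qed
  have "signed_pow p (a - b) = - signed_pow p (b - a)"
    using signed_pow_minus[of p "b - a"] by simp
  then show ?thesis
    using *[OF assms(2), of b a] *[OF assms(3), of a b] by (simp add: algebra_simps)
qed

section \<open>Integrals over products\<close>

lemma nn_integral_lborel_prod:
  fixes f :: "'a::euclidean_space \<times> 'b::euclidean_space \<Rightarrow> ennreal"
  assumes "f \<in> borel_measurable borel"
  shows "(\<integral>\<^sup>+z. f z \<partial>lborel) = (\<integral>\<^sup>+x. \<integral>\<^sup>+y. f (x, y) \<partial>lborel \<partial>lborel)"
proof -
  have "f \<in> borel_measurable (lborel \<Otimes>\<^sub>M lborel)"
    using assms by (simp add: lborel_prod)
  from lborel.nn_integral_fst[OF this] show ?thesis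
    by (simp add: lborel_prod)
qed

lemma nn_integral_lborel_swap:
  fixes f :: "'a::euclidean_space \<times> 'b::euclidean_space \<Rightarrow> ennreal"
  assumes [measurable]: "f \<in> borel_measurable borel"
  shows "(\<integral>\<^sup>+z. f (snd z, fst z) \<partial>lborel) = (\<integral>\<^sup>+z. f z \<partial>lborel)"
proof -
  have m: "f \<in> borel_measurable (lborel \<Otimes>\<^sub>M lborel)"
    using assms by (simp add: lborel_prod)
  have "(\<lambda>z::'b \<times> 'a. f (snd z, fst z)) \<in> borel_measurable borel"
    unfolding borel_prod[symmetric] by measurable
  then have "(\<integral>\<^sup>+(z::'b \<times> 'a). f (snd z, fst z) \<partial>lborel) = (\<integral>\<^sup>+y. \<integral>\<^sup>+x. f (x, y) \<partial>lborel \<partial>lborel)"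
    by (subst nn_integral_lborel_prod) auto
  also have "\<dots> = (\<integral>\<^sup>+z. f z \<partial>lborel)"
    using lborel_pair.nn_integral_snd[OF m] by (simp add: lborel_prod)
  finally show ?thesis .
qed

lemma nn_integral_le_lincomb:
  fixes f g h :: "'a \<Rightarrow> real"
  assumes le: "AE x in M. f x \<le> c * g x + d * h x"
    and [measurable]: "g \<in> borel_measurable M" "h \<in> borel_measurable M"
    and nn: "0 \<le> c" "0 \<le> d" "\<And>x. 0 \<le> g x" "\<And>x. 0 \<le> h x"
  shows "(\<integral>\<^sup>+x. ennreal (f x) \<partial>M)
    \<le> ennreal c * (\<integral>\<^sup>+x. ennreal (g x) \<partial>M) + ennreal d * (\<integral>\<^sup>+x. ennreal (h x) \<partial>M)"
proof -
  have "(\<integral>\<^sup>+x. ennreal (f x) \<partial>M) \<le> (\<integral>\<^sup>+x. ennreal c * ennreal (g x) + ennreal d * ennreal (h x) \<partial>M)"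
    by (rule nn_integral_mono_AE, use le in eventually_elim)
      (simp add: ennreal_collect ennreal_leI nn del: ennreal_plus)
  also have "\<dots> = ennreal c * (\<integral>\<^sup>+x. ennreal (g x) \<partial>M) + ennreal d * (\<integral>\<^sup>+x. ennreal (h x) \<partial>M)"
    by (simp add: nn_integral_add nn_integral_cmult)
  finally show ?thesis .
qed

lemma nn_integral_le_cmult:
  fixes f g :: "'a \<Rightarrow> real"
  assumes "AE x in M. f x \<le> c * g x" "g \<in> borel_measurable M" "0 \<le> c" "\<And>x. 0 \<le> g x"
  shows "(\<integral>\<^sup>+x. ennreal (f x) \<partial>M) \<le> ennreal c * (\<integral>\<^sup>+x. ennreal (g x) \<partial>M)"
  using nn_integral_le_lincomb[where M = M and f = f and c = c and g = g and d = 0 and h = "\<lambda>_. 0"] assms by simp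

lemma borel_measurable_Pair1:
  fixes f :: "'a::euclidean_space \<times> 'b::euclidean_space \<Rightarrow> 'c::topological_space"
  assumes "f \<in> borel_measurable borel"
  shows "(\<lambda>y. f (x, y)) \<in> borel_measurable borel"
  using assms unfolding borel_prod[symmetric] by (rule measurable_compose[OF measurable_Pair1', rotated]) auto

lemma nn_integral_lborel_translate:
  fixes f :: "'a::euclidean_space \<Rightarrow> ennreal"
  assumes "f \<in> borel_measurable borel"
  shows "(\<integral>\<^sup>+x. f (a + x) \<partial>lborel) = (\<integral>\<^sup>+x. f x \<partial>lborel)"
  using assms by (subst lborel_distr_plus[of a, symmetric], subst nn_integral_distr) auto

lemma nn_integral_lborel_reflect:
  fixes f :: "'a::euclidean_space \<Rightarrow> ennreal"
  assumes "f \<in> borel_measurable borel"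
  shows "(\<integral>\<^sup>+x. f (a - x) \<partial>lborel) = (\<integral>\<^sup>+x. f x \<partial>lborel)"
  using assms
  by (subst lborel_affine[of "-1" a]) (auto simp: nn_integral_density nn_integral_distr)

section \<open>Null sets in the product\<close>

lemma AE_lborel_fst:
  assumes "AE x in (lborel :: 'a::euclidean_space measure). P x"
  shows "AE z in (lborel :: ('a \<times> 'b::euclidean_space) measure). P (fst z)"
proof -
  from assms obtain N where N: "{x. \<not> P x} \<subseteq> N" "emeasure lborel N = 0" "N \<in> sets lborel"
    by (auto elim!: AE_E)
  have s: "N \<times> (UNIV :: 'b set) \<in> sets (lborel \<Otimes>\<^sub>M lborel)"
    using N by (intro pair_measureI) auto
  have "emeasure (lborel \<Otimes>\<^sub>M lborel) (N \<times> (UNIV :: 'b set)) = 0"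
    using N by (subst lborel.emeasure_pair_measure_Times) auto
  then show ?thesis
    unfolding lborel_prod[symmetric] using N(1) s by (intro AE_I[where N = "N \<times> UNIV"]) auto
qed

lemma AE_lborel_snd:
  assumes "AE x in (lborel :: 'a::euclidean_space measure). P x"
  shows "AE z in (lborel :: ('b::euclidean_space \<times> 'a) measure). P (snd z)"
proof -
  from assms obtain N where N: "{x. \<not> P x} \<subseteq> N" "emeasure lborel N = 0" "N \<in> sets lborel"
    by (auto elim!: AE_E)
  have s: "(UNIV :: 'b set) \<times> N \<in> sets (lborel \<Otimes>\<^sub>M lborel)"
    using N by (intro pair_measureI) auto
  have "emeasure (lborel \<Otimes>\<^sub>M lborel) ((UNIV :: 'b set) \<times> N) = 0"
    using N by (subst lborel.emeasure_pair_measure_Times) auto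
  then show ?thesis
    unfolding lborel_prod[symmetric] using N(1) s by (intro AE_I[where N = "UNIV \<times> N"]) auto
qed

lemma AE_lborel_off_diagonal:
  "AE z in (lborel :: ('a::euclidean_space \<times> 'a) measure). fst z \<noteq> snd z"
proof -
  have cl: "closed {z :: 'a \<times> 'a. fst z = snd z}"
    by (intro closed_Collect_eq continuous_intros)
  have "emeasure lborel {z :: 'a \<times> 'a. fst z = snd z}
      = (\<integral>\<^sup>+z. indicator {z :: 'a \<times> 'a. fst z = snd z} z \<partial>lborel)"
    using cl by simp
  also have "\<dots> = (\<integral>\<^sup>+x. \<integral>\<^sup>+y. indicator {z :: 'a \<times> 'a. fst z = snd z} (x, y) \<partial>lborel \<partial>lborel)"
    using cl by (intro nn_integral_lborel_prod) auto
  also have "\<dots> = (\<integral>\<^sup>+(x::'a). \<integral>\<^sup>+y. indicator {x} y \<partial>lborel \<partial>lborel)"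
    by (intro nn_integral_cong) (auto simp: indicator_def)
  also have "\<dots> = 0" by simp
  finally show ?thesis
    using cl by (intro AE_I[where N = "{z. fst z = snd z}"]) auto
qed

section \<open>The singular kernel\<close>

definition sing :: "real \<Rightarrow> real \<Rightarrow> 'a::euclidean_space \<Rightarrow> 'a \<Rightarrow> real" where
  "sing s p x y = 1 / norm (x - y) powr (real DIM('a) + s * p)"

definition tailw :: "real \<Rightarrow> real \<Rightarrow> 'a::euclidean_space \<Rightarrow> real" where
  "tailw s p y = (1 + norm y) powr (- real DIM('a) - s * p)"

abbreviation tail_integral :: "real \<Rightarrow> real \<Rightarrow> ('a::euclidean_space \<Rightarrow> real) \<Rightarrow> ennreal" where
  "tail_integral s p f \<equiv> (\<integral>\<^sup>+x. ennreal (f x powr (p - 1) * tailw s p x) \<partial>lborel)"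

abbreviation volume :: "'a::euclidean_space set \<Rightarrow> ennreal" where
  "volume D \<equiv> (\<integral>\<^sup>+x. ennreal (indicator D x) \<partial>lborel)"

abbreviation lp_on :: "real \<Rightarrow> 'a::euclidean_space set \<Rightarrow> ('a \<Rightarrow> real) \<Rightarrow> ennreal" where
  "lp_on p D f \<equiv> (\<integral>\<^sup>+x. ennreal (indicator D x * \<bar>f x\<bar> powr p) \<partial>lborel)"

abbreviation gagliardo_on :: "real \<Rightarrow> real \<Rightarrow> 'a::euclidean_space set \<Rightarrow> ('a \<Rightarrow> real) \<Rightarrow> ennreal" where
  "gagliardo_on s p D f \<equiv> (\<integral>\<^sup>+z. ennreal (indicator (D \<times> D) z *
     (\<bar>f (fst z) - f (snd z)\<bar> powr p * sing s p (fst z) (snd z))) \<partial>lborel)"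

lemma sing_nonneg [simp]: "0 \<le> sing s p x y"
  by (simp add: sing_def)

lemma sing_commute: "sing s p x y = sing s p y x"
  by (simp add: sing_def norm_minus_commute)

lemma tailw_nonneg [simp]: "0 \<le> tailw s p y"
  by (simp add: tailw_def)

lemma borel_measurable_sing [measurable]:
  assumes [measurable]: "f \<in> borel_measurable M" "g \<in> borel_measurable M"
  shows "(\<lambda>x. sing s p (f x) (g x :: 'a::euclidean_space)) \<in> borel_measurable M"
  unfolding sing_def by measurable

lemma borel_measurable_tailw [measurable]: "tailw s p \<in> borel_measurable borel"
  unfolding tailw_def[abs_def] by measurable

lemma emeasure_ball_le:
  "0 \<le> r \<Longrightarrow> emeasure lborel (ball (c::'a::euclidean_space) r)
     = ennreal (r ^ DIM('a)) * emeasure lborel (ball (0::'a) 1)"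
  by (simp add: emeasure_ball unit_ball_vol_nonneg ennreal_mult' mult.commute)

text \<open>A replacement for polar coordinates: the integrand is dominated by a series of constants
  on centred balls, whose volumes scale like r^n. The balls may overlap, since an upper bound is all
  that is wanted.\<close>

lemma nn_integral_shells_finite:
  fixes f :: "'a::euclidean_space \<Rightarrow> real" and c r :: "nat \<Rightarrow> real"
  assumes "\<And>k. 0 \<le> c k" "\<And>k. 0 \<le> r k"
    and sm: "summable (\<lambda>k. c k * r k ^ DIM('a))"
    and dom: "\<And>z. P z \<Longrightarrow> \<exists>k. norm z < r k \<and> f z \<le> c k"
  shows "(\<integral>\<^sup>+z. (if P z then ennreal (f z) else 0) \<partial>lborel) < \<infinity>"
proof -
  have [measurable]: "ball (0::'a) (r k) \<in> sets borel" for k by simp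
  have fin: "emeasure lborel (ball (0::'a) 1) < \<infinity>"
    using emeasure_bounded_finite[OF bounded_ball] by auto
  have "(\<integral>\<^sup>+z. (if P z then ennreal (f z) else 0) \<partial>lborel)
      \<le> (\<integral>\<^sup>+(z::'a). (\<Sum>k. ennreal (c k) * indicator (ball 0 (r k)) z) \<partial>lborel)"
  proof (intro nn_integral_mono)
    fix z :: 'a
    show "(if P z then ennreal (f z) else 0) \<le> (\<Sum>k. ennreal (c k) * indicator (ball 0 (r k)) z)"
    proof (cases "P z")
      case True
      then obtain k where k: "norm z < r k" "f z \<le> c k" using dom by blast
      have "(if P z then ennreal (f z) else 0) \<le> ennreal (c k) * indicator (ball 0 (r k)) z"
        using k by (auto intro: ennreal_leI)
      also have "\<dots> = (\<Sum>j\<in>{k}. ennreal (c j) * indicator (ball 0 (r j)) z)"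
        by (simp only: sum.insert finite.emptyI empty_iff not_False_eq_True sum.empty add_0_right)
      also have "\<dots> \<le> (\<Sum>k. ennreal (c k) * indicator (ball 0 (r k)) z)"
        by (intro sum_le_suminf) auto
      finally show ?thesis .
    qed simp
  qed
  also have "\<dots> = (\<Sum>k. ennreal (c k) * emeasure lborel (ball (0::'a) (r k)))"
    by (subst nn_integral_suminf) (simp_all add: nn_integral_cmult_indicator)
  also have "\<dots> = (\<Sum>k. ennreal (c k * r k ^ DIM('a)) * emeasure lborel (ball (0::'a) 1))"
    using assms(1,2) by (simp add: emeasure_ball_le[OF assms(2)] ennreal_mult' mult.assoc)
  also have "\<dots> = (\<Sum>k. ennreal (c k * r k ^ DIM('a))) * emeasure lborel (ball (0::'a) 1)"
    by simp
  also have "(\<Sum>k. ennreal (c k * r k ^ DIM('a))) = ennreal (\<Sum>k. c k * r k ^ DIM('a))"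
    using assms by (intro suminf_ennreal2) auto
  finally show ?thesis
    using fin by (auto simp: ennreal_mult_less_top le_less_trans)
qed

lemma dyadic_bracket:
  fixes x :: real
  assumes "1 \<le> x"
  obtains k :: nat where "2 ^ k \<le> x" "x < 2 ^ Suc k"
proof -
  define k where "k = nat \<lfloor>log 2 x\<rfloor>"
  have l: "0 \<le> log 2 x" using assms by simp
  have "real k \<le> log 2 x" "log 2 x < real (Suc k)"
    using l by (auto simp: k_def) linarith+
  then have "2 powr real k \<le> x" "x < 2 powr real (Suc k)"
    using assms by (simp_all add: le_log_iff log_less_iff)
  then show ?thesis using that[of k] by (simp add: powr_realpow del: of_nat_Suc power_Suc)
qed

lemma summable_dyadic:
  assumes "0 < (a::real)"
  shows "summable (\<lambda>k::nat. C * 2 powr (- a * real k))"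
proof -
  have "(2 powr (- a)) ^ k = 2 powr (- a * real k)" for k
    by (simp add: powr_powr powr_realpow[symmetric])
  moreover have "summable (\<lambda>k. C * (2 powr (- a)) ^ k)"
    using assms by (intro summable_mult summable_geometric) (auto simp: powr_less_one)
  ultimately show ?thesis by simp
qed

text \<open>The integrand behaves like |z|^(-n-sp) at infinity and like |z|^(p(1-s)-n) at the
  origin; integrability uses s > 0 in the first case and s < 1 in the second.\<close>

lemma nn_integral_singular_finite:
  fixes s p :: real
  assumes "0 < s" "s < 1" "1 < p"
  shows "(\<integral>\<^sup>+(z::'a::euclidean_space). ennreal (min 1 (norm z powr p) * sing s p 0 z) \<partial>lborel) < \<infinity>"
proof -
  define n where "n = real DIM('a)"
  define b where "b = n + s * p"
  define f where "f z = min 1 (norm z powr p) * sing s p 0 (z::'a)" for z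
  have n: "0 \<le> n" "0 < b" using assms by (auto simp: n_def b_def add_nonneg_pos)
  have f: "f z = min 1 (norm z powr p) * norm z powr - b" for z
    by (simp add: f_def sing_def n_def[symmetric] b_def[symmetric] powr_minus_divide)
  have out: "(\<integral>\<^sup>+z. (if 1 \<le> norm z then ennreal (f z) else 0) \<partial>lborel) < \<infinity>"
  proof (rule nn_integral_shells_finite[where c = "\<lambda>k. 2 powr (- b * real k)" and r = "\<lambda>k. 2 ^ Suc k"])
    have "2 powr (- b * real k) * (2 ^ Suc k) ^ DIM('a) = 2 powr n * 2 powr (- (s * p) * real k)" for k
    proof -
      have "(2 ^ Suc k :: real) ^ DIM('a) = 2 powr (real (Suc k) * n)"
        by (simp add: n_def powr_realpow[symmetric] powr_powr del: power_Suc of_nat_Suc)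
      then show ?thesis
        by (simp add: powr_add[symmetric] b_def algebra_simps)
    qed
    then show "summable (\<lambda>k. 2 powr (- b * real k) * (2 ^ Suc k) ^ DIM('a) :: real)"
      using summable_dyadic[of "s * p" "2 powr n"] assms by simp
    fix z :: 'a assume z: "1 \<le> norm z"
    then obtain k where k: "2 ^ k \<le> norm z" "norm z < 2 ^ Suc k" by (rule dyadic_bracket)
    have "f z \<le> norm z powr - b" by (simp add: f mult_left_le_one_le)
    also have "\<dots> \<le> (2 ^ k) powr - b"
      using k n by (intro powr_mono2') auto
    also have "\<dots> = 2 powr (- b * real k)"
      by (simp add: powr_realpow[symmetric] powr_powr mult.commute)
    finally show "\<exists>k. norm z < 2 ^ Suc k \<and> f z \<le> 2 powr (- b * real k)"
      using k by blast
  qed auto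
  \<comment> \<open>On the shell 2^(-k-1) \<le> |z| \<le> 2^(-k) the factor |z|^p is taken at the
    outer radius and |z|^(-b) at the inner one. The radius of the ball is doubled because the
    bracket gives only a weak inequality and a strict one is required.\<close>
  have inn: "(\<integral>\<^sup>+z. (if norm z < 1 then ennreal (f z) else 0) \<partial>lborel) < \<infinity>"
  proof (rule nn_integral_shells_finite[where c = "\<lambda>k. 2 powr (- p * real k + b * real (Suc k))"
          and r = "\<lambda>k. 2 * 2 powr (- real k)"])
    have "2 powr (- p * real k + b * real (Suc k)) * (2 * 2 powr (- real k)) ^ DIM('a)
        = 2 powr (n + b) * 2 powr (- (p * (1 - s)) * real k)" for k
    proof -
      have "(2 * 2 powr (- real k) :: real) ^ DIM('a) = (2 powr (1 - real k)) ^ DIM('a)"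
        by (simp add: powr_diff powr_minus field_simps)
      also have "\<dots> = 2 powr ((1 - real k) * n)"
        by (simp add: n_def powr_realpow[symmetric] powr_powr)
      finally show ?thesis
        by (simp add: powr_add[symmetric] b_def algebra_simps)
    qed
    then show "summable (\<lambda>k. 2 powr (- p * real k + b * real (Suc k)) * (2 * 2 powr (- real k)) ^ DIM('a) :: real)"
      using summable_dyadic[of "p * (1 - s)" "2 powr (n + b)"] assms by simp
    fix z :: 'a assume z: "norm z < 1"
    show "\<exists>k. norm z < 2 * 2 powr (- real k) \<and> f z \<le> 2 powr (- p * real k + b * real (Suc k))"
    proof (cases "z = 0")
      case True
      then show ?thesis by (intro exI[of _ 0]) (auto simp: f)
    next
      case False
      then have "1 \<le> 1 / norm z" using z by simp
      then obtain k where k: "2 ^ k \<le> 1 / norm z" "1 / norm z < 2 ^ Suc k" by (rule dyadic_bracket)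
      have k1: "norm z \<le> 2 powr (- real k)"
        using k(1) False by (simp add: powr_minus powr_realpow field_simps)
      have k2: "2 powr (- real (Suc k)) \<le> norm z"
        using k(2) False by (simp add: powr_minus powr_realpow field_simps del: of_nat_Suc power_Suc)
      have "f z \<le> norm z powr p * norm z powr - b"
        by (simp add: f mult_right_mono)
      also have "\<dots> \<le> (2 powr (- real k)) powr p * (2 powr (- real (Suc k))) powr - b"
        using k1 k2 n assms by (intro mult_mono powr_mono2 powr_mono2') auto
      also have "\<dots> = 2 powr (- p * real k + b * real (Suc k))"
        by (simp add: powr_powr powr_add[symmetric] algebra_simps)
      finally show ?thesis
        using k1 by (intro exI[of _ k]) (auto intro: le_less_trans)
    qed
  qed (auto simp: n)
  have [measurable]: "f \<in> borel_measurable borel" unfolding f_def[abs_def] by measurable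
  have "(\<integral>\<^sup>+z. ennreal (f z) \<partial>lborel) = (\<integral>\<^sup>+z. (if 1 \<le> norm z then ennreal (f z) else 0)
      + (if norm z < 1 then ennreal (f z) else 0) \<partial>lborel)"
    by (intro nn_integral_cong) auto
  also have "\<dots> = (\<integral>\<^sup>+z. (if 1 \<le> norm z then ennreal (f z) else 0) \<partial>lborel)
      + (\<integral>\<^sup>+z. (if norm z < 1 then ennreal (f z) else 0) \<partial>lborel)"
    by (intro nn_integral_add) auto
  also have "\<dots> < \<infinity>" using out inn by simp
  finally show ?thesis by (simp add: f_def)
qed

text \<open>From 1 + |y| \<le> 1 + R + |x - y| and \<rho> \<le> min 1 |x - y| one gets 1 + |y| \<le>
  (2 + R)/\<rho> |x - y|. The explicit power of \<rho> matters: later \<rho> is half of the cutoff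
  at x and tends to 0 at the edge of its support.\<close>

lemma sing_le_tailw:
  fixes x y :: "'a::euclidean_space"
  assumes "0 < s" "1 < p" "norm x \<le> R" "0 < \<rho>" "\<rho> \<le> 1" "\<rho> \<le> dist x y"
  shows "sing s p x y \<le> ((2 + R) / \<rho>) powr (real DIM('a) + s * p) * tailw s p y"
proof -
  define b where "b = real DIM('a) + s * p"
  have b: "0 \<le> b" using assms by (simp add: b_def)
  have R: "0 \<le> R" using assms(3) norm_ge_zero order_trans by blast
  have d: "\<rho> \<le> norm (x - y)" using assms by (simp add: dist_norm)
  have "1 + norm y \<le> 1 + R + norm (x - y)"
    using norm_triangle_ineq4[of x "x - y"] assms by simp
  also have "\<dots> \<le> (1 + R) * (norm (x - y) / \<rho>) + norm (x - y) / \<rho>"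
  proof -
    have "1 \<le> norm (x - y) / \<rho>" using d assms by simp
    then have "(1 + R) * 1 \<le> (1 + R) * (norm (x - y) / \<rho>)" using R by (intro mult_left_mono) auto
    moreover have "norm (x - y) \<le> norm (x - y) / \<rho>"
      using assms by (simp add: le_divide_eq mult_left_le)
    ultimately show ?thesis by simp
  qed
  finally have *: "1 + norm y \<le> (2 + R) / \<rho> * norm (x - y)"
    by (simp add: field_simps add_divide_distrib)
  have "(1 + norm y) powr b \<le> ((2 + R) / \<rho> * norm (x - y)) powr b"
    using * b by (intro powr_mono2) auto
  also have "\<dots> = ((2 + R) / \<rho>) powr b * norm (x - y) powr b"
    by (rule powr_mult)
  finally have "(1 + norm y) powr b \<le> ((2 + R) / \<rho>) powr b * norm (x - y) powr b" .
  moreover have "0 < norm (x - y) powr b" using d \<open>0 < \<rho>\<close> by auto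
  moreover have "0 < 1 + norm y" by (simp add: add_pos_nonneg)
  ultimately have "1 / norm (x - y) powr b \<le> ((2 + R) / \<rho>) powr b * (1 + norm y) powr (- b)"
    by (simp add: powr_minus field_simps)
  moreover have "- real DIM('a) - s * p = - b" by (simp add: b_def)
  ultimately show ?thesis by (simp only: sing_def tailw_def b_def[symmetric])
qed

text \<open>On bounded sets the tail density is bounded below, so a tail integral controls the local
  integral of the power p - 1.\<close>

lemma tailw_lower:
  fixes y :: "'a::euclidean_space"
  assumes "0 < s" "1 < p" "norm y \<le> R"
  shows "1 \<le> (1 + R) powr (real DIM('a) + s * p) * tailw s p y"
proof -
  define b where "b = real DIM('a) + s * p"
  have "(1 + norm y) powr b \<le> (1 + R) powr b"
    using assms by (intro powr_mono2) (auto simp: b_def intro: add_nonneg_nonneg)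
  moreover have "0 < 1 + norm y" by (simp add: add_pos_nonneg)
  ultimately have "1 \<le> (1 + R) powr b * (1 + norm y) powr (- b)"
    by (simp add: powr_minus field_simps)
  moreover have "- real DIM('a) - s * p = - b" by (simp add: b_def)
  ultimately show ?thesis by (simp add: tailw_def b_def[symmetric])
qed

text \<open>Constants have finite tail. This allows adding a bound M to the majorant of the
  sequence.\<close>

lemma nn_integral_tailw_finite:
  assumes "0 < s" "s < 1" "1 < p"
  shows "(\<integral>\<^sup>+(y::'a::euclidean_space). ennreal (tailw s p y) \<partial>lborel) < \<infinity>"
proof -
  have neg: "- real DIM('a) - s * p \<le> 0"
    using mult_pos_pos[of s p] assms by linarith
  have "(\<integral>\<^sup>+(y::'a). ennreal (tailw s p y) \<partial>lborel)
      \<le> (\<integral>\<^sup>+(y::'a). indicator (ball 0 1) y + ennreal (min 1 (norm y powr p) * sing s p 0 y) \<partial>lborel)"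
  proof (intro nn_integral_mono)
    fix y :: 'a
    show "ennreal (tailw s p y)
        \<le> indicator (ball 0 1) y + ennreal (min 1 (norm y powr p) * sing s p 0 y)"
    proof (cases "norm y < 1")
      case True
      have "tailw s p y \<le> 1 powr (- real DIM('a) - s * p)"
        unfolding tailw_def using neg by (intro powr_mono2') auto
      then show ?thesis using True by (auto intro: add_increasing2 simp: ennreal_le_1)
    next
      case False
      have "tailw s p y \<le> norm y powr (- real DIM('a) - s * p)"
        unfolding tailw_def using neg False by (intro powr_mono2') auto
      also have "\<dots> = min 1 (norm y powr p) * sing s p 0 y"
      proof -
        have "1 \<le> norm y powr p" using False assms by (intro ge_one_powr_ge_zero) auto
        then show ?thesis by (simp add: sing_def powr_diff powr_minus powr_add field_simps)
      qed
      finally show ?thesis using False by (auto intro: ennreal_leI)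
    qed
  qed
  also have "\<dots> = emeasure lborel (ball (0::'a) 1)
      + (\<integral>\<^sup>+(y::'a). ennreal (min 1 (norm y powr p) * sing s p 0 y) \<partial>lborel)"
    by (subst nn_integral_add) (auto intro!: borel_measurable_indicator borel_open)
  also have "\<dots> < \<infinity>"
    using nn_integral_singular_finite[OF assms, where 'a='a] emeasure_bounded_finite[OF bounded_ball, of "0::'a" 1]
    by simp
  finally show ?thesis .
qed

section \<open>Passage to the limit\<close>

text \<open>A form of Vitali's convergence theorem in which uniform integrability is expressed by
  an \<open>\<epsilon>\<close>-Young splitting; it replaces weak convergence in \<open>L\<^sup>p\<close>.\<close>

lemma vitali_young_convergence:
  fixes F :: "nat \<Rightarrow> 'a \<Rightarrow> real"
  assumes Fm [measurable]: "\<And>j. F j \<in> borel_measurable M" and Gm [measurable]: "G \<in> borel_measurable M"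
    and lim: "AE x in M. (\<lambda>j. F j x) \<longlonglongrightarrow> G x"
    and Pm [measurable]: "\<And>j. P j \<in> borel_measurable M"
    and P: "\<And>j. (\<integral>\<^sup>+x. ennreal (P j x) \<partial>M) \<le> ennreal B"
    and dom: "\<And>\<epsilon>. 0 < \<epsilon> \<Longrightarrow> \<exists>Q. Q \<in> borel_measurable M \<and> (\<integral>\<^sup>+x. ennreal (Q x) \<partial>M) < \<infinity> \<and>
       (\<forall>j. AE x in M. \<bar>F j x\<bar> \<le> \<epsilon> * \<bar>P j x\<bar> + Q x)"
    and Pnn: "\<And>j x. 0 \<le> P j x"
  shows "integrable M G" "(\<lambda>j. integral\<^sup>L M (F j)) \<longlonglongrightarrow> integral\<^sup>L M G" "\<And>j. integrable M (F j)"
proof -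
  have bound: "(\<integral>\<^sup>+x. ennreal (\<epsilon> * \<bar>P j x\<bar>) \<partial>M) \<le> ennreal (\<epsilon> * B)" if "0 < \<epsilon>" for j \<epsilon>
  proof -
    have "(\<integral>\<^sup>+x. ennreal (\<epsilon> * \<bar>P j x\<bar>) \<partial>M) = ennreal \<epsilon> * (\<integral>\<^sup>+x. ennreal (P j x) \<partial>M)"
      using Pnn that by (subst nn_integral_cmult[symmetric]) (auto simp: ennreal_mult)
    also have "\<dots> \<le> ennreal \<epsilon> * ennreal B" using P by (intro mult_left_mono) auto
    also have "\<dots> = ennreal (\<epsilon> * B)" using that by (simp add: ennreal_mult')
    finally show ?thesis .
  qed
  obtain Q1 where Q1 [measurable]: "Q1 \<in> borel_measurable M" and Q1f: "(\<integral>\<^sup>+x. ennreal (Q1 x) \<partial>M) < \<infinity>"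
    and Q1d: "\<And>j. AE x in M. \<bar>F j x\<bar> \<le> 1 * \<bar>P j x\<bar> + Q1 x"
    using dom[of 1] by auto
  have Fb: "(\<integral>\<^sup>+x. ennreal \<bar>F j x\<bar> \<partial>M) \<le> ennreal B + (\<integral>\<^sup>+x. ennreal (Q1 x) \<partial>M)" for j
  proof -
    have "(\<integral>\<^sup>+x. ennreal \<bar>F j x\<bar> \<partial>M) \<le> (\<integral>\<^sup>+x. ennreal (1 * \<bar>P j x\<bar>) + ennreal (Q1 x) \<partial>M)"
    proof (rule nn_integral_mono_AE, use Q1d[of j] in eventually_elim)
      fix x assume "\<bar>F j x\<bar> \<le> 1 * \<bar>P j x\<bar> + Q1 x"
      then have "ennreal \<bar>F j x\<bar> \<le> ennreal (\<bar>P j x\<bar> + max 0 (Q1 x))" by (intro ennreal_leI) auto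
      also have "\<dots> = ennreal \<bar>P j x\<bar> + ennreal (max 0 (Q1 x))" by (intro ennreal_plus) auto
      also have "ennreal (max 0 (Q1 x)) = ennreal (Q1 x)" by (auto simp: max_def ennreal_neg)
      finally show "ennreal \<bar>F j x\<bar> \<le> ennreal (1 * \<bar>P j x\<bar>) + ennreal (Q1 x)" by simp
    qed
    also have "\<dots> = (\<integral>\<^sup>+x. ennreal (1 * \<bar>P j x\<bar>) \<partial>M) + (\<integral>\<^sup>+x. ennreal (Q1 x) \<partial>M)"
      by (intro nn_integral_add) auto
    also have "\<dots> \<le> ennreal B + (\<integral>\<^sup>+x. ennreal (Q1 x) \<partial>M)"
      using bound[of 1 j] by (intro add_right_mono) auto
    finally show ?thesis .
  qed
  show Fi: "integrable M (F j)" for j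
    using Fb[of j] Q1f by (intro integrableI_bounded) (auto simp: le_less_trans)
  have "(\<integral>\<^sup>+x. ennreal \<bar>G x\<bar> \<partial>M) = (\<integral>\<^sup>+x. liminf (\<lambda>j. ennreal \<bar>F j x\<bar>) \<partial>M)"
  proof (rule nn_integral_cong_AE, use lim in eventually_elim)
    fix x assume "(\<lambda>j. F j x) \<longlonglongrightarrow> G x"
    then have "(\<lambda>j. ennreal \<bar>F j x\<bar>) \<longlonglongrightarrow> ennreal \<bar>G x\<bar>" by (intro tendsto_ennrealI tendsto_intros)
    then show "ennreal \<bar>G x\<bar> = liminf (\<lambda>j. ennreal \<bar>F j x\<bar>)"
      by (intro lim_imp_Liminf[symmetric] trivial_limit_sequentially)
  qed
  also have "\<dots> \<le> liminf (\<lambda>j. \<integral>\<^sup>+x. ennreal \<bar>F j x\<bar> \<partial>M)" by (intro nn_integral_liminf) auto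
  also have "\<dots> \<le> liminf (\<lambda>j::nat. ennreal B + (\<integral>\<^sup>+x. ennreal (Q1 x) \<partial>M))"
    using Fb by (intro Liminf_mono) auto
  also have "\<dots> = ennreal B + (\<integral>\<^sup>+x. ennreal (Q1 x) \<partial>M)"
    by (intro lim_imp_Liminf) auto
  also have "\<dots> < \<infinity>" using Q1f by simp
  finally show Gi: "integrable M G" by (intro integrableI_bounded) auto
  show "(\<lambda>j. integral\<^sup>L M (F j)) \<longlonglongrightarrow> integral\<^sup>L M G"
  proof (rule LIMSEQ_I)
    fix e :: real assume e: "0 < e"
    \<comment> \<open>The summand 1 keeps \<epsilon> well defined and positive when B is 0.\<close>
    define \<epsilon> where "\<epsilon> = e / (2 * (\<bar>B\<bar> + 1))"
    have eps: "0 < \<epsilon>" "\<epsilon> * \<bar>B\<bar> < e / 2"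
      using e by (auto simp: \<epsilon>_def field_simps)
    obtain Q where Q [measurable]: "Q \<in> borel_measurable M" and Qf: "(\<integral>\<^sup>+x. ennreal (Q x) \<partial>M) < \<infinity>"
      and Qd: "\<And>j. AE x in M. \<bar>F j x\<bar> \<le> \<epsilon> * \<bar>P j x\<bar> + Q x"
      using dom[OF eps(1)] by auto
    have mQ: "ennreal (norm (max 0 (Q x))) = ennreal (Q x)" for x
      by (auto simp: max_def ennreal_neg)
    have Qi: "integrable M (\<lambda>x. max 0 (Q x))"
      using Qf by (intro integrableI_bounded) (auto simp only: mQ, measurable)
    \<comment> \<open>The error is truncated at an integrable level, so dominated convergence
      applies to \<open>H\<close>. Where the truncation acts, the splitting bounds what is cut off
      by \<open>\<epsilon> * P j x\<close>.\<close>
    define H where "H j x = min \<bar>F j x - G x\<bar> (max 0 (Q x) + \<bar>G x\<bar>)" for j x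
    have Hm [measurable]: "H j \<in> borel_measurable M" for j unfolding H_def[abs_def] by measurable
    have Hlim: "AE x in M. (\<lambda>j. H j x) \<longlonglongrightarrow> 0"
      using lim
    proof eventually_elim
      fix x assume "(\<lambda>j. F j x) \<longlonglongrightarrow> G x"
      then have "(\<lambda>j. H j x) \<longlonglongrightarrow> min \<bar>G x - G x\<bar> (max 0 (Q x) + \<bar>G x\<bar>)"
        unfolding H_def by (intro tendsto_intros)
      then show "(\<lambda>j. H j x) \<longlonglongrightarrow> 0" by simp
    qed
    have Hw: "integrable M (\<lambda>x. max 0 (Q x) + \<bar>G x\<bar>)" using Qi Gi by auto
    have Hd: "AE x in M. norm (H j x) \<le> max 0 (Q x) + \<bar>G x\<bar>" for j
      by (auto simp: H_def)
    have Hl: "(\<lambda>j. integral\<^sup>L M (H j)) \<longlonglongrightarrow> integral\<^sup>L M (\<lambda>x. 0)"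
      by (rule integral_dominated_convergence[OF _ _ Hw Hlim Hd]) auto
    have Hi: "integrable M (H j)" for j
      by (rule integrable_dominated_convergence2[OF _ _ Hw Hlim Hd]) auto
    from Hl have "(\<lambda>j. integral\<^sup>L M (H j)) \<longlonglongrightarrow> 0" by simp
    then obtain N where N: "\<And>j. N \<le> j \<Longrightarrow> \<bar>integral\<^sup>L M (H j)\<bar> < e / 2"
      using LIMSEQ_D[of _ 0 "e / 2"] e by fastforce
    have "norm (integral\<^sup>L M (F j) - integral\<^sup>L M G) < e" if "N \<le> j" for j
    proof -
      have Pi: "integrable M (P j)"
        using P[of j] Pnn by (intro integrableI_bounded) (auto simp: le_less_trans)
      have Pint: "integral\<^sup>L M (P j) \<le> \<bar>B\<bar>"
      proof -
        have "ennreal (integral\<^sup>L M (P j)) = (\<integral>\<^sup>+x. ennreal (P j x) \<partial>M)"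
          using Pi Pnn by (intro nn_integral_eq_integral[symmetric]) auto
        also have "\<dots> \<le> ennreal \<bar>B\<bar>" using P[of j] by (rule order_trans) (auto intro: ennreal_leI)
        finally show ?thesis by (simp add: ennreal_le_iff)
      qed
      have "norm (integral\<^sup>L M (F j) - integral\<^sup>L M G) = norm (\<integral>x. F j x - G x \<partial>M)"
        using Fi Gi by simp
      also have "\<dots> \<le> (\<integral>x. norm (F j x - G x) \<partial>M)" by (rule integral_norm_bound)
      also have "\<dots> \<le> (\<integral>x. H j x + \<epsilon> * P j x \<partial>M)"
      proof (rule integral_mono_AE)
        show "integrable M (\<lambda>x. norm (F j x - G x))" using Fi Gi by auto
        show "integrable M (\<lambda>x. H j x + \<epsilon> * P j x)" using Hi Pi by auto
        show "AE x in M. norm (F j x - G x) \<le> H j x + \<epsilon> * P j x"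
          using Qd[of j]
        proof eventually_elim
          fix x assume "\<bar>F j x\<bar> \<le> \<epsilon> * \<bar>P j x\<bar> + Q x"
          moreover have "0 \<le> \<epsilon> * P j x" using eps Pnn by simp
          ultimately show "norm (F j x - G x) \<le> H j x + \<epsilon> * P j x"
            using Pnn[of j x] by (auto simp: H_def min_def max_def)
        qed
      qed
      also have "\<dots> = integral\<^sup>L M (H j) + \<epsilon> * integral\<^sup>L M (P j)" using Hi Pi by simp
      also have "\<dots> < e / 2 + e / 2"
      proof -
        have "\<epsilon> * integral\<^sup>L M (P j) \<le> \<epsilon> * \<bar>B\<bar>" using Pint eps by (intro mult_left_mono) auto
        then show ?thesis using N[OF that] eps by linarith
      qed
      finally show ?thesis by simp
    qed
    then show "\<exists>N. \<forall>j\<ge>N. norm (integral\<^sup>L M (F j) - integral\<^sup>L M G) < e" by blast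
  qed
qed

section \<open>Smooth functions and mollifiers\<close>

lemma Ck_SucI:
  assumes "\<And>x. (f has_derivative f' x) (at x)" "\<And>v. Ck k (\<lambda>x. f' x v)"
  shows "Ck (Suc k) f"
proof -
  have "frechet_derivative f (at x) = f' x" for x
    using frechet_derivative_at[OF assms(1)] by simp
  then show ?thesis using assms by (auto simp: differentiable_def)
qed

lemma Ck_Suc_has_derivative:
  "Ck (Suc k) f \<Longrightarrow> (f has_derivative frechet_derivative f (at x)) (at x)"
  by (simp add: frechet_derivative_works)

lemma Ck_SucD: "Ck (Suc k) f \<Longrightarrow> Ck k f"
proof (induction k arbitrary: f)
  case 0
  then show ?case
    by (auto intro!: continuous_at_imp_continuous_on differentiable_imp_continuous_within)
next
  case (Suc k)
  have "\<forall>v. Ck k (\<lambda>x. frechet_derivative f (at x) v)"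
    using Suc.prems by (auto intro: Suc.IH simp del: Ck.simps simp: Ck.simps(2)[of "Suc k"])
  then show ?case using Suc.prems by auto
qed

lemma Ck_const: "Ck k (\<lambda>x. c)"
proof (induction k arbitrary: c)
  case (Suc k)
  show ?case
    by (rule Ck_SucI[where f' = "\<lambda>x v. 0"]) (auto intro: Suc)
qed simp

lemma Ck_inner: "Ck k (\<lambda>x::'a::real_inner. x \<bullet> v)"
proof (cases k)
  case (Suc j)
  show ?thesis unfolding Suc
    by (rule Ck_SucI[where f' = "\<lambda>x h. h \<bullet> v"]) (auto intro!: derivative_eq_intros Ck_const)
qed (auto intro!: continuous_intros)

lemma Ck_add: "Ck k f \<Longrightarrow> Ck k g \<Longrightarrow> Ck k (\<lambda>x. f x + g x)"
proof (induction k arbitrary: f g)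
  case (Suc k)
  note f = Ck_Suc_has_derivative[OF Suc.prems(1)] and g = Ck_Suc_has_derivative[OF Suc.prems(2)]
  show ?case
    using Suc.prems
    by (intro Ck_SucI[OF has_derivative_add[OF f g]] Suc.IH) auto
qed (auto intro: continuous_intros)

lemma Ck_mult: "Ck k f \<Longrightarrow> Ck k g \<Longrightarrow> Ck k (\<lambda>x. f x * g x)"
proof (induction k arbitrary: f g)
  case (Suc k)
  note f = Ck_Suc_has_derivative[OF Suc.prems(1)] and g = Ck_Suc_has_derivative[OF Suc.prems(2)]
  show ?case
    using Suc.prems Ck_SucD[OF Suc.prems(1)] Ck_SucD[OF Suc.prems(2)]
    by (intro Ck_SucI[OF has_derivative_mult[OF f g]] Ck_add Suc.IH) auto
qed (auto intro: continuous_intros)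

lemma Ck_scale: "Ck k f \<Longrightarrow> Ck k (\<lambda>x. f (c *\<^sub>R x))"
proof (induction k arbitrary: f)
  case 0
  then show ?case
    by (auto intro!: continuous_on_compose2[of UNIV f] continuous_intros)
next
  case (Suc k)
  have "((\<lambda>x. f (c *\<^sub>R x)) has_derivative (\<lambda>v. frechet_derivative f (at (c *\<^sub>R x)) (c *\<^sub>R v))) (at x)" for x
    by (rule has_derivative_compose[OF _ Ck_Suc_has_derivative[OF Suc.prems]])
      (auto intro!: derivative_eq_intros)
  moreover have "Ck k (\<lambda>x. frechet_derivative f (at (c *\<^sub>R x)) (c *\<^sub>R v))" for v
    using Suc.prems by (intro Suc.IH[of "\<lambda>x. frechet_derivative f (at x) (c *\<^sub>R v)"]) simp
  ultimately show ?case by (rule Ck_SucI)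
qed

text \<open>The functions t^(-m) exp(-1/t), extended by 0. Differentiation maps this family into its
  own linear span, which turns smoothness of the bump into an induction.\<close>

definition flat_exp :: "nat \<Rightarrow> real \<Rightarrow> real" where
  "flat_exp m t = (if 0 < t then inverse t ^ m * exp (- inverse t) else 0)"

lemma flat_exp_tendsto_0: "(flat_exp m \<longlongrightarrow> 0) (at 0)"
proof -
  have "((\<lambda>t::real. inverse t ^ m / exp (inverse t)) \<longlongrightarrow> 0) (at_right 0)"
    by (rule filterlim_compose[OF tendsto_power_div_exp_0 filterlim_inverse_at_top_right])
  then have "((\<lambda>t::real. inverse t ^ m * exp (- inverse t)) \<longlongrightarrow> 0) (at_right 0)"
    by (simp add: exp_minus field_simps)
  then have r: "(flat_exp m \<longlongrightarrow> 0) (at_right 0)"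
    by (rule Lim_transform_eventually) (auto simp: flat_exp_def eventually_at_right_less
        intro!: eventually_mono[OF eventually_at_right_less[of 0]])
  have "((\<lambda>t::real. 0::real) \<longlongrightarrow> 0) (at_left 0)" by simp
  then have l: "(flat_exp m \<longlongrightarrow> 0) (at_left 0)"
    by (rule Lim_transform_eventually) (auto simp: flat_exp_def eventually_at_filter)
  show ?thesis using l r by (rule filterlim_split_at)
qed

lemma flat_exp_derivative:
  "(flat_exp m has_real_derivative - real m * flat_exp (Suc m) t + flat_exp (Suc (Suc m)) t) (at t)"
proof (cases t "0::real" rule: linorder_cases)
  case less
  have "((\<lambda>t. 0) has_real_derivative 0) (at t)" by simp
  then have "(flat_exp m has_real_derivative 0) (at t)"
    by (rule has_field_derivative_transform_within_open[where S = "{..<0}"])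
      (use less in \<open>auto simp: flat_exp_def\<close>)
  then show ?thesis using less by (simp add: flat_exp_def)
next
  case equal
  \<comment> \<open>At the origin the difference quotient of \<open>flat_exp m\<close> is
    \<open>flat_exp (Suc m)\<close>, which tends to 0.\<close>
  have "((\<lambda>y. (flat_exp m y - flat_exp m 0) / (y - 0)) \<longlongrightarrow> 0) (at 0)"
    using flat_exp_tendsto_0[of "Suc m"]
    by (rule Lim_transform_eventually)
      (auto simp: flat_exp_def eventually_at_filter field_simps)
  then have "(flat_exp m has_real_derivative 0) (at 0)"
    by (simp add: has_field_derivative_iff)
  then show ?thesis using equal by (simp add: flat_exp_def)
next
  case greater
  have "((\<lambda>t. inverse t ^ m * exp (- inverse t)) has_real_derivative
      - real m * (inverse t ^ Suc m * exp (- inverse t)) + inverse t ^ Suc (Suc m) * exp (- inverse t)) (at t)"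
  proof -
    have "((\<lambda>t. inverse t ^ m) has_real_derivative - real m * inverse t ^ Suc m) (at t)"
    proof (cases m)
      case (Suc k)
      then show ?thesis
        using DERIV_power_Suc[OF DERIV_inverse[of t UNIV], of k] greater
        by (simp add: algebra_simps)
    qed simp
    moreover have "((\<lambda>t. exp (- inverse t)) has_real_derivative exp (- inverse t) * inverse t ^ 2) (at t)"
      using greater by (auto intro!: derivative_eq_intros simp: power2_eq_square)
    ultimately show ?thesis
      by (rule DERIV_cong[OF DERIV_mult]) (simp add: power2_eq_square algebra_simps)
  qed
  then have "(flat_exp m has_real_derivative
      - real m * (inverse t ^ Suc m * exp (- inverse t)) + inverse t ^ Suc (Suc m) * exp (- inverse t)) (at t)"
    by (rule has_field_derivative_transform_within_open[where S = "{0<..}"])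
      (use greater in \<open>auto simp: flat_exp_def\<close>)
  then show ?thesis using greater by (simp add: flat_exp_def)
qed

lemma continuous_on_flat_exp: "continuous_on UNIV (flat_exp m)"
  using flat_exp_derivative
  by (auto intro!: continuous_at_imp_continuous_on DERIV_isCont)

text \<open>The smooth factor \<open>P\<close> and the index \<open>m\<close> are kept general so
  that the induction closes: a derivative is a sum of three products of the same form, with indices
  m, m + 1 and m + 2.\<close>

lemma Ck_flat_exp:
  fixes P :: "'a::euclidean_space \<Rightarrow> real"
  assumes "\<And>j. Ck j P"
  shows "Ck k (\<lambda>x. P x * flat_exp m (1 - x \<bullet> x))"
  using assms
proof (induction k arbitrary: P m)
  case 0
  have "continuous_on UNIV P" using "0"[of 0] by simp
  then show ?case
    by (auto intro!: continuous_intros continuous_on_compose2[OF continuous_on_flat_exp])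
next
  case (Suc k)
  note P = Ck_Suc_has_derivative[OF Suc.prems]
  have E: "((\<lambda>x. flat_exp m (1 - x \<bullet> x)) has_derivative
     (\<lambda>h. (- real m * flat_exp (Suc m) (1 - x \<bullet> x) + flat_exp (Suc (Suc m)) (1 - x \<bullet> x)) * (- 2 * (h \<bullet> x)))) (at x)" for x :: 'a
    by (rule has_derivative_compose[of "\<lambda>x. 1 - x \<bullet> x", OF _ flat_exp_derivative[unfolded has_field_derivative_def]])
      (auto intro!: derivative_eq_intros simp: inner_commute)
  have D: "Ck j (\<lambda>x. frechet_derivative P (at x) v)" for j v
    using Suc.prems[of "Suc j"] by simp
  show ?case
  proof (rule Ck_SucI)
    show "((\<lambda>x. P x * flat_exp m (1 - x \<bullet> x)) has_derivative
       (\<lambda>v. (frechet_derivative P (at x) v * flat_exp m (1 - x \<bullet> x)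
          + (P x * (2 * real m * (x \<bullet> v))) * flat_exp (Suc m) (1 - x \<bullet> x))
          + (P x * ((- 2) * (x \<bullet> v))) * flat_exp (Suc (Suc m)) (1 - x \<bullet> x))) (at x)" for x
      by (rule has_derivative_eq_rhs[OF has_derivative_mult[OF P E]])
        (auto simp: algebra_simps inner_commute)
    show "Ck k (\<lambda>x. (frechet_derivative P (at x) v * flat_exp m (1 - x \<bullet> x)
          + (P x * (2 * real m * (x \<bullet> v))) * flat_exp (Suc m) (1 - x \<bullet> x))
          + (P x * ((- 2) * (x \<bullet> v))) * flat_exp (Suc (Suc m)) (1 - x \<bullet> x))" for v
      using Suc.prems D by (intro Ck_add Suc.IH Ck_mult Ck_const Ck_inner)
  qed
qed

lemma nn_integral_lborel_rescale:
  fixes f :: "'a::euclidean_space \<Rightarrow> ennreal"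
  assumes [measurable]: "f \<in> borel_measurable borel" and "0 < c"
  shows "(\<integral>\<^sup>+x. f x \<partial>lborel) = ennreal (c ^ DIM('a)) * (\<integral>\<^sup>+x. f (c *\<^sub>R x) \<partial>lborel)"
proof -
  have "(\<integral>\<^sup>+x. f x \<partial>lborel)
      = (\<integral>\<^sup>+x. f x \<partial>density (distr lborel borel (\<lambda>x::'a. 0 + c *\<^sub>R x)) (\<lambda>_. ennreal (\<bar>c\<bar> ^ DIM('a))))"
    using assms by (subst lborel_affine[of c 0]) auto
  then show ?thesis
    using assms by (simp add: nn_integral_density nn_integral_distr nn_integral_cmult)
qed

text \<open>Rescaled copies of one normalised bump. The supremum bound with \<open>C\<close>
  independent of \<epsilon> is recorded because on the support it allows comparing the mollifier
  with the singular kernel; \<open>C\<close> is the reciprocal of the mass of the unscaled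
  bump.\<close>

lemma mollifier_exists:
  obtains C :: real where "0 \<le> C"
    "\<And>\<epsilon>. 0 < \<epsilon> \<Longrightarrow> \<exists>\<phi> :: 'a::euclidean_space \<Rightarrow> real. (\<forall>k. Ck k \<phi>) \<and> (\<forall>x. 0 \<le> \<phi> x) \<and>
       (\<forall>x. \<epsilon> < norm x \<longrightarrow> \<phi> x = 0) \<and> (\<forall>x. \<phi> x \<le> C / \<epsilon> ^ DIM('a)) \<and>
       (\<integral>\<^sup>+x. ennreal (\<phi> x) \<partial>lborel) = 1"
proof -
  define b where "b x = flat_exp 0 (1 - x \<bullet> x)" for x :: 'a
  have bk: "Ck k b" for k
    using Ck_flat_exp[OF Ck_const[of _ 1], of k 0] by (simp add: b_def[abs_def])
  have b0: "0 \<le> b x" "b x \<le> 1" for x by (auto simp: b_def flat_exp_def)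
  have sup: "b x = 0" if "1 \<le> norm x" for x
  proof -
    have "1 \<le> x \<bullet> x" using one_le_power[OF that, of 2] by (simp add: power2_norm_eq_inner)
    then show ?thesis by (simp add: b_def flat_exp_def)
  qed
  have cont: "continuous_on UNIV b" using bk[of 0] by simp
  then have [measurable]: "b \<in> borel_measurable borel" by (rule borel_measurable_continuous_onI)
  define I where "I = (\<integral>\<^sup>+x. ennreal (b x) \<partial>lborel)"
  have "I \<le> (\<integral>\<^sup>+x. indicator (ball (0::'a) 1) x \<partial>lborel)"
    unfolding I_def using b0 sup
    by (intro nn_integral_mono) (auto simp: indicator_def not_less ennreal_le_1)
  also have "\<dots> = emeasure lborel (ball (0::'a) 1)" by simp
  also have "\<dots> < \<infinity>" using emeasure_bounded_finite[OF bounded_ball] by auto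
  finally have Ifin: "I < \<infinity>" .
  have "I \<noteq> 0"
  proof
    assume "I = 0"
    then have "AE x in lborel. b x = 0"
      using b0 by (simp add: I_def nn_integral_0_iff_AE ennreal_eq_0_iff antisym_conv)
    moreover have "AE x in lborel. x \<in> ball (0::'a) 1 \<longrightarrow> b x \<noteq> 0"
      by (auto simp: b_def flat_exp_def power2_norm_eq_inner[symmetric] power_less_one_iff)
    ultimately have "AE x in lborel. x \<notin> ball (0::'a) 1" by eventually_elim auto
    then have "emeasure lborel (ball (0::'a) 1) = 0"
      by (subst (asm) AE_iff_measurable[OF _ refl]) (auto simp: ball_def)
    moreover have "emeasure lborel (ball (0::'a) 1) \<noteq> 0"
      using content_ball_pos[of 1 "0::'a"] by (auto simp: measure_def)
    ultimately show False by simp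
  qed
  define J where "J = enn2real I"
  have J: "I = ennreal J" "0 < J"
    using Ifin \<open>I \<noteq> 0\<close> by (auto simp: J_def less_top enn2real_positive_iff zero_less_iff_neq_zero)
  show ?thesis
  proof
    show "0 \<le> 1 / J" using J by simp
    fix \<epsilon> :: real assume e: "0 < \<epsilon>"
    define \<phi> where "\<phi> x = 1 / (J * \<epsilon> ^ DIM('a)) * b ((1 / \<epsilon>) *\<^sub>R x)" for x
    have "(\<integral>\<^sup>+x. ennreal (\<phi> x) \<partial>lborel)
        = ennreal (\<epsilon> ^ DIM('a)) * (\<integral>\<^sup>+x. ennreal (\<phi> (\<epsilon> *\<^sub>R x)) \<partial>lborel)"
      using e by (intro nn_integral_lborel_rescale) (auto simp: \<phi>_def[abs_def])
    also have "(\<integral>\<^sup>+x. ennreal (\<phi> (\<epsilon> *\<^sub>R x)) \<partial>lborel) = ennreal (1 / (J * \<epsilon> ^ DIM('a))) * I"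
      unfolding I_def using e J b0
      by (subst nn_integral_cmult[symmetric]) (auto simp: \<phi>_def ennreal_mult[symmetric])
    also have "ennreal (\<epsilon> ^ DIM('a)) * \<dots> = ennreal (\<epsilon> ^ DIM('a) * (1 / (J * \<epsilon> ^ DIM('a)) * J))"
      using J e by (simp add: ennreal_mult[symmetric])
    also have "\<dots> = 1" using J e by simp
    finally have "(\<integral>\<^sup>+x. ennreal (\<phi> x) \<partial>lborel) = 1" .
    moreover have "Ck k \<phi>" for k
      unfolding \<phi>_def[abs_def] by (intro Ck_mult Ck_const Ck_scale bk)
    moreover have "0 \<le> \<phi> x" for x using J e b0 by (simp add: \<phi>_def)
    moreover have "\<phi> x \<le> 1 / J / \<epsilon> ^ DIM('a)" for x
      using J e b0(2) by (simp add: \<phi>_def field_simps)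
    moreover have "\<phi> x = 0" if "\<epsilon> < norm x" for x
      using that e by (simp add: \<phi>_def sup)
    ultimately show "\<exists>\<phi> :: 'a \<Rightarrow> real. (\<forall>k. Ck k \<phi>) \<and> (\<forall>x. 0 \<le> \<phi> x) \<and>
       (\<forall>x. \<epsilon> < norm x \<longrightarrow> \<phi> x = 0) \<and> (\<forall>x. \<phi> x \<le> 1 / J / \<epsilon> ^ DIM('a)) \<and>
       (\<integral>\<^sup>+x. ennreal (\<phi> x) \<partial>lborel) = 1"
      by blast
  qed
qed

lemma Ck_0_bounded:
  fixes f :: "'a::euclidean_space \<Rightarrow> real"
  assumes "continuous_on UNIV f" "\<And>x. R < norm x \<Longrightarrow> f x = 0"
  shows "\<exists>B\<ge>0. \<forall>x. \<bar>f x\<bar> \<le> B"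
proof -
  have "bounded (f ` cball 0 R)"
    using assms by (intro compact_imp_bounded compact_continuous_image)
      (auto intro: continuous_on_subset)
  then obtain B where B: "0 < B" "\<And>x. x \<in> cball 0 R \<Longrightarrow> \<bar>f x\<bar> \<le> B"
    by (auto simp: bounded_pos)
  have "\<bar>f x\<bar> \<le> B" for x
    using B(1) B(2)[of x] assms(2)[of x] by (cases "R < norm x") auto
  then show ?thesis using B(1) less_imp_le by blast
qed

lemma frechet_derivative_eq_0:
  fixes f :: "'a::euclidean_space \<Rightarrow> real"
  assumes "\<And>x. R < norm x \<Longrightarrow> f x = 0" "R < norm x"
  shows "frechet_derivative f (at x) v = 0"
proof -
  have o: "open {x::'a. R < norm x}" by (intro open_Collect_less continuous_intros)
  have "((\<lambda>x. 0::real) has_derivative (\<lambda>v. 0)) (at x)" by simp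
  then have "(f has_derivative (\<lambda>v. 0)) (at x)"
    by (rule has_derivative_transform_within_open[OF _ o]) (use assms in auto)
  then show ?thesis using frechet_derivative_at by metis
qed

lemma smooth_lipschitz:
  fixes f :: "'a::euclidean_space \<Rightarrow> real"
  assumes "\<And>k. Ck k f" "\<And>x. R < norm x \<Longrightarrow> f x = 0"
  obtains L where "0 \<le> L" "\<And>x h. \<bar>frechet_derivative f (at x) h\<bar> \<le> L * norm h"
    "\<And>x y. \<bar>f x - f y\<bar> \<le> L * norm (x - y)"
proof -
  have "\<exists>B. 0 \<le> B \<and> (\<forall>x. \<bar>frechet_derivative f (at x) b\<bar> \<le> B)" for b
  proof -
    have "continuous_on UNIV (\<lambda>x. frechet_derivative f (at x) b)"
      using assms(1)[of 1] by simp
    moreover have "frechet_derivative f (at x) b = 0" if "R < norm x" for x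
      using assms(2) that by (rule frechet_derivative_eq_0[of R f])
    ultimately show ?thesis
      using Ck_0_bounded[of "\<lambda>x. frechet_derivative f (at x) b" R] by simp
  qed
  then obtain B where B: "\<And>b. 0 \<le> B b" "\<And>b x. \<bar>frechet_derivative f (at x) b\<bar> \<le> B b"
    by metis
  define L where "L = (\<Sum>b\<in>Basis. B b)"
  have der: "(f has_derivative frechet_derivative f (at x)) (at x)" for x
    using Ck_Suc_has_derivative[OF assms(1)] .
  have *: "\<bar>frechet_derivative f (at x) h\<bar> \<le> L * norm h" for x h
  proof -
    have lin: "linear (frechet_derivative f (at x))"
      using der by (rule has_derivative_linear)
    have "frechet_derivative f (at x) h = frechet_derivative f (at x) (\<Sum>b\<in>Basis. (h \<bullet> b) *\<^sub>R b)"
      by (simp add: euclidean_representation)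
    also have "\<dots> = (\<Sum>b\<in>Basis. (h \<bullet> b) * frechet_derivative f (at x) b)"
      by (simp add: linear_sum[OF lin] linear_scale[OF lin])
    also have "\<bar>\<dots>\<bar> \<le> (\<Sum>b\<in>Basis. \<bar>(h \<bullet> b) * frechet_derivative f (at x) b\<bar>)" by (rule sum_abs)
    also have "\<dots> \<le> (\<Sum>b\<in>Basis. norm h * B b)"
      using B by (intro sum_mono) (auto simp: abs_mult intro!: mult_mono Basis_le_norm)
    finally show ?thesis by (simp add: L_def sum_distrib_left mult.commute)
  qed
  have L: "0 \<le> L" using B by (auto simp: L_def sum_nonneg)
  have "\<bar>f x - f y\<bar> \<le> L * norm (x - y)" for x y
  proof -
    have "norm (f x - f y) \<le> L * norm (x - y)"
      by (rule differentiable_bound[of UNIV f "\<lambda>x. frechet_derivative f (at x)"])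
        (use der * in \<open>auto intro!: onorm_bound L\<close>)
    then show ?thesis by simp
  qed
  with L * show ?thesis by (rule that)
qed

section \<open>Convolution with a smooth kernel\<close>

definition conv :: "('a::euclidean_space \<Rightarrow> real) \<Rightarrow> ('a \<Rightarrow> real) \<Rightarrow> 'a \<Rightarrow> real" where
  "conv \<phi> \<eta> x = (\<integral>y. \<phi> (x - y) * \<eta> y \<partial>lborel)"

lemma integrable_conv:
  fixes \<phi> \<eta> :: "'a::euclidean_space \<Rightarrow> real"
  assumes "continuous_on UNIV \<phi>" "\<And>x. R < norm x \<Longrightarrow> \<phi> x = 0" "integrable lborel \<eta>"
  shows "integrable lborel (\<lambda>y. \<phi> (x - y) * \<eta> y)"
proof -
  obtain B where B: "0 \<le> B" "\<And>x. \<bar>\<phi> x\<bar> \<le> B" using Ck_0_bounded[OF assms(1,2)] by blast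
  have [measurable]: "\<phi> \<in> borel_measurable borel" "\<eta> \<in> borel_measurable borel"
    using assms by (auto intro: borel_measurable_continuous_onI)
  have "integrable lborel (\<lambda>y. B * \<eta> y)" using assms by simp
  then show ?thesis
    by (rule Bochner_Integration.integrable_bound) (use B in \<open>auto simp: abs_mult intro!: mult_right_mono\<close>)
qed

text \<open>All derivatives fall on \<phi>, so integrability of \<eta> suffices. The induction runs
  over \<phi>, since its directional derivatives are again smooth with bounded support.\<close>

lemma Ck_conv:
  fixes \<phi> \<eta> :: "'a::euclidean_space \<Rightarrow> real"
  assumes "\<And>k. Ck k \<phi>" "\<And>x. R < norm x \<Longrightarrow> \<phi> x = 0" "integrable lborel \<eta>"
  shows "Ck k (conv \<phi> \<eta>)"
  using assms(1,2)
proof (induction k arbitrary: \<phi>)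
  case 0
  have cont: "continuous_on UNIV \<phi>" using "0"(1)[of 0] by simp
  obtain B where B: "0 \<le> B" "\<And>x. \<bar>\<phi> x\<bar> \<le> B" using Ck_0_bounded[OF cont "0"(2)] by blast
  have [measurable]: "\<phi> \<in> borel_measurable borel" "\<eta> \<in> borel_measurable borel"
    using assms cont by (auto intro: borel_measurable_continuous_onI)
  have w: "integrable lborel (\<lambda>y. B * \<bar>\<eta> y\<bar>)" using assms by simp
  have "conv \<phi> \<eta> \<midarrow>x\<rightarrow> conv \<phi> \<eta> x" for x
    unfolding tendsto_at_iff_sequentially comp_def
  proof (intro allI impI)
    fix X :: "nat \<Rightarrow> 'a" assume X: "X \<longlonglongrightarrow> x"
    show "(\<lambda>i. conv \<phi> \<eta> (X i)) \<longlonglongrightarrow> conv \<phi> \<eta> x"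
      unfolding conv_def
    proof (rule integral_dominated_convergence[OF _ _ w])
      show "AE y in lborel. (\<lambda>i. \<phi> (X i - y) * \<eta> y) \<longlonglongrightarrow> \<phi> (x - y) * \<eta> y"
      proof (intro AE_I2 tendsto_mult tendsto_const)
        fix y
        have "isCont \<phi> (x - y)" using cont by (simp add: continuous_on_eq_continuous_at)
        then show "(\<lambda>i. \<phi> (X i - y)) \<longlonglongrightarrow> \<phi> (x - y)"
          by (rule isCont_tendsto_compose) (intro tendsto_intros X)
      qed
    qed (use B in \<open>auto simp: abs_mult intro!: mult_right_mono\<close>)
  qed
  then show ?case by (simp add: continuous_on_def)
next
  case (Suc k)
  define D where "D = (\<lambda>x. frechet_derivative \<phi> (at x))"
  have der: "(\<phi> has_derivative D x) (at x)" for x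
    unfolding D_def using Ck_Suc_has_derivative[OF Suc.prems(1)] .
  obtain L where L: "0 \<le> L" "\<And>x h. \<bar>D x h\<bar> \<le> L * norm h" "\<And>x y. \<bar>\<phi> x - \<phi> y\<bar> \<le> L * norm (x - y)"
    unfolding D_def using smooth_lipschitz[OF Suc.prems] by blast
  have DC: "Ck j (\<lambda>x. D x v)" for j v
    unfolding D_def using Suc.prems(1)[of "Suc j"] by simp
  have D0: "R < norm x \<Longrightarrow> D x v = 0" for x v
    unfolding D_def using Suc.prems(2) by (rule frechet_derivative_eq_0)
  have cont: "continuous_on UNIV \<phi>" using Suc.prems(1)[of 0] by simp
  have Dcont: "continuous_on UNIV (\<lambda>x. D x v)" for v using DC[of 0] by simp
  have i1: "integrable lborel (\<lambda>y. \<phi> (x - y) * \<eta> y)" for x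
    by (rule integrable_conv[OF cont Suc.prems(2) assms(3)])
  have i2: "integrable lborel (\<lambda>y. D (x - y) v * \<eta> y)" for x v
    by (rule integrable_conv[OF Dcont D0 assms(3)])
  have lin: "linear (D x)" for x using der by (rule has_derivative_linear)
  have [measurable]: "\<phi> \<in> borel_measurable borel" "\<eta> \<in> borel_measurable borel"
    "\<And>v. (\<lambda>x. D x v) \<in> borel_measurable borel"
    using assms cont Dcont by (auto intro: borel_measurable_continuous_onI)
  have Dm [measurable]: "(\<lambda>y. D (x - y) v) \<in> borel_measurable borel" for x v
    by (rule measurable_compose[of _ _ borel "\<lambda>z. D z v"]) measurable
  have w: "integrable lborel (\<lambda>y. (2 * L) * \<bar>\<eta> y\<bar>)" using assms by simp
  have "(conv \<phi> \<eta> has_derivative (\<lambda>v. conv (\<lambda>x. D x v) \<eta> x)) (at x)" for x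
    unfolding has_derivative_at
  proof
    show "bounded_linear (\<lambda>v. conv (\<lambda>x. D x v) \<eta> x)"
    proof -
      have "linear (\<lambda>v. conv (\<lambda>x. D x v) \<eta> x)"
        using i2 by (intro linearI)
          (auto simp: conv_def linear_add[OF lin] linear_scale[OF lin] distrib_right mult.assoc)
      then show ?thesis by (simp add: linear_conv_bounded_linear)
    qed
    show "(\<lambda>h. norm (conv \<phi> \<eta> (x + h) - conv \<phi> \<eta> x - conv (\<lambda>x. D x h) \<eta> x) / norm h) \<midarrow>0\<rightarrow> 0"
      unfolding tendsto_at_iff_sequentially comp_def
    proof (intro allI impI)
      fix H :: "nat \<Rightarrow> 'a" assume H0: "\<forall>i. H i \<in> UNIV - {0}" and H: "H \<longlonglongrightarrow> 0"
      \<comment> \<open>The normalised remainder of \<phi>: it tends to 0 pointwise by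
        differentiability and is bounded by 2L by the Lipschitz bound, so dominated convergence
        applies under the integral.\<close>
      define q where "q i y = (\<phi> (x + H i - y) - \<phi> (x - y) - D (x - y) (H i)) / norm (H i)" for i y
      have q: "conv \<phi> \<eta> (x + H i) - conv \<phi> \<eta> x - conv (\<lambda>x. D x (H i)) \<eta> x
          = norm (H i) * (\<integral>y. q i y * \<eta> y \<partial>lborel)" for i
      proof -
        have "conv \<phi> \<eta> (x + H i) - conv \<phi> \<eta> x - conv (\<lambda>x. D x (H i)) \<eta> x
            = (\<integral>y. \<phi> (x + H i - y) * \<eta> y - \<phi> (x - y) * \<eta> y - D (x - y) (H i) * \<eta> y \<partial>lborel)"
          unfolding conv_def using i1 i2 by simp
        also have "\<dots> = (\<integral>y. norm (H i) * (q i y * \<eta> y) \<partial>lborel)"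
        proof (intro Bochner_Integration.integral_cong refl)
          fix y
          have "norm (H i) * q i y = \<phi> (x + H i - y) - \<phi> (x - y) - D (x - y) (H i)"
            using H0 by (simp add: q_def)
          then show "\<phi> (x + H i - y) * \<eta> y - \<phi> (x - y) * \<eta> y - D (x - y) (H i) * \<eta> y
              = norm (H i) * (q i y * \<eta> y)"
            by (simp add: left_diff_distrib mult.assoc[symmetric])
        qed
        finally show ?thesis by simp
      qed
      have qb: "\<bar>q i y\<bar> \<le> 2 * L" for i y
      proof -
        have "\<bar>\<phi> (x + H i - y) - \<phi> (x - y) - D (x - y) (H i)\<bar> \<le> 2 * L * norm (H i)"
          using L(2)[of "x - y" "H i"] L(3)[of "x + H i - y" "x - y"] by simp
        then show ?thesis using H0 by (simp add: q_def field_simps)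
      qed
      have qm [measurable]: "q i \<in> borel_measurable borel" for i
        unfolding q_def by measurable
      have "(\<lambda>i. \<integral>y. q i y * \<eta> y \<partial>lborel) \<longlonglongrightarrow> (\<integral>(y::'a). 0 \<partial>lborel)"
      proof (rule integral_dominated_convergence[OF _ _ w])
        show "AE y in lborel. (\<lambda>i. q i y * \<eta> y) \<longlonglongrightarrow> 0"
        proof (intro AE_I2 tendsto_mult_left_zero)
          fix y
          have "(\<lambda>h. norm (\<phi> (x - y + h) - \<phi> (x - y) - D (x - y) h) / norm h) \<midarrow>0\<rightarrow> 0"
            using der[of "x - y"] by (simp add: has_derivative_at)
          then have "(\<lambda>i. norm (\<phi> (x - y + H i) - \<phi> (x - y) - D (x - y) (H i)) / norm (H i)) \<longlonglongrightarrow> 0"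
            using H H0 unfolding tendsto_at_iff_sequentially comp_def by blast
          then have "(\<lambda>i. norm (q i y)) \<longlonglongrightarrow> 0"
            by (simp add: q_def algebra_simps)
          then show "(\<lambda>i. q i y) \<longlonglongrightarrow> 0" by (rule tendsto_norm_zero_cancel)
        qed
        show "AE y in lborel. norm (q i y * \<eta> y) \<le> 2 * L * \<bar>\<eta> y\<bar>" for i
          using qb by (auto simp: abs_mult intro!: mult_right_mono)
      qed auto
      then have "(\<lambda>i. norm (\<integral>y. q i y * \<eta> y \<partial>lborel)) \<longlonglongrightarrow> 0"
        by (intro tendsto_norm_zero) simp
      then show "(\<lambda>i. norm (conv \<phi> \<eta> (x + H i) - conv \<phi> \<eta> x - conv (\<lambda>x. D x (H i)) \<eta> x) / norm (H i)) \<longlonglongrightarrow> 0"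
        using H0 unfolding q by (simp add: abs_mult)
    qed
  qed
  then show ?case
    by (rule Ck_SucI) (intro Suc.IH DC D0)
qed

section \<open>Mollification in fractional Sobolev spaces\<close>

lemma borel_measurable_fst_borel [measurable]:
  "fst \<in> (borel :: ('a::euclidean_space \<times> 'b::euclidean_space) measure) \<rightarrow>\<^sub>M borel"
  unfolding borel_prod[symmetric] by measurable

lemma borel_measurable_snd_borel [measurable]:
  "snd \<in> (borel :: ('a::euclidean_space \<times> 'b::euclidean_space) measure) \<rightarrow>\<^sub>M borel"
  unfolding borel_prod[symmetric] by measurable

definition gagliardo :: "real \<Rightarrow> real \<Rightarrow> ('a::euclidean_space \<Rightarrow> real) \<Rightarrow> ennreal" where
  "gagliardo s p f = (\<integral>\<^sup>+z. ennreal (\<bar>f (fst z) - f (snd z)\<bar> powr p * sing s p (fst z) (snd z)) \<partial>lborel)"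

text \<open>The factor 2 avoids convexity: \<open>f \<le> t + t\<^bsup>1-p\<^esup> f\<^sup>p\<close> for every \<open>t > 0\<close>, and \<open>t = c\<^bsup>1/p\<^esup>\<close> is used.\<close>

lemma jensen_crude:
  fixes f w :: "'a \<Rightarrow> real"
  assumes [measurable]: "f \<in> borel_measurable M" "w \<in> borel_measurable M"
    and nn: "\<And>x. 0 \<le> f x" "\<And>x. 0 \<le> w x"
    and w: "(\<integral>\<^sup>+x. ennreal (w x) \<partial>M) \<le> 1"
    and c: "(\<integral>\<^sup>+x. ennreal (w x * f x powr p) \<partial>M) \<le> ennreal c" "0 \<le> c" and p: "1 < p"
  shows "(\<integral>\<^sup>+x. ennreal (w x * f x) \<partial>M) \<le> ennreal (2 * c powr (1 / p))"
proof (cases "c = 0")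
  case True
  then have "(\<integral>\<^sup>+x. ennreal (w x * f x powr p) \<partial>M) = 0" using c by simp
  then have "AE x in M. ennreal (w x * f x powr p) = 0" by (subst (asm) nn_integral_0_iff_AE) auto
  then have "AE x in M. ennreal (w x * f x) = 0"
    by eventually_elim (use nn p in \<open>auto simp: ennreal_eq_0_iff mult_le_0_iff\<close>)
  then have "(\<integral>\<^sup>+x. ennreal (w x * f x) \<partial>M) = 0" by (subst nn_integral_0_iff_AE) auto
  then show ?thesis by simp
next
  case False
  define t where "t = c powr (1 / p)"
  have t: "0 < t" using False c by (simp add: t_def)
  have tp: "t powr (1 - p) * c = t"
    using False c p by (simp add: t_def powr_powr powr_add[symmetric] field_simps powr_diff)
  have pt: "w x * f x \<le> t * w x + t powr (1 - p) * (w x * f x powr p)" for x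
  proof -
    have "f x \<le> t + t powr (1 - p) * f x powr p"
    proof (cases "f x \<le> t")
      case True
      then show ?thesis by (simp add: add_increasing2)
    next
      case False
      then have fx: "t \<le> f x" "0 < f x" using t by auto
      have "f x = f x powr (1 - p) * f x powr p" using fx by (simp add: powr_add[symmetric])
      also have "\<dots> \<le> t powr (1 - p) * f x powr p"
        using fx t p by (intro mult_right_mono powr_mono2') auto
      finally show ?thesis using t by simp
    qed
    then have "w x * f x \<le> w x * (t + t powr (1 - p) * f x powr p)"
      using nn by (intro mult_left_mono) auto
    then show ?thesis by (simp add: algebra_simps)
  qed
  have "(\<integral>\<^sup>+x. ennreal (w x * f x) \<partial>M) \<le> ennreal t * (\<integral>\<^sup>+x. ennreal (w x) \<partial>M)
      + ennreal (t powr (1 - p)) * (\<integral>\<^sup>+x. ennreal (w x * f x powr p) \<partial>M)"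
    using pt nn t by (intro nn_integral_le_lincomb) auto
  also have "\<dots> \<le> ennreal t * 1 + ennreal (t powr (1 - p)) * ennreal c"
    using w c by (intro add_mono mult_left_mono) auto
  also have "\<dots> = ennreal (2 * t)"
    using t c tp by (simp add: ennreal_collect del: ennreal_plus)
  finally show ?thesis by (simp add: t_def)
qed

lemma ennreal_conv:
  fixes \<phi> \<eta> :: "'a::euclidean_space \<Rightarrow> real"
  assumes "continuous_on UNIV \<phi>" "\<And>x. R < norm x \<Longrightarrow> \<phi> x = 0" "integrable lborel \<eta>"
    and nn: "\<And>x. 0 \<le> \<phi> x" "\<And>x. 0 \<le> \<eta> x"
  shows "ennreal (conv \<phi> \<eta> x) = (\<integral>\<^sup>+y. ennreal (\<phi> (x - y) * \<eta> y) \<partial>lborel)"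
    and "ennreal (conv \<phi> \<eta> x) = (\<integral>\<^sup>+w. ennreal (\<phi> w * \<eta> (x - w)) \<partial>lborel)"
proof -
  have [measurable]: "\<phi> \<in> borel_measurable borel" "\<eta> \<in> borel_measurable borel"
    using assms by (auto intro: borel_measurable_continuous_onI)
  show 1: "ennreal (conv \<phi> \<eta> x) = (\<integral>\<^sup>+y. ennreal (\<phi> (x - y) * \<eta> y) \<partial>lborel)"
    unfolding conv_def using integrable_conv[OF assms(1-3)] nn
    by (intro nn_integral_eq_integral[symmetric]) auto
  show "ennreal (conv \<phi> \<eta> x) = (\<integral>\<^sup>+w. ennreal (\<phi> w * \<eta> (x - w)) \<partial>lborel)"
    unfolding 1 by (subst nn_integral_lborel_reflect[of _ x, symmetric]) auto
qed

lemma conv_nonneg: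
  assumes "\<And>x. 0 \<le> \<phi> x" "\<And>x. 0 \<le> \<eta> x"
  shows "0 \<le> conv \<phi> \<eta> x"
  unfolding conv_def using assms by (intro Bochner_Integration.integral_nonneg) auto

text \<open>A convolution is an average of translates and the seminorm is translation invariant.
  Averaging is done pointwise in the pair by \<open>jensen_crude\<close>, and Fubini then integrates
  the translated seminorms against mass 1; the factor 2^p comes from
  \<open>jensen_crude\<close>.\<close>

lemma gagliardo_conv_le:
  fixes \<phi> \<eta> :: "'a::euclidean_space \<Rightarrow> real"
  assumes cont: "continuous_on UNIV \<phi>" and sup: "\<And>x. R < norm x \<Longrightarrow> \<phi> x = 0"
    and int: "integrable lborel \<eta>"
    and nn: "\<And>x. 0 \<le> \<phi> x" "\<And>x. 0 \<le> \<eta> x"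
    and one: "(\<integral>\<^sup>+x. ennreal (\<phi> x) \<partial>lborel) = 1" and p: "1 < p"
  shows "gagliardo s p (conv \<phi> \<eta>) \<le> ennreal (2 powr p) * gagliardo s p \<eta>"
proof -
  have [measurable]: "\<phi> \<in> borel_measurable borel" "\<eta> \<in> borel_measurable borel"
    using cont int by (auto intro: borel_measurable_continuous_onI)
  have cv: "ennreal (conv \<phi> \<eta> x) = (\<integral>\<^sup>+w. ennreal (\<phi> w * \<eta> (x - w)) \<partial>lborel)" for x
    by (rule ennreal_conv(2)[OF cont sup int nn])
  define I where "I z = (\<integral>\<^sup>+w. ennreal (\<phi> w * \<bar>\<eta> (fst z - w) - \<eta> (snd z - w)\<bar> powr p) \<partial>lborel)"
    for z :: "'a \<times> 'a"
  have pt: "ennreal (\<bar>conv \<phi> \<eta> (fst z) - conv \<phi> \<eta> (snd z)\<bar> powr p) \<le> ennreal (2 powr p) * I z" for z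
  proof (cases "I z = \<infinity>")
    case True
    then show ?thesis by (simp add: ennreal_mult_top)
  next
    case False
    then obtain c where c: "0 \<le> c" "I z = ennreal c"
      by (metis enn2real_nonneg ennreal_enn2real infinity_ennreal_def less_top)
    define d where "d = 2 * c powr (1 / p)"
    have d: "0 \<le> d" by (simp add: d_def)
    have J: "(\<integral>\<^sup>+w. ennreal (\<phi> w * \<bar>\<eta> (fst z - w) - \<eta> (snd z - w)\<bar>) \<partial>lborel) \<le> ennreal d"
      unfolding d_def using c p one nn by (intro jensen_crude) (auto simp: I_def)
    have *: "conv \<phi> \<eta> x \<le> conv \<phi> \<eta> y + d"
      if "(\<integral>\<^sup>+w. ennreal (\<phi> w * \<bar>\<eta> (x - w) - \<eta> (y - w)\<bar>) \<partial>lborel) \<le> ennreal d" for x y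
    proof -
      have "ennreal (conv \<phi> \<eta> x) \<le> (\<integral>\<^sup>+w. ennreal (\<phi> w * \<eta> (y - w)) + ennreal (\<phi> w * \<bar>\<eta> (x - w) - \<eta> (y - w)\<bar>) \<partial>lborel)"
        unfolding cv
      proof (intro nn_integral_mono)
        fix w
        have "\<phi> w * \<eta> (x - w) \<le> \<phi> w * (\<eta> (y - w) + \<bar>\<eta> (x - w) - \<eta> (y - w)\<bar>)"
          using nn by (intro mult_left_mono) auto
        then show "ennreal (\<phi> w * \<eta> (x - w)) \<le> ennreal (\<phi> w * \<eta> (y - w)) + ennreal (\<phi> w * \<bar>\<eta> (x - w) - \<eta> (y - w)\<bar>)"
          using nn by (simp add: ennreal_plus[symmetric] distrib_left ennreal_leI del: ennreal_plus)
      qed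
      also have "\<dots> = ennreal (conv \<phi> \<eta> y) + (\<integral>\<^sup>+w. ennreal (\<phi> w * \<bar>\<eta> (x - w) - \<eta> (y - w)\<bar>) \<partial>lborel)"
        unfolding cv by (intro nn_integral_add) auto
      also have "\<dots> \<le> ennreal (conv \<phi> \<eta> y) + ennreal d"
        using that by (intro add_left_mono)
      also have "\<dots> = ennreal (conv \<phi> \<eta> y + d)"
        using d conv_nonneg[of \<phi> \<eta> y] nn by (simp add: ennreal_plus)
      finally show ?thesis
        using d conv_nonneg[of \<phi> \<eta> y] nn by (subst (asm) ennreal_le_iff) auto
    qed
    have "\<bar>conv \<phi> \<eta> (fst z) - conv \<phi> \<eta> (snd z)\<bar> \<le> d"
      using *[OF J] *[of "snd z" "fst z"] J by (auto simp: abs_minus_commute)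
    then have "\<bar>conv \<phi> \<eta> (fst z) - conv \<phi> \<eta> (snd z)\<bar> powr p \<le> d powr p"
      using p by (intro powr_mono2) auto
    also have "d powr p = 2 powr p * c"
      using c p by (simp add: d_def powr_mult powr_powr)
    finally show ?thesis using c by (simp add: ennreal_mult[symmetric] ennreal_leI)
  qed
  define k where "k z w = ennreal (\<phi> w) * ennreal (\<bar>\<eta> (fst z - w) - \<eta> (snd z - w)\<bar> powr p * sing s p (fst z) (snd z))"
    for z :: "'a \<times> 'a" and w :: 'a
  have km: "(\<lambda>(z, w). k z w) \<in> borel_measurable (lborel \<Otimes>\<^sub>M lborel)"
    unfolding k_def by measurable
  have "gagliardo s p (conv \<phi> \<eta>) \<le> (\<integral>\<^sup>+z. ennreal (2 powr p) * (\<integral>\<^sup>+w. k z w \<partial>lborel) \<partial>lborel)"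
    unfolding gagliardo_def
  proof (intro nn_integral_mono)
    fix z :: "'a \<times> 'a"
    have "ennreal (\<bar>conv \<phi> \<eta> (fst z) - conv \<phi> \<eta> (snd z)\<bar> powr p * sing s p (fst z) (snd z))
        \<le> ennreal (2 powr p) * I z * ennreal (sing s p (fst z) (snd z))"
      using pt[of z] by (simp add: ennreal_mult mult_right_mono)
    also have "\<dots> = ennreal (2 powr p) * (\<integral>\<^sup>+w. k z w \<partial>lborel)"
      unfolding I_def k_def using nn
      by (subst mult.assoc, subst nn_integral_multc[symmetric]) (auto simp: ennreal_mult mult.assoc)
    finally show "ennreal (\<bar>conv \<phi> \<eta> (fst z) - conv \<phi> \<eta> (snd z)\<bar> powr p * sing s p (fst z) (snd z))
        \<le> ennreal (2 powr p) * (\<integral>\<^sup>+w. k z w \<partial>lborel)" .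
  qed
  also have "\<dots> = ennreal (2 powr p) * (\<integral>\<^sup>+z. \<integral>\<^sup>+w. k z w \<partial>lborel \<partial>lborel)"
    using lborel.borel_measurable_nn_integral_fst[OF km] by (subst nn_integral_cmult) auto
  also have "(\<integral>\<^sup>+z. \<integral>\<^sup>+w. k z w \<partial>lborel \<partial>lborel) = (\<integral>\<^sup>+w. \<integral>\<^sup>+z. k z w \<partial>lborel \<partial>lborel)"
    using lborel_pair.Fubini[OF km] by simp
  also have "\<dots> = (\<integral>\<^sup>+w. ennreal (\<phi> w) * gagliardo s p \<eta> \<partial>lborel)"
  proof (intro nn_integral_cong)
    fix w :: 'a
    have "(\<integral>\<^sup>+z. k z w \<partial>lborel) = ennreal (\<phi> w) * (\<integral>\<^sup>+z. ennreal (\<bar>\<eta> (fst z - w) - \<eta> (snd z - w)\<bar> powr p * sing s p (fst z) (snd z)) \<partial>lborel)"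
      unfolding k_def by (subst nn_integral_cmult) auto
    also have "(\<integral>\<^sup>+z. ennreal (\<bar>\<eta> (fst z - w) - \<eta> (snd z - w)\<bar> powr p * sing s p (fst z) (snd z)) \<partial>lborel) = gagliardo s p \<eta>"
      unfolding gagliardo_def
      by (subst nn_integral_lborel_translate[of _ "(w, w)", symmetric]) (auto simp: sing_def)
    finally show "(\<integral>\<^sup>+z. k z w \<partial>lborel) = ennreal (\<phi> w) * gagliardo s p \<eta>" .
  qed
  also have "\<dots> = gagliardo s p \<eta>"
    by (subst nn_integral_multc) (auto simp: one)
  finally show ?thesis .
qed

text \<open>On the ball of radius \<epsilon> the bound C/\<epsilon>^n is at most C \<epsilon>^(sp)
  times the singular kernel. Hence the average of |\<eta>(x) - \<eta>(y)|^p is at most C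
  \<epsilon>^(sp) a, and the convergence has a rate wherever the inner integral of the seminorm is
  finite.\<close>

lemma conv_diff_le:
  fixes \<phi> \<eta> :: "'a::euclidean_space \<Rightarrow> real"
  assumes cont: "continuous_on UNIV \<phi>" and sup: "\<And>x. \<epsilon> < norm x \<Longrightarrow> \<phi> x = 0"
    and int: "integrable lborel \<eta>"
    and nn: "\<And>x. 0 \<le> \<phi> x" "\<And>x. 0 \<le> \<eta> x"
    and one: "(\<integral>\<^sup>+x. ennreal (\<phi> x) \<partial>lborel) = 1" and p: "1 < p" "0 < s" "0 < \<epsilon>"
    and bd: "\<And>x. \<phi> x \<le> C / \<epsilon> ^ DIM('a)" "0 \<le> C"
    and A: "(\<integral>\<^sup>+y. ennreal (\<bar>\<eta> x - \<eta> y\<bar> powr p * sing s p x y) \<partial>lborel) \<le> ennreal a" "0 \<le> a"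
  shows "\<bar>conv \<phi> \<eta> x - \<eta> x\<bar> \<le> 2 * (C * \<epsilon> powr (s * p) * a) powr (1 / p)"
proof -
  have [measurable]: "\<phi> \<in> borel_measurable borel" "\<eta> \<in> borel_measurable borel"
    using cont int by (auto intro: borel_measurable_continuous_onI)
  have one': "(\<integral>\<^sup>+y. ennreal (\<phi> (x - y)) \<partial>lborel) = 1"
    using nn_integral_lborel_reflect[of "\<lambda>y. ennreal (\<phi> y)" x] one by simp
  have i1: "integrable lborel (\<lambda>y. \<phi> (x - y))"
    using one' nn by (intro integrableI_bounded) auto
  have e1: "(\<integral>y. \<phi> (x - y) \<partial>lborel) = 1"
    using one' nn by (subst integral_eq_nn_integral) auto
  have i2: "integrable lborel (\<lambda>y. \<phi> (x - y) * \<eta> y)"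
    by (rule integrable_conv[OF cont sup int])
  have pt: "\<phi> (x - y) * \<bar>\<eta> x - \<eta> y\<bar> powr p
      \<le> C * \<epsilon> powr (s * p) * (\<bar>\<eta> x - \<eta> y\<bar> powr p * sing s p x y)" for y
  proof (cases "x = y \<or> \<epsilon> < norm (x - y)")
    case True
    then show ?thesis using sup[of "x - y"] bd(2) by auto
  next
    case False
    then have xy: "0 < norm (x - y)" "norm (x - y) \<le> \<epsilon>" by auto
    have "1 / \<epsilon> ^ DIM('a) = \<epsilon> powr (s * p) * (1 / \<epsilon> powr (real DIM('a) + s * p))"
      using p by (simp add: powr_add powr_realpow)
    also have "\<dots> \<le> \<epsilon> powr (s * p) * sing s p x y"
      unfolding sing_def using xy p by (intro mult_left_mono divide_left_mono powr_mono2) auto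
    finally have "C * (1 / \<epsilon> ^ DIM('a)) \<le> C * (\<epsilon> powr (s * p) * sing s p x y)"
      using bd by (intro mult_left_mono) auto
    then have "\<phi> (x - y) \<le> C * (\<epsilon> powr (s * p) * sing s p x y)"
      using bd(1)[of "x - y"] by simp
    then have "\<phi> (x - y) * \<bar>\<eta> x - \<eta> y\<bar> powr p \<le> C * (\<epsilon> powr (s * p) * sing s p x y) * \<bar>\<eta> x - \<eta> y\<bar> powr p"
      by (intro mult_right_mono) auto
    then show ?thesis by (simp add: mult_ac)
  qed
  have "(\<integral>\<^sup>+y. ennreal (\<phi> (x - y) * \<bar>\<eta> x - \<eta> y\<bar> powr p) \<partial>lborel)
      \<le> ennreal (C * \<epsilon> powr (s * p)) * (\<integral>\<^sup>+y. ennreal (\<bar>\<eta> x - \<eta> y\<bar> powr p * sing s p x y) \<partial>lborel)"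
    using pt bd by (intro nn_integral_le_cmult) auto
  also have "\<dots> \<le> ennreal (C * \<epsilon> powr (s * p)) * ennreal a"
    using A by (intro mult_left_mono) auto
  also have "\<dots> = ennreal (C * \<epsilon> powr (s * p) * a)"
    using A bd by (simp add: ennreal_mult[symmetric])
  finally have J: "(\<integral>\<^sup>+y. ennreal (\<phi> (x - y) * \<bar>\<eta> x - \<eta> y\<bar>) \<partial>lborel)
      \<le> ennreal (2 * (C * \<epsilon> powr (s * p) * a) powr (1 / p))"
    using A bd nn one' p by (intro jensen_crude) auto
  have i3: "integrable lborel (\<lambda>y. \<phi> (x - y) * \<bar>\<eta> x - \<eta> y\<bar>)"
    using J nn by (intro integrableI_bounded) (auto simp: le_less_trans)
  have "\<bar>conv \<phi> \<eta> x - \<eta> x\<bar> = \<bar>\<integral>y. \<phi> (x - y) * \<eta> y - \<phi> (x - y) * \<eta> x \<partial>lborel\<bar>"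
    unfolding conv_def using i1 i2 e1 by simp
  also have "\<dots> \<le> (\<integral>y. \<phi> (x - y) * \<bar>\<eta> x - \<eta> y\<bar> \<partial>lborel)"
    using nn integral_norm_bound[of lborel "\<lambda>y. \<phi> (x - y) * \<eta> y - \<phi> (x - y) * \<eta> x"]
    by (simp add: right_diff_distrib[symmetric] abs_mult abs_minus_commute)
  also have "ennreal \<dots> \<le> ennreal (2 * (C * \<epsilon> powr (s * p) * a) powr (1 / p))"
    using J i3 nn by (subst nn_integral_eq_integral[symmetric]) auto
  then have "(\<integral>y. \<phi> (x - y) * \<bar>\<eta> x - \<eta> y\<bar> \<partial>lborel) \<le> 2 * (C * \<epsilon> powr (s * p) * a) powr (1 / p)"
    by (subst (asm) ennreal_le_iff) auto
  finally show ?thesis .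
qed

text \<open>The inner integral \<open>A\<close> of the seminorm is integrable, so it is finite
  almost everywhere and its p-th root lies in L^p. The rate of \<open>conv_diff_le\<close> therefore
  yields both the pointwise convergence and one majorant \<open>\<zeta>\<close> in L^p for all
  mollifications, taking the place of Lebesgue points and of a maximal function.\<close>

lemma mollified_sequence:
  fixes \<eta> :: "'a::euclidean_space \<Rightarrow> real"
  assumes p: "1 < p" "0 < s" "s < 1" and [measurable]: "\<eta> \<in> borel_measurable borel"
    and nn: "\<And>x. 0 \<le> \<eta> x" and S': "bounded S" "{x. \<eta> x \<noteq> 0} \<subseteq> S"
    and Lp: "(\<integral>\<^sup>+x. ennreal (\<eta> x powr p) \<partial>lborel) < \<infinity>"
    and G: "gagliardo s p \<eta> < \<infinity>" and \<delta>: "0 < \<delta>"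
  shows "\<exists>e \<zeta>. (\<forall>k j. Ck j (e k)) \<and> (\<forall>k x. 0 \<le> e k x) \<and>
    (\<forall>k x. (\<forall>y\<in>S. \<delta> \<le> dist x y) \<longrightarrow> e k x = 0) \<and>
    (AE x in lborel. (\<lambda>k::nat. e k x) \<longlonglongrightarrow> \<eta> x) \<and>
    (\<forall>k. gagliardo s p (e k) \<le> ennreal (2 powr p) * gagliardo s p \<eta>) \<and>
    \<zeta> \<in> borel_measurable borel \<and> (\<forall>x. 0 \<le> \<zeta> x) \<and> (\<integral>\<^sup>+x. ennreal (\<zeta> x powr p) \<partial>lborel) < \<infinity> \<and>
    (\<forall>k. AE x in lborel. e k x \<le> \<zeta> x)"
proof -
  have S: "bounded S" "\<And>x. x \<notin> S \<Longrightarrow> \<eta> x = 0" using S' by auto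
  obtain R where R: "0 < R" "S \<subseteq> ball 0 R"
    using S(1) bounded_subset_ballD by blast
  have "(\<integral>\<^sup>+x. ennreal (\<eta> x) \<partial>lborel)
      \<le> (\<integral>\<^sup>+x. indicator (ball 0 R) x + ennreal (\<eta> x powr p) \<partial>lborel)"
  proof (intro nn_integral_mono)
    fix x
    show "ennreal (\<eta> x) \<le> indicator (ball 0 R) x + ennreal (\<eta> x powr p)"
    proof (cases "x \<in> S")
      case True
      have "\<eta> x \<le> 1 + \<eta> x powr p"
      proof (cases "\<eta> x \<le> 1")
        case False
        then have "\<eta> x powr 1 \<le> \<eta> x powr p" using p by (intro powr_mono) auto
        then show ?thesis using False by simp
      qed (simp add: add_increasing2)
      then have "ennreal (\<eta> x) \<le> ennreal (1 + \<eta> x powr p)" by (rule ennreal_leI)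
      also have "\<dots> = 1 + ennreal (\<eta> x powr p)" by simp
      finally show ?thesis using True R by (auto simp: subset_iff indicator_def)
    qed (simp add: S)
  qed
  also have "\<dots> = emeasure lborel (ball (0::'a) R) + (\<integral>\<^sup>+x. ennreal (\<eta> x powr p) \<partial>lborel)"
    by (subst nn_integral_add) (auto intro!: borel_measurable_indicator borel_open)
  also have "\<dots> < \<infinity>"
    using Lp emeasure_bounded_finite[OF bounded_ball, of "0::'a" R] by simp
  finally have int: "integrable lborel \<eta>"
    using nn by (intro integrableI_bounded) auto
  obtain C where C: "0 \<le> C" and ex:
    "\<And>\<epsilon>. 0 < \<epsilon> \<Longrightarrow> \<exists>\<phi> :: 'a \<Rightarrow> real. (\<forall>k. Ck k \<phi>) \<and> (\<forall>x. 0 \<le> \<phi> x) \<and>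
       (\<forall>x. \<epsilon> < norm x \<longrightarrow> \<phi> x = 0) \<and> (\<forall>x. \<phi> x \<le> C / \<epsilon> ^ DIM('a)) \<and>
       (\<integral>\<^sup>+x. ennreal (\<phi> x) \<partial>lborel) = 1"
    by (rule mollifier_exists) blast
  \<comment> \<open>Shifting the denominator by 2 keeps every radius strictly below \<delta>, so the
    mollified functions vanish at distance \<delta> from \<open>S\<close>.\<close>
  define r where "r k = \<delta> / real (k + 2)" for k
  have r: "0 < r k" "r k < \<delta>" for k
    using \<delta> by (auto simp: r_def field_simps add_pos_nonneg)
  have rlim: "r \<longlonglongrightarrow> 0"
    using LIMSEQ_ignore_initial_segment[OF lim_const_over_n[of \<delta>], of 2] by (simp add: r_def[abs_def])
  obtain \<phi> :: "nat \<Rightarrow> 'a \<Rightarrow> real" where \<phi>: "\<And>k j. Ck j (\<phi> k)" "\<And>k x. 0 \<le> \<phi> k x"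
    "\<And>k x. r k < norm x \<Longrightarrow> \<phi> k x = 0" "\<And>k x. \<phi> k x \<le> C / r k ^ DIM('a)"
    "\<And>k. (\<integral>\<^sup>+x. ennreal (\<phi> k x) \<partial>lborel) = 1"
    using ex[OF r(1)] by metis
  have cont: "continuous_on UNIV (\<phi> k)" for k using \<phi>(1)[of 0 k] by simp
  define A where "A x = (\<integral>\<^sup>+y. ennreal (\<bar>\<eta> x - \<eta> y\<bar> powr p * sing s p x y) \<partial>lborel)" for x
  have Am [measurable]: "A \<in> borel_measurable borel"
    unfolding A_def[abs_def] by measurable
  have Ai: "(\<integral>\<^sup>+x. A x \<partial>lborel) = gagliardo s p \<eta>"
    unfolding A_def gagliardo_def by (subst nn_integral_lborel_prod) auto
  have Afin: "AE x in lborel. A x \<noteq> \<infinity>"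
    using G Ai by (intro nn_integral_noteq_infinite) auto
  define \<zeta> where "\<zeta> x = \<eta> x + 2 * (C * \<delta> powr (s * p) * enn2real (A x)) powr (1 / p)" for x
  have close: "\<bar>conv (\<phi> k) \<eta> x - \<eta> x\<bar> \<le> 2 * (C * r k powr (s * p) * enn2real (A x)) powr (1 / p)"
    if "A x \<noteq> \<infinity>" for k x
  proof -
    have "A x = ennreal (enn2real (A x))" using that by (simp add: less_top)
    then show ?thesis
      using C p r by (intro conv_diff_le[OF cont \<phi>(3) int \<phi>(2) nn \<phi>(5) _ _ _ \<phi>(4)]) (auto simp: A_def)
  qed
  show ?thesis
  proof (intro exI[of _ "\<lambda>k. conv (\<phi> k) \<eta>"] exI[of _ \<zeta>] conjI allI impI)
    show "Ck j (conv (\<phi> k) \<eta>)" for j k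
      by (rule Ck_conv[OF \<phi>(1) \<phi>(3) int])
    show "0 \<le> conv (\<phi> k) \<eta> x" for k x by (intro conv_nonneg \<phi> nn)
    show "conv (\<phi> k) \<eta> x = 0" if far: "\<forall>y\<in>S. \<delta> \<le> dist x y" for k x
    proof -
      have "\<phi> k (x - y) * \<eta> y = 0" for y
      proof (cases "y \<in> S")
        case True
        then have "r k < norm (x - y)" using bspec[OF far True] r(2)[of k] by (simp add: dist_norm)
        then show ?thesis using \<phi>(3) by simp
      qed (simp add: S)
      then show ?thesis unfolding conv_def by (simp only: Bochner_Integration.integral_zero)
    qed
    show "AE x in lborel. (\<lambda>k. conv (\<phi> k) \<eta> x) \<longlonglongrightarrow> \<eta> x"
      using Afin
    proof eventually_elim
      fix x assume "A x \<noteq> \<infinity>"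
      have "(\<lambda>k. r k powr (s * p)) \<longlonglongrightarrow> 0"
        by (rule tendsto_zero_powrI[OF rlim tendsto_const]) (use r p in \<open>auto intro!: always_eventually less_imp_le\<close>)
      then have "(\<lambda>k. C * r k powr (s * p) * enn2real (A x)) \<longlonglongrightarrow> 0"
        by (intro tendsto_mult_left_zero tendsto_mult_right_zero)
      then have "(\<lambda>k. (C * r k powr (s * p) * enn2real (A x)) powr (1 / p)) \<longlonglongrightarrow> 0"
        by (rule tendsto_zero_powrI[OF _ tendsto_const]) (use C p in auto)
      then have "(\<lambda>k. 2 * (C * r k powr (s * p) * enn2real (A x)) powr (1 / p)) \<longlonglongrightarrow> 0"
        by (rule tendsto_mult_right_zero)
      then have "(\<lambda>k. conv (\<phi> k) \<eta> x - \<eta> x) \<longlonglongrightarrow> 0"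
        by (rule Lim_null_comparison[rotated]) (use close \<open>A x \<noteq> \<infinity>\<close> in auto)
      then show "(\<lambda>k. conv (\<phi> k) \<eta> x) \<longlonglongrightarrow> \<eta> x" by (simp add: LIM_zero_iff)
    qed
    show "gagliardo s p (conv (\<phi> k) \<eta>) \<le> ennreal (2 powr p) * gagliardo s p \<eta>" for k
      by (rule gagliardo_conv_le[OF cont \<phi>(3) int \<phi>(2) nn \<phi>(5) p(1)])
    show "\<zeta> \<in> borel_measurable borel" unfolding \<zeta>_def[abs_def] by measurable
    show "0 \<le> \<zeta> x" for x using nn by (simp add: \<zeta>_def)
    have pow: "ennreal (\<zeta> x powr p) \<le> ennreal (2 powr p) * ennreal (\<eta> x powr p)
        + ennreal (2 powr p * 2 powr p * C * \<delta> powr (s * p)) * A x" for x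
    \<comment> \<open>\<open>C\<close> is only known to be nonnegative, and 0 times infinity is 0 in
      \<open>ennreal\<close>; so C = 0 needs its own argument at points where \<open>A\<close> is
      infinite.\<close>
    proof (cases "A x = \<infinity>")
      case True
      show ?thesis
      proof (cases "C = 0")
        case True
        then have "\<zeta> x = \<eta> x" by (simp add: \<zeta>_def)
        moreover have "1 * \<eta> x powr p \<le> 2 powr p * \<eta> x powr p"
          using p by (intro mult_right_mono ge_one_powr_ge_zero) auto
        ultimately show ?thesis using True
          by (simp add: ennreal_mult[symmetric] ennreal_leI)
      next
        case False
        then show ?thesis using True C \<delta> \<open>A x = \<infinity>\<close> by (simp add: ennreal_mult_top)
      qed
    next
      case False
      have "\<zeta> x powr p \<le> 2 powr p * (\<eta> x powr p + (2 * (C * \<delta> powr (s * p) * enn2real (A x)) powr (1 / p)) powr p)"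
        unfolding \<zeta>_def using nn p by (intro powr_add_le) auto
      also have "(2 * (C * \<delta> powr (s * p) * enn2real (A x)) powr (1 / p)) powr p
          = 2 powr p * (C * \<delta> powr (s * p) * enn2real (A x))"
        using C p by (simp add: powr_mult powr_powr)
      finally have "ennreal (\<zeta> x powr p) \<le> ennreal (2 powr p * \<eta> x powr p
          + 2 powr p * 2 powr p * C * \<delta> powr (s * p) * enn2real (A x))"
        by (intro ennreal_leI) (simp add: algebra_simps)
      also have "\<dots> = ennreal (2 powr p) * ennreal (\<eta> x powr p)
        + ennreal (2 powr p * 2 powr p * C * \<delta> powr (s * p)) * ennreal (enn2real (A x))"
        using C by (simp add: ennreal_collect del: ennreal_plus)
      finally show ?thesis using False by (simp add: less_top)
    qed
    have "(\<integral>\<^sup>+x. ennreal (\<zeta> x powr p) \<partial>lborel) \<le> (\<integral>\<^sup>+x. ennreal (2 powr p) * ennreal (\<eta> x powr p)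
        + ennreal (2 powr p * 2 powr p * C * \<delta> powr (s * p)) * A x \<partial>lborel)"
      by (intro nn_integral_mono pow)
    also have "\<dots> = ennreal (2 powr p) * (\<integral>\<^sup>+x. ennreal (\<eta> x powr p) \<partial>lborel)
        + ennreal (2 powr p * 2 powr p * C * \<delta> powr (s * p)) * gagliardo s p \<eta>"
      by (subst nn_integral_add) (auto simp: nn_integral_cmult Ai)
    also have "\<dots> < \<infinity>" using Lp G by (auto simp: ennreal_mult_less_top)
    finally show "(\<integral>\<^sup>+x. ennreal (\<zeta> x powr p) \<partial>lborel) < \<infinity>" .
    show "AE x in lborel. conv (\<phi> k) \<eta> x \<le> \<zeta> x" for k
      using Afin
    proof eventually_elim
      fix x assume "A x \<noteq> \<infinity>"
      have "r k powr (s * p) \<le> \<delta> powr (s * p)"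
        using r[of k] p by (intro powr_mono2) auto
      then have "C * r k powr (s * p) * enn2real (A x) \<le> C * \<delta> powr (s * p) * enn2real (A x)"
        using C by (intro mult_right_mono mult_left_mono) auto
      then have "(C * r k powr (s * p) * enn2real (A x)) powr (1 / p) \<le> (C * \<delta> powr (s * p) * enn2real (A x)) powr (1 / p)"
        using C p by (intro powr_mono2) auto
      then show "conv (\<phi> k) \<eta> x \<le> \<zeta> x"
        using close[OF \<open>A x \<noteq> \<infinity>\<close>, of k] by (simp add: \<zeta>_def)
    qed
  qed
qed

section \<open>Limits of the energy\<close>

definition nbhd :: "'a::euclidean_space set \<Rightarrow> real \<Rightarrow> 'a set" where
  "nbhd S r = (\<Union>x\<in>S. ball x r)"

lemma open_nbhd: "open (nbhd S r)"
  by (auto simp: nbhd_def)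

lemma nbhd_mono: "r \<le> r' \<Longrightarrow> nbhd S r \<subseteq> nbhd S r'"
  by (auto simp: nbhd_def dist_commute)

lemma nbhd_separated: "x \<in> nbhd S r \<Longrightarrow> y \<notin> nbhd S r' \<Longrightarrow> r' - r \<le> dist x y"
proof -
  assume "x \<in> nbhd S r" "y \<notin> nbhd S r'"
  then obtain c where "dist c x < r" "r' \<le> dist c y" by (force simp: nbhd_def not_less)
  then show ?thesis using dist_triangle[of c y x] by linarith
qed

lemma closure_nbhd: "r < r' \<Longrightarrow> closure (nbhd S r) \<subseteq> nbhd S r'"
proof
  fix x assume r: "r < r'" and "x \<in> closure (nbhd S r)"
  then obtain y where y: "y \<in> nbhd S r" "dist y x < r' - r"
    unfolding closure_approachable by (metis diff_gt_0_iff_gt)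
  show "x \<in> nbhd S r'"
  proof (rule ccontr)
    assume "x \<notin> nbhd S r'"
    from nbhd_separated[OF y(1) this] y(2) show False by linarith
  qed
qed

lemma bounded_nbhd: "bounded S \<Longrightarrow> bounded (nbhd S r)"
proof -
  assume "bounded S"
  then obtain a b where ab: "\<And>y. y \<in> S \<Longrightarrow> dist a y \<le> b" by (auto simp: bounded_def)
  have "dist a x \<le> b + r" if x: "x \<in> nbhd S r" for x
  proof -
    obtain y where y: "y \<in> S" "dist y x < r" using x by (auto simp: nbhd_def)
    then show ?thesis using ab[OF y(1)] dist_triangle[of a x y] by linarith
  qed
  then show ?thesis by (auto simp: bounded_def)
qed

lemma compactly_inside_nbhd:
  assumes "compact S" "r < r'" "nbhd S r' \<subseteq> \<Omega>"
  shows "compactly_inside (nbhd S r) \<Omega>"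
  using assms closure_nbhd[of r r' S] bounded_nbhd[of S r]
  by (auto simp: compactly_inside_def compact_imp_bounded)

lemma nbhd_subset_open:
  assumes "compact S" "open \<Omega>" "S \<subseteq> \<Omega>"
  obtains r where "0 < r" "r \<le> 1" "nbhd S r \<subseteq> \<Omega>"
proof -
  obtain e where e: "0 < e" "(\<Union>x\<in>S. ball x e) \<subseteq> \<Omega>"
    using compact_subset_open_imp_ball_epsilon_subset[OF assms] by blast
  then show ?thesis
    using nbhd_mono[of "min e 1" e S] by (intro that[of "min e 1"]) (auto simp: nbhd_def[symmetric])
qed

lemma nn_integral_lborel_times:
  fixes f :: "'a::euclidean_space \<Rightarrow> ennreal" and g :: "'b::euclidean_space \<Rightarrow> ennreal"
  assumes [measurable]: "f \<in> borel_measurable borel" "g \<in> borel_measurable borel"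
  shows "(\<integral>\<^sup>+z. f (fst z) * g (snd z) \<partial>lborel) = (\<integral>\<^sup>+x. f x \<partial>lborel) * (\<integral>\<^sup>+y. g y \<partial>lborel)"
  by (subst nn_integral_lborel_prod) (auto simp: nn_integral_cmult nn_integral_multc)

section \<open>Comparison of the kernel with the singular weight\<close>

lemma admissible_kernel_bounds:
  assumes "admissible_kernel s p \<Lambda> (K :: 'a::euclidean_space \<Rightarrow> 'a \<Rightarrow> real)" "1 \<le> \<Lambda>"
  shows "AE z in lborel. K (fst z) (snd z) \<le> \<Lambda> * sing s p (fst z) (snd z)
     \<and> sing s p (fst z) (snd z) \<le> \<Lambda> * K (fst z) (snd z)"
proof -
  have "AE z in lborel. inverse \<Lambda> \<le> K (fst z) (snd z) * norm (fst z - snd z) powr (real DIM('a) + s * p)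
          \<and> K (fst z) (snd z) * norm (fst z - snd z) powr (real DIM('a) + s * p) \<le> \<Lambda>"
    using assms by (auto simp: admissible_kernel_def AE_completion_iff)
  with AE_lborel_off_diagonal show ?thesis
  proof eventually_elim
    fix z :: "'a \<times> 'a"
    assume ne: "fst z \<noteq> snd z" and b: "inverse \<Lambda> \<le> K (fst z) (snd z) * norm (fst z - snd z) powr (real DIM('a) + s * p)
          \<and> K (fst z) (snd z) * norm (fst z - snd z) powr (real DIM('a) + s * p) \<le> \<Lambda>"
    have "0 < norm (fst z - snd z) powr (real DIM('a) + s * p)" using ne by simp
    then show "K (fst z) (snd z) \<le> \<Lambda> * sing s p (fst z) (snd z)
     \<and> sing s p (fst z) (snd z) \<le> \<Lambda> * K (fst z) (snd z)"
      using b assms(2) by (simp add: sing_def field_simps)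
  qed
qed

lemma borel_measurable_lebesgueI: "f \<in> borel_measurable borel \<Longrightarrow> f \<in> borel_measurable lebesgue"
  by (simp add: measurable_completion)

lemma energy_integrand_measurable:
  assumes "1 < p" "u \<in> borel_measurable borel" "\<eta> \<in> borel_measurable borel"
    and K: "admissible_kernel s p \<Lambda> K"
  shows "energy_integrand p K u \<eta> \<in> borel_measurable lebesgue"
proof -
  note [measurable] = assms(2,3)
  have [measurable]: "signed_pow p \<in> borel_measurable borel" using assms(1) by measurable
  have "(\<lambda>z. signed_pow p (u (fst z) - u (snd z)) * (\<eta> (fst z) - \<eta> (snd z))) \<in> borel_measurable borel"
    by measurable
  then have "(\<lambda>z. signed_pow p (u (fst z) - u (snd z)) * (\<eta> (fst z) - \<eta> (snd z)) * K (fst z) (snd z))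
      \<in> borel_measurable lebesgue"
    using K by (intro borel_measurable_times[OF borel_measurable_lebesgueI]) (auto simp: admissible_kernel_def)
  then show ?thesis by (simp add: energy_integrand_eq[abs_def])
qed

lemma energy_integrand_abs_le:
  assumes "K (fst z) (snd z) \<le> \<Lambda> * sing s p (fst z) (snd z)" "0 \<le> K (fst z) (snd z)"
  shows "\<bar>energy_integrand p K u \<eta> z\<bar>
    \<le> \<Lambda> * (\<bar>u (fst z) - u (snd z)\<bar> powr (p - 1) * \<bar>\<eta> (fst z) - \<eta> (snd z)\<bar> * sing s p (fst z) (snd z))"
proof -
  have "\<bar>energy_integrand p K u \<eta> z\<bar>
      = \<bar>u (fst z) - u (snd z)\<bar> powr (p - 1) * \<bar>\<eta> (fst z) - \<eta> (snd z)\<bar> * K (fst z) (snd z)"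
    using assms by (simp add: energy_integrand_eq abs_mult abs_signed_pow)
  also have "\<dots> \<le> \<bar>u (fst z) - u (snd z)\<bar> powr (p - 1) * \<bar>\<eta> (fst z) - \<eta> (snd z)\<bar> * (\<Lambda> * sing s p (fst z) (snd z))"
    using assms by (intro mult_left_mono) auto
  finally show ?thesis by (simp add: mult_ac)
qed

text \<open>The sets \<open>D\<^sub>1 \<subseteq> D\<^sub>2\<close> are at distance \<open>\<delta>\<close> from each other's complement. On \<open>D\<^sub>2 \<times> D\<^sub>2\<close> the energy is
  controlled by a Young splitting, elsewhere by the integrable tail majorant built from
  \<open>\<zeta>\<close>, \<open>U\<close> and \<open>G\<close>.\<close>

lemma energy_limit:
  fixes u e :: "nat \<Rightarrow> 'a::euclidean_space \<Rightarrow> real"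
  assumes p: "1 < p" "0 < s" "s < 1" and K: "admissible_kernel s p \<Lambda> K" "1 \<le> \<Lambda>"
    and [measurable]: "\<And>j. u j \<in> borel_measurable borel" "v \<in> borel_measurable borel"
      "\<And>j. e j \<in> borel_measurable borel" "\<eta> \<in> borel_measurable borel"
    and lim: "AE x in lborel. (\<lambda>j. u j x) \<longlonglongrightarrow> v x" "AE x in lborel. (\<lambda>j. e j x) \<longlonglongrightarrow> \<eta> x"
    and [measurable]: "D1 \<in> sets borel" and bdd: "bounded D1"
    and \<delta>: "0 < \<delta>" "\<delta> \<le> 1" and sep: "\<And>x y. x \<in> D1 \<Longrightarrow> y \<notin> D2 \<Longrightarrow> \<delta> \<le> dist x y"
    and e0: "\<And>j x. x \<notin> D1 \<Longrightarrow> e j x = 0"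
    and [measurable]: "G \<in> borel_measurable borel" "\<zeta> \<in> borel_measurable borel" "U \<in> borel_measurable borel"
    and uG: "\<And>j. AE x in lborel. \<bar>u j x\<bar> \<le> G x" and e\<zeta>: "\<And>j. AE x in lborel. \<bar>e j x\<bar> \<le> \<zeta> x"
    and uU: "\<And>j. AE x in lborel. x \<in> D1 \<longrightarrow> \<bar>u j x\<bar> \<le> U x"
    and Gi: "tail_integral s p G < \<infinity>"
    and \<zeta>i: "(\<integral>\<^sup>+x. ennreal (indicator D1 x * \<zeta> x) \<partial>lborel) < \<infinity>"
      "(\<integral>\<^sup>+x. ennreal (indicator D1 x * \<zeta> x * U x powr (p - 1)) \<partial>lborel) < \<infinity>"
    and [measurable]: "\<And>j. P j \<in> borel_measurable borel" and Pnn: "\<And>j z. 0 \<le> P j z"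
    and PB: "\<And>j. (\<integral>\<^sup>+z. ennreal (P j z) \<partial>lborel) \<le> ennreal B"
    and dom: "\<And>\<epsilon>. 0 < \<epsilon> \<Longrightarrow> \<exists>Q. Q \<in> borel_measurable borel \<and> (\<integral>\<^sup>+z. ennreal (Q z) \<partial>lborel) < \<infinity> \<and>
       (\<forall>j. AE z in lborel. z \<in> D2 \<times> D2 \<longrightarrow>
          \<bar>u j (fst z) - u j (snd z)\<bar> powr (p - 1) * \<bar>e j (fst z) - e j (snd z)\<bar> * sing s p (fst z) (snd z)
          \<le> \<epsilon> * P j z + Q z)"
  shows "integrable lebesgue (energy_integrand p K v \<eta>)"
    and "(\<lambda>j. integral\<^sup>L lebesgue (energy_integrand p K (u j) (e j)))
       \<longlonglongrightarrow> integral\<^sup>L lebesgue (energy_integrand p K v \<eta>)"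
proof -
  obtain R where R: "\<And>x. x \<in> D1 \<Longrightarrow> norm x \<le> R" using bdd by (auto simp: bounded_iff)
  define c where "c = ((2 + R) / \<delta>) powr (real DIM('a) + s * p)"
  \<comment> \<open>The absolute value is taken because \<open>\<zeta>\<close> is nonnegative only
    almost everywhere, while the majorant has to be nonnegative at every point.\<close>
  define q where "q x = \<bar>\<zeta> x\<bar> * indicator D1 x" for x
  define out where "out z = 2 powr (p - 1) * c * (q (fst z) * U (fst z) powr (p - 1) * tailw s p (snd z)
      + q (fst z) * (G (snd z) powr (p - 1) * tailw s p (snd z)))" for z
  have c0: "0 \<le> c" by (simp add: c_def)
  have qm [measurable]: "q \<in> borel_measurable borel" unfolding q_def[abs_def] by measurable
  have q0: "0 \<le> q x" for x by (simp add: q_def)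
  have out_m [measurable]: "out \<in> borel_measurable borel" unfolding out_def[abs_def] by measurable
  have out0: "0 \<le> out z" for z using c0 q0 by (simp add: out_def)
  have "AE x in lborel. \<bar>e 0 x\<bar> \<le> \<zeta> x" by (rule e\<zeta>)
  then have \<zeta>0: "AE x in lborel. 0 \<le> \<zeta> x" by eventually_elim linarith
  have qi: "(\<integral>\<^sup>+x. ennreal (q x) \<partial>lborel) < \<infinity>" "(\<integral>\<^sup>+x. ennreal (q x * U x powr (p - 1)) \<partial>lborel) < \<infinity>"
  proof -
    have "(\<integral>\<^sup>+x. ennreal (q x) \<partial>lborel) = (\<integral>\<^sup>+x. ennreal (indicator D1 x * \<zeta> x) \<partial>lborel)"
      by (rule nn_integral_cong_AE, use \<zeta>0 in eventually_elim) (auto simp: q_def)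
    then show "(\<integral>\<^sup>+x. ennreal (q x) \<partial>lborel) < \<infinity>" using \<zeta>i by simp
    have "(\<integral>\<^sup>+x. ennreal (q x * U x powr (p - 1)) \<partial>lborel)
        = (\<integral>\<^sup>+x. ennreal (indicator D1 x * \<zeta> x * U x powr (p - 1)) \<partial>lborel)"
      by (rule nn_integral_cong_AE, use \<zeta>0 in eventually_elim) (auto simp: q_def mult_ac)
    then show "(\<integral>\<^sup>+x. ennreal (q x * U x powr (p - 1)) \<partial>lborel) < \<infinity>" using \<zeta>i by simp
  qed
  have outi: "(\<integral>\<^sup>+z. ennreal (out z) \<partial>lborel) < \<infinity>"
  proof -
    have "(\<integral>\<^sup>+z. ennreal (out z) \<partial>lborel) = (\<integral>\<^sup>+z. ennreal (2 powr (p - 1) * c)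
        * (ennreal (q (fst z) * U (fst z) powr (p - 1)) * ennreal (tailw s p (snd z))
         + ennreal (q (fst z)) * ennreal (G (snd z) powr (p - 1) * tailw s p (snd z))) \<partial>lborel)"
      using c0 q0 by (intro nn_integral_cong)
        (simp add: out_def ennreal_collect del: ennreal_plus)
    also have "\<dots> = ennreal (2 powr (p - 1) * c)
        * ((\<integral>\<^sup>+x. ennreal (q x * U x powr (p - 1)) \<partial>lborel) * (\<integral>\<^sup>+y. ennreal (tailw s p (y::'a)) \<partial>lborel)
         + (\<integral>\<^sup>+x. ennreal (q x) \<partial>lborel) * tail_integral s p G)"
      by (simp add: nn_integral_cmult nn_integral_add
          nn_integral_lborel_times[of "\<lambda>x. ennreal (q x * U x powr (p - 1))" "\<lambda>y. ennreal (tailw s p y)"]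
          nn_integral_lborel_times[of "\<lambda>x. ennreal (q x)" "\<lambda>x. ennreal (G x powr (p - 1) * tailw s p x)"])
    also have "\<dots> < \<infinity>"
      using qi Gi nn_integral_tailw_finite[OF p(2,3,1), where 'a='a]
      by (auto simp: ennreal_mult_less_top)
    finally show ?thesis .
  qed
  \<comment> \<open>A pair with one point in \<open>D1\<close> and the other outside
    \<open>D2\<close> is at least \<delta> apart, so the kernel is bounded by the tail density of
    the distant point. The majorant becomes a sum of products of one-variable functions.
    \<open>U\<close> bounds the sequence near the test function and \<open>G\<close> bounds it
    globally; they are kept apart because \<zeta> may be integrable only against a better bound than
    \<open>G\<close>.\<close>
  have far: "\<bar>a - b\<bar> powr (p - 1) * \<bar>d\<bar> * sing s p x y \<le> out (x, y)"
    if "x \<in> D1" "\<delta> \<le> dist x y" "\<bar>a\<bar> \<le> U x" "\<bar>b\<bar> \<le> G y" "\<bar>d\<bar> \<le> \<zeta> x" for a b d x y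
  proof -
    have "\<bar>a - b\<bar> powr (p - 1) \<le> 2 powr (p - 1) * (\<bar>a\<bar> powr (p - 1) + \<bar>b\<bar> powr (p - 1))"
      using p by (intro powr_abs_diff_le) auto
    also have "\<dots> \<le> 2 powr (p - 1) * (U x powr (p - 1) + G y powr (p - 1))"
      using that p by (intro mult_left_mono add_mono powr_mono2) auto
    finally have 1: "\<bar>a - b\<bar> powr (p - 1) \<le> 2 powr (p - 1) * (U x powr (p - 1) + G y powr (p - 1))" .
    have 2: "sing s p x y \<le> c * tailw s p y"
      unfolding c_def using that p \<delta> R by (intro sing_le_tailw) auto
    have 3: "\<bar>d\<bar> \<le> q x" using that by (auto simp: q_def)
    have "\<bar>a - b\<bar> powr (p - 1) * \<bar>d\<bar> * sing s p x y
        \<le> 2 powr (p - 1) * (U x powr (p - 1) + G y powr (p - 1)) * q x * (c * tailw s p y)"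
      using 1 2 3 q0 c0 by (intro mult_mono) auto
    also have "\<dots> = out (x, y)" by (simp add: out_def algebra_simps)
    finally show ?thesis .
  qed
  have sub: "x \<in> D2" if "x \<in> D1" for x using sep[OF that, of x] \<delta> by force
  have Kb: "AE z in lborel. K (fst z) (snd z) \<le> \<Lambda> * sing s p (fst z) (snd z)"
    using admissible_kernel_bounds[OF K] by eventually_elim simp
  have K0: "0 \<le> K x y" for x y using K by (simp add: admissible_kernel_def)
  note F = vitali_young_convergence[where M = lebesgue and F = "\<lambda>j. energy_integrand p K (u j) (e j)"
      and G = "energy_integrand p K v \<eta>" and P = P and B = B]
  have m1: "energy_integrand p K (u j) (e j) \<in> borel_measurable lebesgue" for j
    by (rule energy_integrand_measurable[OF p(1) _ _ K(1)]) measurable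
  have m2: "energy_integrand p K v \<eta> \<in> borel_measurable lebesgue"
    by (rule energy_integrand_measurable[OF p(1) _ _ K(1)]) measurable
  have m3: "P j \<in> borel_measurable lebesgue" for j by (intro borel_measurable_lebesgueI) measurable
  have l: "AE z in lebesgue. (\<lambda>j. energy_integrand p K (u j) (e j) z) \<longlonglongrightarrow> energy_integrand p K v \<eta> z"
    unfolding AE_completion_iff
    using AE_lborel_fst[OF lim(1)] AE_lborel_snd[OF lim(1)] AE_lborel_fst[OF lim(2)] AE_lborel_snd[OF lim(2)]
  proof eventually_elim
    fix z
    assume h: "(\<lambda>j. u j (fst z)) \<longlonglongrightarrow> v (fst z)" "(\<lambda>j. u j (snd z)) \<longlonglongrightarrow> v (snd z)"
      "(\<lambda>j. e j (fst z)) \<longlonglongrightarrow> \<eta> (fst z)" "(\<lambda>j. e j (snd z)) \<longlonglongrightarrow> \<eta> (snd z)"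
    have "isCont (signed_pow p) (v (fst z) - v (snd z))"
      using continuous_signed_pow[OF p(1)] by (simp add: continuous_on_eq_continuous_at)
    then have "(\<lambda>j. signed_pow p (u j (fst z) - u j (snd z))) \<longlonglongrightarrow> signed_pow p (v (fst z) - v (snd z))"
      by (rule isCont_tendsto_compose) (intro tendsto_diff h)
    then show "(\<lambda>j. energy_integrand p K (u j) (e j) z) \<longlonglongrightarrow> energy_integrand p K v \<eta> z"
      unfolding energy_integrand_eq by (intro tendsto_intros h)
  qed
  have pb: "(\<integral>\<^sup>+z. ennreal (P j z) \<partial>lebesgue) \<le> ennreal B" for j
    using PB by (simp add: nn_integral_completion)
  have d: "\<exists>Q. Q \<in> borel_measurable lebesgue \<and> (\<integral>\<^sup>+x. ennreal (Q x) \<partial>lebesgue) < \<infinity> \<and>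
       (\<forall>j. AE z in lebesgue. \<bar>energy_integrand p K (u j) (e j) z\<bar> \<le> \<epsilon> * \<bar>P j z\<bar> + Q z)"
    if "0 < \<epsilon>" for \<epsilon>
  proof -
    \<comment> \<open>The hypothesis \<open>dom\<close> refers to the singular weight; replacing it
      by \<open>K\<close> costs the factor \<Lambda>, which is compensated in advance.\<close>
    have "0 < \<epsilon> / \<Lambda>" using that K by simp
    from dom[OF this] obtain Q where Qm [measurable]: "Q \<in> borel_measurable borel"
      and Qf: "(\<integral>\<^sup>+z. ennreal (Q z) \<partial>lborel) < \<infinity>"
      and Qd: "\<And>j. AE z in lborel. z \<in> D2 \<times> D2 \<longrightarrow>
          \<bar>u j (fst z) - u j (snd z)\<bar> powr (p - 1) * \<bar>e j (fst z) - e j (snd z)\<bar> * sing s p (fst z) (snd z)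
          \<le> \<epsilon> / \<Lambda> * P j z + Q z"
      by blast
    \<comment> \<open>\<open>out\<close> covers pairs whose first point lies in \<open>D1\<close>;
      its reflection covers those whose second point does.\<close>
    define Q' where "Q' z = \<Lambda> * (max 0 (Q z) + (out z + out (snd z, fst z)))" for z
    have sw [measurable]: "(\<lambda>z. out (snd z, fst z)) \<in> borel_measurable borel"
      unfolding out_def fst_conv snd_conv by measurable
    have Q'm: "Q' \<in> borel_measurable borel" unfolding Q'_def[abs_def] by measurable
    have eq: "ennreal (Q' z) = ennreal \<Lambda> * (ennreal (Q z) + (ennreal (out z) + ennreal (out (snd z, fst z))))" for z
    proof -
      have "ennreal (Q z) = ennreal (max 0 (Q z))" by (auto simp: max_def ennreal_neg)
      then show ?thesis using K out0
        by (simp add: Q'_def ennreal_collect del: ennreal_plus)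
    qed
    have "(\<integral>\<^sup>+z. ennreal (Q' z) \<partial>lborel) = ennreal \<Lambda> * ((\<integral>\<^sup>+z. ennreal (Q z) \<partial>lborel)
       + ((\<integral>\<^sup>+z. ennreal (out z) \<partial>lborel) + (\<integral>\<^sup>+z. ennreal (out (snd z, fst z)) \<partial>lborel)))"
      unfolding eq by (simp add: nn_integral_cmult nn_integral_add)
    also have "(\<integral>\<^sup>+z. ennreal (out (snd z, fst z)) \<partial>lborel) = (\<integral>\<^sup>+z. ennreal (out z) \<partial>lborel)"
      by (rule nn_integral_lborel_swap) measurable
    finally have Q'f: "(\<integral>\<^sup>+z. ennreal (Q' z) \<partial>lborel) < \<infinity>"
      using Qf outi by (auto simp: ennreal_mult_less_top)
    have "AE z in lborel. \<bar>energy_integrand p K (u j) (e j) z\<bar> \<le> \<epsilon> * \<bar>P j z\<bar> + Q' z" for j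
      using Qd[of j] Kb AE_lborel_fst[OF uG, of j] AE_lborel_snd[OF uG, of j]
        AE_lborel_fst[OF uU, of j] AE_lborel_snd[OF uU, of j]
        AE_lborel_fst[OF e\<zeta>, of j] AE_lborel_snd[OF e\<zeta>, of j]
    proof eventually_elim
      fix z
      assume h: "z \<in> D2 \<times> D2 \<longrightarrow>
          \<bar>u j (fst z) - u j (snd z)\<bar> powr (p - 1) * \<bar>e j (fst z) - e j (snd z)\<bar> * sing s p (fst z) (snd z)
          \<le> \<epsilon> / \<Lambda> * P j z + Q z" "K (fst z) (snd z) \<le> \<Lambda> * sing s p (fst z) (snd z)"
        "\<bar>u j (fst z)\<bar> \<le> G (fst z)" "\<bar>u j (snd z)\<bar> \<le> G (snd z)"
        "fst z \<in> D1 \<longrightarrow> \<bar>u j (fst z)\<bar> \<le> U (fst z)" "snd z \<in> D1 \<longrightarrow> \<bar>u j (snd z)\<bar> \<le> U (snd z)"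
        "\<bar>e j (fst z)\<bar> \<le> \<zeta> (fst z)" "\<bar>e j (snd z)\<bar> \<le> \<zeta> (snd z)"
      define E where "E = \<bar>u j (fst z) - u j (snd z)\<bar> powr (p - 1) * \<bar>e j (fst z) - e j (snd z)\<bar> * sing s p (fst z) (snd z)"
      have pos: "0 \<le> \<epsilon> / \<Lambda> * P j z" using that K Pnn by simp
      have "E \<le> \<epsilon> / \<Lambda> * P j z + (max 0 (Q z) + (out z + out (snd z, fst z)))"
      proof (cases "fst z \<in> D2 \<and> snd z \<in> D2")
        case True
        then show ?thesis using h(1) out0[of z] out0[of "(snd z, fst z)"] unfolding E_def
          by (auto simp: mem_Times_iff)
      next
        case False
        have "E \<le> out z + out (snd z, fst z)"
        proof (cases "fst z \<in> D1")
          case True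
          then have nd: "snd z \<notin> D2" using False sub by blast
          then have "e j (snd z) = 0" using e0 sub by blast
          then have "E \<le> out z"
            unfolding E_def using far[OF True sep[OF True nd], of "u j (fst z)" "u j (snd z)" "e j (fst z)"] True h
            by simp
          then show ?thesis using out0[of "(snd z, fst z)"] by linarith
        next
          case nf: False
          then have z1: "e j (fst z) = 0" by (rule e0)
          show ?thesis
          proof (cases "snd z \<in> D1")
            case True
            then have nd: "fst z \<notin> D2" using False sub by blast
            have "E \<le> out (snd z, fst z)"
              unfolding E_def using far[OF True sep[OF True nd], of "u j (snd z)" "u j (fst z)" "e j (snd z)"] True h z1
              by (simp add: abs_minus_commute sing_commute)
            then show ?thesis using out0[of z] by linarith
          next
            case False
            then have "E = 0" unfolding E_def using z1 e0 by simp
            then show ?thesis using out0[of z] out0[of "(snd z, fst z)"] by linarith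
          qed
        qed
        then show ?thesis using pos by linarith
      qed
      then have "\<Lambda> * E \<le> \<Lambda> * (\<epsilon> / \<Lambda> * P j z + (max 0 (Q z) + (out z + out (snd z, fst z))))"
        using K by (intro mult_left_mono) auto
      also have "\<dots> = \<epsilon> * \<bar>P j z\<bar> + Q' z"
        using K Pnn[of j z] by (simp add: Q'_def distrib_left)
      finally show "\<bar>energy_integrand p K (u j) (e j) z\<bar> \<le> \<epsilon> * \<bar>P j z\<bar> + Q' z"
        using energy_integrand_abs_le[of K z \<Lambda> s p "u j" "e j", OF h(2) K0] unfolding E_def by linarith
    qed
    then show ?thesis
      using Q'm Q'f by (intro exI[of _ Q'])
        (auto simp: AE_completion_iff nn_integral_completion intro: borel_measurable_lebesgueI)
  qed
  show "integrable lebesgue (energy_integrand p K v \<eta>)"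
    and "(\<lambda>j. integral\<^sup>L lebesgue (energy_integrand p K (u j) (e j)))
       \<longlonglongrightarrow> integral\<^sup>L lebesgue (energy_integrand p K v \<eta>)"
    using F[OF m1 m2 l m3 pb d Pnn] by blast+
qed

section \<open>Sobolev test functions\<close>

lemma nn_set_integral_lebesgue_eq:
  "(\<integral>\<^sup>+x\<in>A. ennreal (f x) \<partial>lebesgue) = (\<integral>\<^sup>+x. ennreal (indicator A x * f x) \<partial>lborel)"
  unfolding nn_integral_completion by (intro nn_integral_cong) (auto simp: indicator_def)

lemma sobolev_lp:
  assumes "u \<in> sobolev s p D"
  shows "lp_on p D u < \<infinity>"
  using assms by (simp add: sobolev_def nn_set_integral_lebesgue_eq)

lemma sobolev_seminorm:
  assumes "u \<in> sobolev s p (D :: 'a::euclidean_space set)"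
  shows "gagliardo_on s p D u < \<infinity>"
  using assms by (simp add: sobolev_def nn_set_integral_lebesgue_eq sing_def)

lemma le_one_plus_powr:
  fixes a p :: real
  assumes "1 \<le> p"
  shows "a \<le> 1 + a powr p"
proof (cases "a \<le> 1")
  case False
  then have "a powr 1 \<le> a powr p" using assms by (intro powr_mono) auto
  then show ?thesis using False by simp
qed (simp add: add_increasing2)

lemma nn_integral_indicator_bounded:
  fixes D :: "'a::euclidean_space set"
  assumes "D \<in> sets borel" "bounded D"
  shows "volume D < \<infinity>"
proof -
  have "volume D = (\<integral>\<^sup>+x. indicator D x \<partial>lborel)"
    by (intro nn_integral_cong) (auto simp: indicator_def)
  then show ?thesis using assms emeasure_bounded_finite[OF assms(2)] by simp
qed

text \<open>Enlarges the class of test functions. \<open>energy_limit\<close> is applied with the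
  supersolution as a constant sequence and with the mollifications of \<eta> as smooth test
  functions: their energies are nonnegative and converge, because their seminorms are bounded
  uniformly.\<close>

lemma weak_supersolution_test:
  fixes u \<eta> :: "'a::euclidean_space \<Rightarrow> real"
  assumes p: "1 < p" "0 < s" "s < 1" and K: "admissible_kernel s p \<Lambda> K" "1 \<le> \<Lambda>"
    and "open \<Omega>" and u: "weak_supersolution s p K \<Omega> u" and u_m [measurable]: "u \<in> borel_measurable borel"
    and G_m [measurable]: "G \<in> borel_measurable borel" and uG: "AE x in lborel. \<bar>u x\<bar> \<le> G x"
    and Gi: "tail_integral s p G < \<infinity>"
    and S: "compact S" "S \<subseteq> \<Omega>" and \<eta>_m [measurable]: "\<eta> \<in> borel_measurable borel"
    and nn: "\<And>x. 0 \<le> \<eta> x" and \<eta>S: "{x. \<eta> x \<noteq> 0} \<subseteq> S"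
    and Lp: "(\<integral>\<^sup>+x. ennreal (\<eta> x powr p) \<partial>lborel) < \<infinity>"
    and Gag: "gagliardo s p \<eta> < \<infinity>"
  shows "integrable lebesgue (energy_integrand p K u \<eta>)"
    and "0 \<le> integral\<^sup>L lebesgue (energy_integrand p K u \<eta>)"
proof -
  obtain R where R: "0 < R" "R \<le> 1" "nbhd S R \<subseteq> \<Omega>"
    using nbhd_subset_open[OF S(1) \<open>open \<Omega>\<close> S(2)] by blast
  \<comment> \<open>Three steps of length R/3: the mollifications live within r, the energy is split
    at 2r, and the closure of that set still lies in the R-neighbourhood inside \<Omega>.\<close>
  define r where "r = R / 3"
  define D1 where "D1 = nbhd S r"
  define D2 where "D2 = nbhd S (2 * r)"
  have r: "0 < r" "r \<le> 1" using R by (auto simp: r_def)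
  have c1: "compactly_inside D1 \<Omega>" and c2: "compactly_inside D2 \<Omega>"
    unfolding D1_def D2_def using S R by (auto intro!: compactly_inside_nbhd[of S _ R] simp: r_def)
  have D_m [measurable]: "D1 \<in> sets borel" "D2 \<in> sets borel"
    unfolding D1_def D2_def by (auto intro: borel_open open_nbhd)
  have D2m [measurable]: "D2 \<times> D2 \<in> sets (borel :: ('a \<times> 'a) measure)"
    unfolding D2_def by (intro borel_open open_Times open_nbhd)
  have b1: "bounded D1" unfolding D1_def using S by (intro bounded_nbhd compact_imp_bounded)
  have uW: "u \<in> sobolev s p D1" "u \<in> sobolev s p D2"
    using u c1 c2 by (auto simp: weak_supersolution_def sobolev_loc_def D1_def D2_def open_nbhd)
  obtain e \<zeta> where e: "\<And>k j. Ck j (e k)" "\<And>k x. 0 \<le> e k x"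
    "\<And>k x. \<forall>y\<in>S. r \<le> dist x y \<Longrightarrow> e k x = 0"
    "AE x in lborel. (\<lambda>k::nat. e k x) \<longlonglongrightarrow> \<eta> x"
    "\<And>k. gagliardo s p (e k) \<le> ennreal (2 powr p) * gagliardo s p \<eta>"
    and \<zeta>: "\<zeta> \<in> borel_measurable borel" "\<And>x. 0 \<le> \<zeta> x" "(\<integral>\<^sup>+x. ennreal (\<zeta> x powr p) \<partial>lborel) < \<infinity>"
    "\<And>k. AE x in lborel. e k x \<le> \<zeta> x"
    using mollified_sequence[OF p \<eta>_m nn compact_imp_bounded[OF S(1)] \<eta>S Lp Gag r(1)]
    by (elim exE conjE) (rule that; (assumption | erule spec | simp))
  note [measurable] = \<zeta>(1)
  have em [measurable]: "e k \<in> borel_measurable borel" for k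
    using e(1)[of 0 k] by (auto intro: borel_measurable_continuous_onI)
  have e0: "e k x = 0" if "x \<notin> D1" for k x
    using that by (intro e(3)) (auto simp: D1_def nbhd_def dist_commute not_less)
  have et: "e k \<in> test_functions \<Omega>" for k
  proof -
    have "{x. e k x \<noteq> 0} \<subseteq> D1" using e0 by blast
    then have "closure {x. e k x \<noteq> 0} \<subseteq> closure D1" by (rule closure_mono)
    moreover have "compact (closure {x. e k x \<noteq> 0})"
      using \<open>{x. e k x \<noteq> 0} \<subseteq> D1\<close> b1 by (auto intro: bounded_subset)
    ultimately show ?thesis
      using e(1) c1 by (auto simp: test_functions_def compactly_inside_def)
  qed
  define g where "g = enn2real (gagliardo s p \<eta>)"
  have g: "gagliardo s p \<eta> = ennreal g" "0 \<le> g"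
    using Gag by (auto simp: g_def less_top)
  define P where "P k z = \<bar>e k (fst z) - e k (snd z)\<bar> powr p * sing s p (fst z) (snd z)" for k z
  have Pm: "P k \<in> borel_measurable borel" for k unfolding P_def[abs_def] by measurable
  have Pnn: "0 \<le> P k z" for k z by (simp add: P_def)
  have PB: "(\<integral>\<^sup>+z. ennreal (P k z) \<partial>lborel) \<le> ennreal (2 powr p * g)" for k
  proof -
    have "(\<integral>\<^sup>+z. ennreal (P k z) \<partial>lborel) = gagliardo s p (e k)"
      unfolding P_def gagliardo_def ..
    also have "\<dots> \<le> ennreal (2 powr p) * gagliardo s p \<eta>" by (rule e(5))
    also have "\<dots> = ennreal (2 powr p * g)" using g by (simp add: ennreal_mult)
    finally show ?thesis .
  qed
  have \<zeta>1: "(\<integral>\<^sup>+x. ennreal (indicator D1 x * \<zeta> x) \<partial>lborel) < \<infinity>"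
  proof -
    have "(\<integral>\<^sup>+x. ennreal (indicator D1 x * \<zeta> x) \<partial>lborel)
        \<le> ennreal 1 * volume D1 + ennreal 1 * (\<integral>\<^sup>+x. ennreal (\<zeta> x powr p) \<partial>lborel)"
      using le_one_plus_powr[of p "\<zeta> x" for x] p
      by (intro nn_integral_le_lincomb) (auto simp: indicator_def)
    also have "\<dots> < \<infinity>" using \<zeta>(3) nn_integral_indicator_bounded[OF _ b1] by simp
    finally show ?thesis .
  qed
  \<comment> \<open>Here \<open>U\<close> is |u| itself: \<zeta> is only in L^p, so it is paired
    with the L^p norm of u on \<open>D1\<close>. The majorant \<open>G\<close> has only its power p
    - 1 under control.\<close>
  have \<zeta>2: "(\<integral>\<^sup>+x. ennreal (indicator D1 x * \<zeta> x * \<bar>u x\<bar> powr (p - 1)) \<partial>lborel) < \<infinity>"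
  proof -
    have "\<bar>u x\<bar> powr (p - 1) * \<zeta> x \<le> \<bar>u x\<bar> powr p + \<zeta> x powr p" for x
      using young_powr[OF p(1), of 1 "\<bar>u x\<bar>" "\<zeta> x"] \<zeta>(2) by simp
    then have "(\<integral>\<^sup>+x. ennreal (indicator D1 x * \<zeta> x * \<bar>u x\<bar> powr (p - 1)) \<partial>lborel)
        \<le> ennreal 1 * lp_on p D1 u + ennreal 1 * (\<integral>\<^sup>+x. ennreal (\<zeta> x powr p) \<partial>lborel)"
      by (intro nn_integral_le_lincomb) (auto simp: indicator_def mult.commute)
    also have "\<dots> < \<infinity>" using \<zeta>(3) sobolev_lp[OF uW(1)] by simp
    finally show ?thesis .
  qed
  have dom: "\<exists>Q. Q \<in> borel_measurable borel \<and> (\<integral>\<^sup>+z. ennreal (Q z) \<partial>lborel) < \<infinity> \<and>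
       (\<forall>k::nat. AE z in lborel. z \<in> D2 \<times> D2 \<longrightarrow>
          \<bar>u (fst z) - u (snd z)\<bar> powr (p - 1) * \<bar>e k (fst z) - e k (snd z)\<bar> * sing s p (fst z) (snd z)
          \<le> \<epsilon> * P k z + Q z)" if \<epsilon>: "0 < \<epsilon>" for \<epsilon>
  proof -
    define C where "C = \<epsilon> powr (- 1 / (p - 1))"
    \<comment> \<open>The large constant multiplies the energy of the fixed function u, which is
      finite on \<open>D2\<close>; the small one remains on the varying mollifications.\<close>
    define Q where "Q z = C * (indicator (D2 \<times> D2) z * (\<bar>u (fst z) - u (snd z)\<bar> powr p * sing s p (fst z) (snd z)))" for z
    have C: "0 \<le> C" by (simp add: C_def)
    have Qm: "Q \<in> borel_measurable borel" unfolding Q_def[abs_def] by measurable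
    have "(\<integral>\<^sup>+z. ennreal (Q z) \<partial>lborel) = ennreal C * gagliardo_on s p D2 u"
      unfolding Q_def using C by (subst nn_integral_cmult[symmetric]) (auto simp: ennreal_mult)
    also have "\<dots> < \<infinity>" using sobolev_seminorm[OF uW(2)] by (simp add: ennreal_mult_less_top)
    finally have Qf: "(\<integral>\<^sup>+z. ennreal (Q z) \<partial>lborel) < \<infinity>" .
    have "\<bar>u (fst z) - u (snd z)\<bar> powr (p - 1) * \<bar>e k (fst z) - e k (snd z)\<bar> * sing s p (fst z) (snd z)
          \<le> \<epsilon> * P k z + Q z" if "z \<in> D2 \<times> D2" for k z
    proof -
      have "\<bar>u (fst z) - u (snd z)\<bar> powr (p - 1) * \<bar>e k (fst z) - e k (snd z)\<bar>
          \<le> C * \<bar>u (fst z) - u (snd z)\<bar> powr p + \<epsilon> * \<bar>e k (fst z) - e k (snd z)\<bar> powr p"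
        unfolding C_def using p \<epsilon> by (intro young_powr') auto
      then have "\<bar>u (fst z) - u (snd z)\<bar> powr (p - 1) * \<bar>e k (fst z) - e k (snd z)\<bar> * sing s p (fst z) (snd z)
          \<le> (C * \<bar>u (fst z) - u (snd z)\<bar> powr p + \<epsilon> * \<bar>e k (fst z) - e k (snd z)\<bar> powr p) * sing s p (fst z) (snd z)"
        by (intro mult_right_mono) auto
      then show ?thesis using that by (simp add: P_def Q_def algebra_simps)
    qed
    then show ?thesis using Qm Qf by (intro exI[of _ Q]) auto
  qed
  have lim: "AE x in lborel. (\<lambda>j::nat. u x) \<longlonglongrightarrow> u x" by simp
  have e\<zeta>: "AE x in lborel. \<bar>e k x\<bar> \<le> \<zeta> x" for k
    using \<zeta>(4)[of k] by eventually_elim (simp add: e(2))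
  have sep: "r \<le> dist x y" if "x \<in> D1" "y \<notin> D2" for x y
    using nbhd_separated[of x S r y "2 * r"] that by (simp add: D1_def D2_def)
  have uU: "AE x in lborel. x \<in> D1 \<longrightarrow> \<bar>u x\<bar> \<le> \<bar>u x\<bar>" by simp
  have um: "(\<lambda>x. \<bar>u x\<bar>) \<in> borel_measurable borel" by measurable
  note L = energy_limit[OF p K u_m u_m em \<eta>_m lim e(4) D_m(1) b1 r sep e0 G_m
      \<zeta>(1) um uG e\<zeta> uU Gi \<zeta>1 \<zeta>2 Pm Pnn PB dom]
  show "integrable lebesgue (energy_integrand p K u \<eta>)" by (rule L(1))
  have "0 \<le> integral\<^sup>L lebesgue (energy_integrand p K u (e k))" for k
    using u et e(2) by (auto simp: weak_supersolution_def)
  then show "0 \<le> integral\<^sup>L lebesgue (energy_integrand p K u \<eta>)"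
    by (intro LIMSEQ_le_const[OF L(2)]) auto
qed

section \<open>The Caccioppoli estimate\<close>

lemma powr_diff_le_unit:
  fixes a b m :: real
  assumes "1 \<le> m" "0 \<le> a" "0 \<le> b" "a \<le> 1" "b \<le> 1"
  shows "\<bar>a powr m - b powr m\<bar> \<le> m * \<bar>a - b\<bar>"
proof -
  have z: "x powr m \<le> m * x" if "0 \<le> x" "x \<le> 1" for x
  proof -
    have "x powr m \<le> x powr 1" using that assms by (intro powr_mono') auto
    also have "\<dots> = x" using that by simp
    also have "\<dots> \<le> m * x" using that assms by (simp add: mult_le_cancel_right1)
    finally show ?thesis .
  qed
  consider "a = 0" | "b = 0" | "0 < a" "0 < b" using assms by linarith
  then show ?thesis
  proof cases
    case 3
    then show ?thesis using powr_diff_le[of m a b 1] assms by simp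
  qed (use z[of a] z[of b] assms in auto)
qed

text \<open>Either \<open>2 * v\<close> already dominates, or half of a^p is at most t a, and
  dividing by \<open>a\<close> bounds a^(p-1) by 2t.\<close>

lemma powr_le_of_le_linear:
  fixes a t v p :: real
  assumes "1 < p" "0 \<le> a" "0 \<le> t" "0 \<le> v" "a powr p \<le> t * a + v"
  shows "a powr p \<le> (2 * t) powr (p / (p - 1)) + 2 * v"
proof (cases "a powr p \<le> 2 * v")
  case False
  then have "a powr p / 2 \<le> t * a" and a: "0 < a" using assms by (auto intro: ccontr)
  then have "a powr (p - 1) * a \<le> 2 * t * a" using powr_minus_one_mult[of a p] by simp
  then have "a powr (p - 1) \<le> 2 * t" using a by simp
  then have "(a powr (p - 1)) powr (p / (p - 1)) \<le> (2 * t) powr (p / (p - 1))"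
    using assms by (intro powr_mono2) auto
  moreover have "(p - 1) * (p / (p - 1)) = p" using assms by simp
  ultimately show ?thesis using assms by (simp add: powr_powr)
qed (simp add: add_increasing)

text \<open>Either |b| is at least |a|/2, or |a - b| is. One factor |a| is deliberately kept in the
  first term so that \<open>b\<close> enters with power p - 1 only, the power whose average is
  controlled.\<close>

lemma powr_le_average:
  fixes a b p :: real
  assumes "1 < p"
  shows "\<bar>a\<bar> powr p \<le> 2 powr (p - 1) * \<bar>a\<bar> * \<bar>b\<bar> powr (p - 1) + 2 powr p * \<bar>a - b\<bar> powr p"
proof (cases "\<bar>a\<bar> / 2 \<le> \<bar>b\<bar>")
  case True
  have "\<bar>a\<bar> powr (p - 1) \<le> (2 * \<bar>b\<bar>) powr (p - 1)" using True assms by (intro powr_mono2) auto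
  then have "\<bar>a\<bar> powr (p - 1) * \<bar>a\<bar> \<le> (2 * \<bar>b\<bar>) powr (p - 1) * \<bar>a\<bar>" by (rule mult_right_mono) auto
  then have "\<bar>a\<bar> powr p \<le> 2 powr (p - 1) * \<bar>a\<bar> * \<bar>b\<bar> powr (p - 1)"
    using powr_minus_one_mult[of "\<bar>a\<bar>" p] by (simp add: powr_mult mult_ac)
  then show ?thesis by (simp add: add_increasing2)
next
  case False
  then have "\<bar>a\<bar> \<le> 2 * \<bar>a - b\<bar>" using abs_triangle_ineq2[of a b] by argo
  then have "\<bar>a\<bar> powr p \<le> (2 * \<bar>a - b\<bar>) powr p" using assms by (intro powr_mono2) auto
  then show ?thesis by (simp add: powr_mult add_increasing)
qed

definition sing_const :: "real \<Rightarrow> real \<Rightarrow> 'a::euclidean_space itself \<Rightarrow> real" where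
  "sing_const s p _ = enn2real (\<integral>\<^sup>+(z::'a). ennreal (min 1 (norm z powr p) * sing s p 0 z) \<partial>lborel)"

lemma nn_integral_sing_const:
  fixes x :: "'a::euclidean_space"
  assumes "0 < s" "s < 1" "1 < p"
  shows "(\<integral>\<^sup>+y. ennreal (min 1 (norm (x - y) powr p) * sing s p x y) \<partial>lborel)
    = ennreal (sing_const s p TYPE('a))"
proof -
  have "(\<integral>\<^sup>+y. ennreal (min 1 (norm (x - y) powr p) * sing s p 0 (x - y)) \<partial>lborel)
      = (\<integral>\<^sup>+(z::'a). ennreal (min 1 (norm z powr p) * sing s p 0 z) \<partial>lborel)"
    by (intro nn_integral_lborel_reflect) measurable
  moreover have "sing s p 0 (x - y) = sing s p x y" for y
    by (simp add: sing_def norm_minus_commute)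
  ultimately show ?thesis
    using nn_integral_singular_finite[OF assms, where 'a='a]
    by (simp add: sing_const_def less_top)
qed

lemma nn_integral_weighted_sing:
  fixes f :: "'a::euclidean_space \<Rightarrow> real"
  assumes "0 < s" "s < 1" "1 < p" and [measurable]: "f \<in> borel_measurable borel" and "\<And>x. 0 \<le> f x"
  shows "(\<integral>\<^sup>+z. ennreal (f (fst z) * (min 1 (norm (fst z - snd z) powr p) * sing s p (fst z) (snd z))) \<partial>lborel)
    = (\<integral>\<^sup>+x. ennreal (f x) \<partial>lborel) * ennreal (sing_const s p TYPE('a))"
proof -
  have "(\<integral>\<^sup>+z. ennreal (f (fst z) * (min 1 (norm (fst z - snd z) powr p) * sing s p (fst z) (snd z))) \<partial>lborel)
     = (\<integral>\<^sup>+x. \<integral>\<^sup>+y. ennreal (f x) * ennreal (min 1 (norm (x - y) powr p) * sing s p x y) \<partial>lborel \<partial>lborel)"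
    using assms(5) by (subst nn_integral_lborel_prod) (auto simp: ennreal_mult)
  also have "\<dots> = (\<integral>\<^sup>+x. ennreal (f x) * ennreal (sing_const s p TYPE('a)) \<partial>lborel)"
    by (intro nn_integral_cong, subst nn_integral_cmult) (auto simp: nn_integral_sing_const[OF assms(1-3)])
  also have "\<dots> = (\<integral>\<^sup>+x. ennreal (f x) \<partial>lborel) * ennreal (sing_const s p TYPE('a))"
    by (intro nn_integral_multc) auto
  finally show ?thesis .
qed

text \<open>Product rule for differences: the increment of w is multiplied by \<xi> and the
  increment of \<xi> by w. The first part stays inside D x D; the second is an L^p function times
  min(1, |x-y|^p) times the kernel, whose integral in y is finite and independent of x. The positive
  part makes the product nonnegative at every point although w is nonnegative on D only almost
  everywhere in the application.\<close>

lemma gagliardo_cutoff: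
  fixes w \<xi> :: "'a::euclidean_space \<Rightarrow> real"
  assumes p: "0 < s" "s < 1" "1 < p"
    and [measurable]: "w \<in> borel_measurable borel" "\<xi> \<in> borel_measurable borel"
    and D: "open D" and \<xi>: "\<And>x. x \<notin> D \<Longrightarrow> \<xi> x = 0" "\<And>x. 0 \<le> \<xi> x" "\<And>x. \<xi> x \<le> b"
    and lip: "\<And>x y. \<bar>\<xi> x - \<xi> y\<bar> \<le> L * min 1 (norm (x - y))" "0 \<le> L"
    and w: "lp_on p D w < \<infinity>"
      "gagliardo_on s p D w < \<infinity>"
  shows "gagliardo s p (\<lambda>x. max (w x) 0 * \<xi> x) < \<infinity>"
    and "(\<integral>\<^sup>+x. ennreal ((max (w x) 0 * \<xi> x) powr p) \<partial>lborel) < \<infinity>"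
proof -
  have [measurable]: "D \<in> sets borel" using D by simp
  have [measurable]: "D \<times> D \<in> sets (borel :: ('a \<times> 'a) measure)"
    using D by (intro borel_open open_Times)
  have b: "0 \<le> b" using \<xi>(2,3) order_trans by blast
  define f where "f x = max (w x) 0" for x
  define W where "W x = indicator D x * \<bar>w x\<bar> powr p" for x
  define V where "V z = indicator (D \<times> D) z *
         (\<bar>w (fst z) - w (snd z)\<bar> powr p * sing s p (fst z) (snd z))" for z
  define k where "k z = min 1 (norm (fst z - snd z) powr p) * sing s p (fst z) (snd z)" for z :: "'a \<times> 'a"
  have [measurable]: "W \<in> borel_measurable borel" "V \<in> borel_measurable borel" "k \<in> borel_measurable borel"
    unfolding W_def[abs_def] V_def[abs_def] k_def[abs_def] by measurable
  have nn: "0 \<le> W x" "0 \<le> V z" "0 \<le> k z" for x z by (auto simp: W_def V_def k_def)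
  have minp: "min 1 r powr p = min 1 (r powr p)" if "0 \<le> r" for r
  proof (cases "r \<le> 1")
    case True
    then have "r powr p \<le> 1 powr p" using that p by (intro powr_mono2) auto
    then show ?thesis using True by simp
  next
    case False
    then have "1 \<le> r powr p" using p by (intro ge_one_powr_ge_zero) auto
    then show ?thesis using False by simp
  qed
  have one: "(\<bar>w x\<bar> * \<bar>\<xi> x - \<xi> y\<bar>) powr p * sing s p x y \<le> L powr p * (W x * k (x, y))" if "x \<in> D" for x y
  proof -
    have "(\<bar>w x\<bar> * \<bar>\<xi> x - \<xi> y\<bar>) powr p \<le> (\<bar>w x\<bar> * (L * min 1 (norm (x - y)))) powr p"
      using p lip by (intro powr_mono2 mult_left_mono) auto
    also have "\<dots> = \<bar>w x\<bar> powr p * (L powr p * min 1 (norm (x - y) powr p))"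
      by (simp add: powr_mult minp)
    finally have "(\<bar>w x\<bar> * \<bar>\<xi> x - \<xi> y\<bar>) powr p * sing s p x y
        \<le> \<bar>w x\<bar> powr p * (L powr p * min 1 (norm (x - y) powr p)) * sing s p x y"
      by (intro mult_right_mono) auto
    then show ?thesis using that by (simp add: W_def k_def mult_ac)
  qed
  have pt: "\<bar>f (fst z) * \<xi> (fst z) - f (snd z) * \<xi> (snd z)\<bar> powr p * sing s p (fst z) (snd z)
    \<le> 2 powr p * b powr p * V z + 2 powr p * L powr p * (W (fst z) * k z)
      + 2 powr p * L powr p * (W (snd z) * k (snd z, fst z))" for z
  proof -
    obtain x y where z: "z = (x, y)" by (cases z)
    have tp: "1 \<le> (2::real) powr p" using p by (intro ge_one_powr_ge_zero) auto
    have up: "L powr p * (W x * k (x, y)) \<le> 2 powr p * L powr p * (W x * k (x, y))" for x y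
      using mult_right_mono[OF tp, of "L powr p * (W x * k (x, y))"] nn by (simp add: mult.assoc)
    have nnr: "0 \<le> 2 powr p * b powr p * V (x, y)" "\<And>x y. 0 \<le> 2 powr p * L powr p * (W x * k (x, y))"
      using nn by (auto intro!: mult_nonneg_nonneg)
    have fw: "\<bar>f x\<bar> \<le> \<bar>w x\<bar>" for x by (simp add: f_def)
    have goal: "\<bar>f x * \<xi> x - f y * \<xi> y\<bar> powr p * sing s p x y
      \<le> 2 powr p * b powr p * V (x, y) + 2 powr p * L powr p * (W x * k (x, y))
        + 2 powr p * L powr p * (W y * k (y, x))"
    proof (cases "x \<in> D")
      case True
      show ?thesis
      proof (cases "y \<in> D")
        case y: True
        have "f x * \<xi> x - f y * \<xi> y = (f x - f y) * \<xi> y + f x * (\<xi> x - \<xi> y)" by (simp add: algebra_simps)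
        then have "\<bar>f x * \<xi> x - f y * \<xi> y\<bar> \<le> \<bar>(f x - f y) * \<xi> y\<bar> + \<bar>f x * (\<xi> x - \<xi> y)\<bar>"
          using abs_triangle_ineq by simp
        also have "\<dots> = \<bar>f x - f y\<bar> * \<xi> y + \<bar>f x\<bar> * \<bar>\<xi> x - \<xi> y\<bar>"
          using \<xi>(2) by (simp add: abs_mult)
        also have "\<dots> \<le> \<bar>w x - w y\<bar> * b + \<bar>w x\<bar> * \<bar>\<xi> x - \<xi> y\<bar>"
          using \<xi>(2,3) fw by (intro add_mono mult_mono) (auto simp: f_def)
        finally have "\<bar>f x * \<xi> x - f y * \<xi> y\<bar> powr p \<le> (\<bar>w x - w y\<bar> * b + \<bar>w x\<bar> * \<bar>\<xi> x - \<xi> y\<bar>) powr p"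
          using p by (intro powr_mono2) auto
        also have "\<dots> \<le> 2 powr p * ((\<bar>w x - w y\<bar> * b) powr p + (\<bar>w x\<bar> * \<bar>\<xi> x - \<xi> y\<bar>) powr p)"
          using b p by (intro powr_add_le) auto
        finally have "\<bar>f x * \<xi> x - f y * \<xi> y\<bar> powr p * sing s p x y
            \<le> 2 powr p * ((\<bar>w x - w y\<bar> * b) powr p + (\<bar>w x\<bar> * \<bar>\<xi> x - \<xi> y\<bar>) powr p) * sing s p x y"
          by (intro mult_right_mono) auto
        also have "\<dots> = 2 powr p * b powr p * V (x, y) + 2 powr p * ((\<bar>w x\<bar> * \<bar>\<xi> x - \<xi> y\<bar>) powr p * sing s p x y)"
          using True y by (simp add: V_def powr_mult algebra_simps)
        also have "\<dots> \<le> 2 powr p * b powr p * V (x, y) + 2 powr p * (L powr p * (W x * k (x, y)))"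
          using one[OF True, of y] by (intro add_left_mono mult_left_mono) auto
        finally show ?thesis using nnr(2)[of y x] by (simp add: mult.assoc)
      next
        case y: False
        have "\<bar>f x * \<xi> x - f y * \<xi> y\<bar> \<le> \<bar>w x\<bar> * \<bar>\<xi> x - \<xi> y\<bar>"
          using \<xi>(1)[OF y] fw[of x] by (simp add: abs_mult mult_right_mono)
        then have "\<bar>f x * \<xi> x - f y * \<xi> y\<bar> powr p * sing s p x y \<le> (\<bar>w x\<bar> * \<bar>\<xi> x - \<xi> y\<bar>) powr p * sing s p x y"
          using p by (intro mult_right_mono powr_mono2) auto
        then show ?thesis using one[OF True, of y] up[of x y] nnr(1) nnr(2)[of y x] by linarith
      qed
    next
      case x: False
      show ?thesis
      proof (cases "y \<in> D")
        case True
        have "\<bar>f x * \<xi> x - f y * \<xi> y\<bar> \<le> \<bar>w y\<bar> * \<bar>\<xi> y - \<xi> x\<bar>"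
          using \<xi>(1)[OF x] fw[of y] by (simp add: abs_mult mult_right_mono)
        then have "\<bar>f x * \<xi> x - f y * \<xi> y\<bar> powr p * sing s p x y \<le> (\<bar>w y\<bar> * \<bar>\<xi> y - \<xi> x\<bar>) powr p * sing s p y x"
          unfolding sing_commute[of s p y x] using p by (intro mult_right_mono powr_mono2) auto
        then show ?thesis using one[OF True, of x] up[of y x] nnr(1) nnr(2)[of x y] by linarith
      next
        case False
        then show ?thesis using \<xi>(1)[OF x] \<xi>(1)[OF False] nnr(1) nnr(2)[of x y] nnr(2)[of y x] by simp
      qed
    qed
    then show ?thesis by (simp add: z)
  qed
  have WI: "(\<integral>\<^sup>+z. ennreal (W (fst z) * k z) \<partial>lborel) < \<infinity>"
    using nn_integral_weighted_sing[OF p, of W] nn w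
    by (simp add: k_def W_def[symmetric] ennreal_mult_less_top)
  have km: "(\<lambda>z. W (snd z) * k (snd z, fst z)) \<in> borel_measurable borel"
    unfolding k_def by measurable
  have "(\<integral>\<^sup>+z. ennreal (W (snd z) * k (snd z, fst z)) \<partial>lborel) = (\<integral>\<^sup>+z. ennreal (W (fst z) * k z) \<partial>lborel)"
    using nn_integral_lborel_swap[of "\<lambda>z. ennreal (W (fst z) * k z)"] by simp
  then have WI': "(\<integral>\<^sup>+z. ennreal (W (snd z) * k (snd z, fst z)) \<partial>lborel) < \<infinity>" using WI by simp
  have "gagliardo s p (\<lambda>x. f x * \<xi> x) \<le> (\<integral>\<^sup>+z. ennreal (2 powr p * b powr p) * ennreal (V z)
      + ennreal (2 powr p * L powr p) * ennreal (W (fst z) * k z)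
      + ennreal (2 powr p * L powr p) * ennreal (W (snd z) * k (snd z, fst z)) \<partial>lborel)"
    unfolding gagliardo_def using pt nn
    by (intro nn_integral_mono)
      (simp add: ennreal_collect ennreal_leI del: ennreal_plus)
  also have "\<dots> = ennreal (2 powr p * b powr p) * (\<integral>\<^sup>+z. ennreal (V z) \<partial>lborel)
      + ennreal (2 powr p * L powr p) * (\<integral>\<^sup>+z. ennreal (W (fst z) * k z) \<partial>lborel)
      + ennreal (2 powr p * L powr p) * (\<integral>\<^sup>+z. ennreal (W (snd z) * k (snd z, fst z)) \<partial>lborel)"
    using km by (simp add: nn_integral_add nn_integral_cmult)
  also have "\<dots> < \<infinity>"
    using WI WI' w(2) by (auto simp: ennreal_mult_less_top V_def)
  finally show "gagliardo s p (\<lambda>x. max (w x) 0 * \<xi> x) < \<infinity>" by (simp add: f_def)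
  have "(f x * \<xi> x) powr p \<le> b powr p * W x" for x
  proof (cases "x \<in> D")
    case True
    have "f x * \<xi> x \<le> \<bar>w x\<bar> * b" using \<xi>(2,3) by (intro mult_mono) (auto simp: f_def)
    then have "(f x * \<xi> x) powr p \<le> (\<bar>w x\<bar> * b) powr p"
      using p \<xi>(2) by (intro powr_mono2) (auto simp: f_def)
    then show ?thesis using True by (simp add: W_def powr_mult mult.commute)
  qed (simp add: \<xi>(1) W_def)
  then have "(\<integral>\<^sup>+x. ennreal ((f x * \<xi> x) powr p) \<partial>lborel) \<le> ennreal (b powr p) * (\<integral>\<^sup>+x. ennreal (W x) \<partial>lborel)"
    using nn by (intro nn_integral_le_cmult) auto
  also have "\<dots> < \<infinity>" using w(1) by (simp add: W_def ennreal_mult_less_top)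
  finally show "(\<integral>\<^sup>+x. ennreal ((max (w x) 0 * \<xi> x) powr p) \<partial>lborel) < \<infinity>" by (simp add: f_def)
qed

text \<open>Transfers a pointwise bound with a signed integrable term to nonnegative integrals. If
  \<open>e\<close> has infinite integral nothing is claimed; otherwise all terms can be integrated
  in the usual sense.\<close>

lemma nn_integral_le_of_integral_le_0:
  fixes f g e :: "'a \<Rightarrow> real"
  assumes f: "integrable M f" "integral\<^sup>L M f \<le> 0" and e [measurable]: "e \<in> borel_measurable M"
    and nn: "\<And>x. 0 \<le> g x" "\<And>x. 0 \<le> e x" and le: "AE x in M. g x \<le> f x + e x"
  shows "(\<integral>\<^sup>+x. ennreal (g x) \<partial>M) \<le> (\<integral>\<^sup>+x. ennreal (e x) \<partial>M)"
proof (cases "(\<integral>\<^sup>+x. ennreal (e x) \<partial>M) = \<infinity>")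
  case False
  then have ei: "integrable M e"
    using nn by (intro integrableI_bounded) (auto simp: less_top)
  have "(\<integral>\<^sup>+x. ennreal (g x) \<partial>M) \<le> (\<integral>\<^sup>+x. ennreal (f x + e x) \<partial>M)"
    by (rule nn_integral_mono_AE, use le in eventually_elim) (rule ennreal_leI)
  also have "\<dots> = ennreal (\<integral>x. f x + e x \<partial>M)"
  proof (rule nn_integral_eq_integral)
    show "AE x in M. 0 \<le> f x + e x" using le by eventually_elim (use nn order_trans in blast)
  qed (use f ei in auto)
  also have "\<dots> \<le> ennreal (integral\<^sup>L M e)" using f ei by (intro ennreal_leI) auto
  also have "\<dots> = (\<integral>\<^sup>+x. ennreal (e x) \<partial>M)"
    using ei nn by (intro nn_integral_eq_integral[symmetric]) auto
  finally show ?thesis .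
qed simp

section \<open>Weighted energies for a Lipschitz cutoff\<close>

locale cutoff_weight =
  fixes s p :: real and \<psi> :: "'a::euclidean_space \<Rightarrow> real" and D :: "'a set"
  assumes s: "0 < s" "s < 1" and p: "1 < p"
    and psi_nonneg: "0 \<le> \<psi> x" and psi_le: "\<psi> x \<le> 1" and psi_lip: "\<bar>\<psi> x - \<psi> y\<bar> \<le> norm (x - y)"
    and psi_zero: "x \<notin> D \<Longrightarrow> \<psi> x = 0" and open_D: "open D" and bounded_D: "bounded D"
begin

definition b :: real where "b = real DIM('a) + s * p"

text \<open>The exponent of the cutoff is chosen so large that every power of \<open>\<psi>\<close> arising below
  is nonnegative.\<close>

definition m :: real where "m = p + b + b / (p - 1) + real DIM('a) * (p / (p - 1)) / s"

text \<open>With Lipschitz constant 1, the factor 1/2 forces \<psi> to be positive at both points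
  and comparable within a factor 2. The maximum makes the set symmetric.\<close>

definition near :: "('a \<times> 'a) set" where
  "near = {z. norm (fst z - snd z) < max (\<psi> (fst z)) (\<psi> (snd z)) / 2}"

definition X :: "('a \<Rightarrow> real) \<Rightarrow> ennreal" where
  "X w = (\<integral>\<^sup>+z. ennreal (indicator near z * (\<psi> (fst z) powr m *
     (\<bar>w (fst z) - w (snd z)\<bar> powr p * sing s p (fst z) (snd z)))) \<partial>lborel)"

definition q :: "('a \<Rightarrow> real) \<Rightarrow> 'a \<Rightarrow> real" where
  "q w x = \<bar>w x\<bar> powr p * \<psi> x powr (m - p)"

text \<open>The existential quantifiers hide the data on which the constants below must not depend.\<close>

definition tested :: "real \<Rightarrow> real \<Rightarrow> ('a \<Rightarrow> real) \<Rightarrow> bool" where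
  "tested \<Lambda> T w \<longleftrightarrow> (\<exists>K H. admissible_kernel s p \<Lambda> K \<and> w \<in> borel_measurable borel \<and> H \<in> borel_measurable borel \<and>
     (AE x in lborel. \<bar>w x\<bar> \<le> H x) \<and> (AE x in lborel. x \<in> D \<longrightarrow> 0 \<le> w x) \<and>
     tail_integral s p H \<le> ennreal T \<and>
     integrable lebesgue (energy_integrand p K w (\<lambda>x. max (w x) 0 * \<psi> x powr m)) \<and>
     integral\<^sup>L lebesgue (energy_integrand p K w (\<lambda>x. max (w x) 0 * \<psi> x powr m)) \<le> 0)"

definition Y :: "('a \<Rightarrow> real) \<Rightarrow> ennreal" where
  "Y w = (\<integral>\<^sup>+x. ennreal (q w x) \<partial>lborel)"

lemma b_pos: "0 < b"
  using s p by (simp add: b_def add_nonneg_pos)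

lemma m_ge: "p + b + b / (p - 1) \<le> m" "p + real DIM('a) * (p / (p - 1)) / s \<le> m" "1 \<le> m"
  using s p b_pos by (auto simp: m_def add_increasing2)

lemma continuous_psi: "continuous_on UNIV \<psi>"
proof -
  have "1-lipschitz_on UNIV \<psi>"
    using psi_lip by (intro lipschitz_onI) (auto simp: dist_norm)
  then show ?thesis by (rule lipschitz_on_continuous_on)
qed

lemma psi_measurable [measurable]: "\<psi> \<in> borel_measurable borel"
  by (rule borel_measurable_continuous_onI[OF continuous_psi])

lemma q_nonneg: "0 \<le> q w x"
  by (simp add: q_def)

lemma q_measurable [measurable]:
  assumes [measurable]: "w \<in> borel_measurable borel"
  shows "q w \<in> borel_measurable borel"
  unfolding q_def[abs_def] by measurable

lemma D_measurable [measurable]: "D \<in> sets borel"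
  using open_D by simp

lemma near_measurable [measurable]: "near \<in> sets borel"
  unfolding near_def by measurable

lemma near_pos:
  assumes "z \<in> near"
  shows "0 < \<psi> (fst z)" "0 < \<psi> (snd z)" "fst z \<in> D" "snd z \<in> D"
proof -
  show *: "0 < \<psi> (fst z)" "0 < \<psi> (snd z)"
    using assms psi_lip[of "fst z" "snd z"] norm_ge_zero[of "fst z - snd z"]
      psi_nonneg[of "fst z"] psi_nonneg[of "snd z"]
    by (auto simp: near_def max_def split: if_splits)
  show "fst z \<in> D" "snd z \<in> D"
    using psi_zero[of "fst z"] psi_zero[of "snd z"] * by auto
qed

lemma psi_powr_le_1: "0 \<le> a \<Longrightarrow> \<psi> x powr a \<le> 1"
  using psi_nonneg psi_le by (intro powr_le1) auto

text \<open>The far estimate leaves |w| with weight \<psi>^(m-b), linear in w. Below the threshold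
  \<psi>^(-b/(p-1)) the large exponent m makes the product at most 1; above it \<psi>^(-b) is at
  most |w|^(p-1), and this turns the linear term into the p-th power.\<close>

lemma weighted_linear_le:
  "\<bar>w x\<bar> * \<psi> x powr (m - b) \<le> q w x + indicator D x"
proof (cases "\<psi> x = 0")
  case True
  then show ?thesis by (simp add: q_def)
next
  case False
  then have pos: "0 < \<psi> x" and x: "x \<in> D" using psi_nonneg[of x] psi_zero[of x] by auto
  define \<kappa> where "\<kappa> = b / (p - 1)"
  show ?thesis
  proof (cases "\<bar>w x\<bar> \<le> \<psi> x powr (- \<kappa>)")
    case True
    then have "\<bar>w x\<bar> * \<psi> x powr (m - b) \<le> \<psi> x powr (- \<kappa>) * \<psi> x powr (m - b)"
      by (intro mult_right_mono) auto
    also have "\<dots> = \<psi> x powr (m - b - \<kappa>)" by (simp add: powr_add[symmetric])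
    also have "\<dots> \<le> 1" using m_ge(1) p by (intro psi_powr_le_1) (simp add: \<kappa>_def)
    finally show ?thesis using x q_nonneg[of w x] by simp
  next
    case False
    have "\<psi> x powr (- b) = (\<psi> x powr (- \<kappa>)) powr (p - 1)"
      using p by (simp add: powr_powr \<kappa>_def)
    also have "\<dots> \<le> \<bar>w x\<bar> powr (p - 1)" using False p by (intro powr_mono2) auto
    finally have 1: "\<psi> x powr (- b) \<le> \<bar>w x\<bar> powr (p - 1)" .
    have "\<psi> x powr (m - b) = \<psi> x powr p * (\<psi> x powr (- b) * \<psi> x powr (m - p))"
      by (simp add: powr_add[symmetric])
    also have "\<dots> \<le> 1 * (\<bar>w x\<bar> powr (p - 1) * \<psi> x powr (m - p))"
      using 1 p by (intro mult_mono psi_powr_le_1) auto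
    finally have "\<bar>w x\<bar> * \<psi> x powr (m - b) \<le> \<bar>w x\<bar> * (\<bar>w x\<bar> powr (p - 1) * \<psi> x powr (m - p))"
      by (intro mult_left_mono) auto
    also have "\<dots> = q w x"
      using powr_minus_one_mult[of "\<bar>w x\<bar>" p] by (simp add: q_def mult_ac)
    finally show ?thesis by (simp add: add_increasing2)
  qed
qed

text \<open>Pointwise \<open>good\<close> is at most the energy integrand plus \<open>err\<close>,
  and the energy is at most 0. Near errors integrate to a multiple of Y through the singular
  integral; far errors are products of an integral over D and the tail integral of H, hence at most
  (Y + |D|) T. The constant sees T, \<Lambda> and the data of the locale only.\<close>

lemma caccioppoli:
  assumes "0 \<le> T" "1 \<le> \<Lambda>"
  obtains a where "0 \<le> a"
    "\<And>w. tested \<Lambda> T w \<Longrightarrow> X w \<le> ennreal a * (Y w + 1)"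
proof -
  obtain c C where c: "0 < c" and C: "0 \<le> C" and near_le:
    "\<And>a b \<alpha> \<beta> d. \<lbrakk>0 \<le> a; 0 \<le> b; 0 < \<alpha>; 0 < \<beta>; \<bar>\<alpha> - \<beta>\<bar> \<le> d; d \<le> max \<alpha> \<beta> / 2\<rbrakk> \<Longrightarrow>
       c * \<bar>a - b\<bar> powr p * \<alpha> powr m - C * (a powr p * \<alpha> powr (m - p) * d powr p)
       \<le> signed_pow p (a - b) * (a * \<alpha> powr m - b * \<beta> powr m)"
    using caccioppoli_near[OF p m_ge(3)] by blast
  obtain R where R: "0 \<le> R" "\<And>x. x \<in> D \<Longrightarrow> norm x \<le> R"
    using bounded_D by (auto simp: bounded_pos intro: less_imp_le)
  \<comment> \<open>\<open>sing_le_tailw\<close> at separation \<psi>(x)/2 gives the constant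
    (2(2+R)/\<psi>(x))^b; \<open>A\<close> is its part independent of \<psi>.\<close>
  define A where "A = (2 * (2 + R)) powr b"
  define d where "d = enn2real (volume D)"
  have d: "volume D = ennreal d" "0 \<le> d"
    using nn_integral_indicator_bounded[OF _ bounded_D] by (auto simp: d_def less_top)
  define S where "S = sing_const s p TYPE('a)"
  have S: "0 \<le> S" by (simp add: S_def sing_const_def)
  have A: "0 \<le> A" by (simp add: A_def)
  \<comment> \<open>The near error contributes \<open>C * \<Lambda> * S\<close> times Y, and the two
    far errors contribute \<Lambda> A T (Y + d) each; the final 1 only makes the constant
    positive.\<close>
  define a' where "a' = C * \<Lambda> * S + 2 * \<Lambda> * A * T * (1 + d) + 1"
  have a': "0 < a'" using C S A d assms by (auto simp: a'_def add_nonneg_pos)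
  define a where "a = \<Lambda> / c * a'"
  show ?thesis
  proof (rule that[of a])
    show "0 \<le> a" using a' c assms by (simp add: a_def)
    fix w assume "tested \<Lambda> T w"
    then obtain K H where K: "admissible_kernel s p \<Lambda> K"
      and [measurable]: "w \<in> borel_measurable borel" "H \<in> borel_measurable borel"
      and wH: "AE x in lborel. \<bar>w x\<bar> \<le> H x" and w0: "AE x in lborel. x \<in> D \<longrightarrow> 0 \<le> w x"
      and T: "tail_integral s p H \<le> ennreal T"
      and f: "integrable lebesgue (energy_integrand p K w (\<lambda>x. max (w x) 0 * \<psi> x powr m))"
         "integral\<^sup>L lebesgue (energy_integrand p K w (\<lambda>x. max (w x) 0 * \<psi> x powr m)) \<le> 0"
      unfolding tested_def by blast
    define good where "good z = c / \<Lambda> * (indicator near z * (\<psi> (fst z) powr m *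
     (\<bar>w (fst z) - w (snd z)\<bar> powr p * sing s p (fst z) (snd z))))" for z
    define e1 where "e1 z = q w (fst z) * (min 1 (norm (fst z - snd z) powr p) * sing s p (fst z) (snd z))" for z
    define e2 where "e2 z = (q w (fst z) + indicator D (fst z)) * (H (snd z) powr (p - 1) * tailw s p (snd z))" for z
    define err where "err z = C * \<Lambda> * e1 z + \<Lambda> * A * (e2 z + e2 (snd z, fst z))" for z
    have e1m [measurable]: "e1 \<in> borel_measurable borel" unfolding e1_def[abs_def] by measurable
    have e2m [measurable]: "e2 \<in> borel_measurable borel" unfolding e2_def[abs_def] by measurable
    have e2m' [measurable]: "(\<lambda>z. e2 (snd z, fst z)) \<in> borel_measurable borel"
      unfolding e2_def fst_conv snd_conv by measurable
    have errm: "err \<in> borel_measurable borel" unfolding err_def[abs_def] by measurable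
    have e0: "0 \<le> e1 z" "0 \<le> e2 z" for z using q_nonneg by (auto simp: e1_def e2_def)
    have e10: "0 \<le> C * \<Lambda> * e1 z" "0 \<le> \<Lambda> * A * (e2 z + e2 (snd z, fst z))" for z
      using C A assms e0 by auto
    have far: "H y powr (p - 1) * (max (w x) 0 * \<psi> x powr m) * sing s p x y \<le> A * e2 (x, y)"
      if "max (\<psi> x) (\<psi> y) / 2 \<le> norm (x - y)" for x y
    proof (cases "\<psi> x = 0")
      case True
      then show ?thesis using A e0 by simp
    next
      case False
      then have pos: "0 < \<psi> x" and x: "x \<in> D" using psi_nonneg[of x] psi_zero[of x] by auto
      have "sing s p x y \<le> ((2 + R) / (\<psi> x / 2)) powr b * tailw s p y"
        unfolding b_def using s p R(2)[OF x] pos that psi_le[of x]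
        by (intro sing_le_tailw) (auto simp: dist_norm)
      also have "((2 + R) / (\<psi> x / 2)) powr b = A * \<psi> x powr (- b)"
        using R pos by (simp add: A_def powr_divide powr_minus_divide powr_mult algebra_simps)
      finally have sg: "sing s p x y \<le> A * \<psi> x powr (- b) * tailw s p y" .
      have "H y powr (p - 1) * (max (w x) 0 * \<psi> x powr m) * sing s p x y
        \<le> H y powr (p - 1) * (\<bar>w x\<bar> * \<psi> x powr m) * (A * \<psi> x powr (- b) * tailw s p y)"
        using sg by (intro mult_mono mult_left_mono mult_right_mono) auto
      also have "\<dots> = A * ((\<bar>w x\<bar> * \<psi> x powr (m - b)) * (H y powr (p - 1) * tailw s p y))"
        using pos by (simp add: powr_diff powr_minus field_simps)
      also have "\<dots> \<le> A * ((q w x + indicator D x) * (H y powr (p - 1) * tailw s p y))"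
        using A weighted_linear_le by (intro mult_left_mono mult_right_mono) auto
      finally show ?thesis by (simp add: e2_def)
    qed
    have "AE z in lborel. good z \<le> energy_integrand p K w (\<lambda>x. max (w x) 0 * \<psi> x powr m) z + err z"
      using AE_lborel_fst[OF wH] AE_lborel_snd[OF wH] AE_lborel_fst[OF w0] AE_lborel_snd[OF w0]
        admissible_kernel_bounds[OF K \<open>1 \<le> \<Lambda>\<close>]
    proof eventually_elim
      fix z :: "'a \<times> 'a"
      assume h: "\<bar>w (fst z)\<bar> \<le> H (fst z)" "\<bar>w (snd z)\<bar> \<le> H (snd z)"
        "fst z \<in> D \<longrightarrow> 0 \<le> w (fst z)" "snd z \<in> D \<longrightarrow> 0 \<le> w (snd z)"
        "K (fst z) (snd z) \<le> \<Lambda> * sing s p (fst z) (snd z)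
          \<and> sing s p (fst z) (snd z) \<le> \<Lambda> * K (fst z) (snd z)"
      obtain x y where z: "z = (x, y)" by (cases z)
      have K0: "0 \<le> K x y" using K by (simp add: admissible_kernel_def)
      define J where "J = signed_pow p (w x - w y) * (max (w x) 0 * \<psi> x powr m - max (w y) 0 * \<psi> y powr m)"
      have E: "energy_integrand p K w (\<lambda>x. max (w x) 0 * \<psi> x powr m) z = J * K x y"
        by (simp add: energy_integrand_eq z J_def)
      show "good z \<le> energy_integrand p K w (\<lambda>x. max (w x) 0 * \<psi> x powr m) z + err z"
      proof (cases "z \<in> near")
        case True
        note np = near_pos[OF True]
        have w: "0 \<le> w x" "0 \<le> w y" using h np by (auto simp: z)
        have dn: "norm (x - y) < max (\<psi> x) (\<psi> y) / 2" using True by (simp add: near_def z)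
        then have n1: "norm (x - y) \<le> 1" using psi_le[of x] psi_le[of y] by (auto simp: max_def split: if_splits)
        have "c * \<bar>w x - w y\<bar> powr p * \<psi> x powr m
            - C * (w x powr p * \<psi> x powr (m - p) * norm (x - y) powr p)
          \<le> signed_pow p (w x - w y) * (w x * \<psi> x powr m - w y * \<psi> y powr m)"
          using w np dn psi_lip[of x y] by (intro near_le) (auto simp: z)
        then have "c * \<bar>w x - w y\<bar> powr p * \<psi> x powr m - C * (q w x * norm (x - y) powr p) \<le> J"
          using w by (simp add: J_def q_def max_def mult.assoc)
        then have "(c * \<bar>w x - w y\<bar> powr p * \<psi> x powr m - C * (q w x * norm (x - y) powr p)) * K x y \<le> J * K x y"
          using K0 by (rule mult_right_mono)
        moreover have "c * \<bar>w x - w y\<bar> powr p * \<psi> x powr m * (sing s p x y / \<Lambda>)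
            \<le> c * \<bar>w x - w y\<bar> powr p * \<psi> x powr m * K x y"
          using h(5) c assms by (intro mult_left_mono) (auto simp: z field_simps)
        moreover have "C * (q w x * norm (x - y) powr p) * K x y
            \<le> C * (q w x * norm (x - y) powr p) * (\<Lambda> * sing s p x y)"
          using h(5) C q_nonneg by (intro mult_left_mono) (auto simp: z)
        \<comment> \<open>Near pairs have |x - y| \<le> 1 because \<psi> \<le> 1, so the minimum in
          \<open>e1\<close> is |x - y|^p.\<close>
        moreover have "C * (q w x * norm (x - y) powr p) * (\<Lambda> * sing s p x y) = C * \<Lambda> * e1 z"
        proof -
          have "norm (x - y) powr p \<le> 1" using n1 p by (intro powr_le1) auto
          then show ?thesis by (simp add: e1_def z)
        qed
        moreover have "good z = c * \<bar>w x - w y\<bar> powr p * \<psi> x powr m * (sing s p x y / \<Lambda>)"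
          using True by (simp add: good_def z)
        ultimately show ?thesis
          using e10(2)[of z] unfolding E err_def by (simp add: left_diff_distrib)
      next
        \<comment> \<open>On far pairs \<open>good\<close> vanishes, and it remains to bound the
          negative part of the energy integrand.\<close>
        case False
        then have dn: "max (\<psi> x) (\<psi> y) / 2 \<le> norm (x - y)" by (simp add: near_def z not_less)
        have "- (\<bar>w y\<bar> powr (p - 1) * (max (w x) 0 * \<psi> x powr m) + \<bar>w x\<bar> powr (p - 1) * (max (w y) 0 * \<psi> y powr m)) \<le> J"
          unfolding J_def by (intro caccioppoli_far p) auto
        moreover have "\<bar>w y\<bar> powr (p - 1) * (max (w x) 0 * \<psi> x powr m) \<le> H y powr (p - 1) * (max (w x) 0 * \<psi> x powr m)"
          using h p by (intro mult_right_mono powr_mono2) (auto simp: z)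
        moreover have "\<bar>w x\<bar> powr (p - 1) * (max (w y) 0 * \<psi> y powr m) \<le> H x powr (p - 1) * (max (w y) 0 * \<psi> y powr m)"
          using h p by (intro mult_right_mono powr_mono2) (auto simp: z)
        ultimately have "- J \<le> H y powr (p - 1) * (max (w x) 0 * \<psi> x powr m) + H x powr (p - 1) * (max (w y) 0 * \<psi> y powr m)"
          (is "_ \<le> ?h") by linarith
        then have "- J * K x y \<le> ?h * K x y" using K0 by (rule mult_right_mono)
        also have "\<dots> \<le> ?h * (\<Lambda> * sing s p x y)"
          using h(5) by (intro mult_left_mono) (auto simp: z)
        also have "\<dots> = \<Lambda> * (H y powr (p - 1) * (max (w x) 0 * \<psi> x powr m) * sing s p x y
            + H x powr (p - 1) * (max (w y) 0 * \<psi> y powr m) * sing s p y x)"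
          by (simp add: algebra_simps sing_commute[of s p y x])
        also have "\<dots> \<le> \<Lambda> * (A * e2 (x, y) + A * e2 (y, x))"
          using far[of x y] far[of y x] dn assms
          by (intro mult_left_mono add_mono) (auto simp: norm_minus_commute max.commute)
        also have "\<dots> = \<Lambda> * A * (e2 z + e2 (snd z, fst z))" by (simp add: z algebra_simps)
        finally have "- J * K x y \<le> \<Lambda> * A * (e2 z + e2 (snd z, fst z))" .
        then show ?thesis using False e10(1)[of z] unfolding E err_def by (simp add: good_def)
      qed
    qed
    then have "(\<integral>\<^sup>+z. ennreal (good z) \<partial>lebesgue) \<le> (\<integral>\<^sup>+z. ennreal (err z) \<partial>lebesgue)"
      using errm e10 c assms
      by (intro nn_integral_le_of_integral_le_0[OF f])
        (auto simp: AE_completion_iff good_def err_def[symmetric] intro: borel_measurable_lebesgueI,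
         auto simp: err_def)
    then have main: "(\<integral>\<^sup>+z. ennreal (good z) \<partial>lborel) \<le> (\<integral>\<^sup>+z. ennreal (err z) \<partial>lborel)"
      by (simp only: nn_integral_completion)
    have I1: "(\<integral>\<^sup>+z. ennreal (e1 z) \<partial>lborel) = Y w * ennreal S"
      unfolding e1_def Y_def S_def by (intro nn_integral_weighted_sing s p q_nonneg) measurable
    have I2: "(\<integral>\<^sup>+z. ennreal (e2 z) \<partial>lborel) \<le> (Y w + ennreal d) * ennreal T"
    proof -
      have "(\<integral>\<^sup>+z. ennreal (e2 z) \<partial>lborel) = (\<integral>\<^sup>+z. (ennreal (q w (fst z)) + ennreal (indicator D (fst z)))
          * ennreal (H (snd z) powr (p - 1) * tailw s p (snd z)) \<partial>lborel)"
        using q_nonneg by (intro nn_integral_cong)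
          (simp add: e2_def ennreal_collect del: ennreal_plus)
      also have "\<dots> = (\<integral>\<^sup>+x. ennreal (q w x) + ennreal (indicator D x) \<partial>lborel)
          * tail_integral s p H"
        by (rule nn_integral_lborel_times[of "\<lambda>x. ennreal (q w x) + ennreal (indicator D x)"
              "\<lambda>y. ennreal (H y powr (p - 1) * tailw s p y)"]) measurable
      also have "(\<integral>\<^sup>+x. ennreal (q w x) + ennreal (indicator D x) \<partial>lborel) = Y w + ennreal d"
        by (subst nn_integral_add) (auto simp: Y_def d)
      also have "(Y w + ennreal d) * tail_integral s p H
          \<le> (Y w + ennreal d) * ennreal T"
        using T by (intro mult_left_mono) auto
      finally show ?thesis .
    qed
    have I2': "(\<integral>\<^sup>+z. ennreal (e2 (snd z, fst z)) \<partial>lborel) = (\<integral>\<^sup>+z. ennreal (e2 z) \<partial>lborel)"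
      using nn_integral_lborel_swap[of "\<lambda>z. ennreal (e2 z)"] by simp
    have "(\<integral>\<^sup>+z. ennreal (err z) \<partial>lborel) = (\<integral>\<^sup>+z. ennreal (C * \<Lambda>) * ennreal (e1 z)
        + ennreal (\<Lambda> * A) * (ennreal (e2 z) + ennreal (e2 (snd z, fst z))) \<partial>lborel)"
      using C A assms e0 by (intro nn_integral_cong)
        (simp add: err_def ennreal_collect del: ennreal_plus)
    also have "\<dots> = ennreal (C * \<Lambda>) * (Y w * ennreal S) + ennreal (\<Lambda> * A) *
        ((\<integral>\<^sup>+z. ennreal (e2 z) \<partial>lborel) + (\<integral>\<^sup>+z. ennreal (e2 z) \<partial>lborel))"
      by (simp add: nn_integral_add nn_integral_cmult I1 I2')
    also have "\<dots> \<le> ennreal (C * \<Lambda>) * (Y w * ennreal S) + ennreal (\<Lambda> * A) *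
        ((Y w + ennreal d) * ennreal T + (Y w + ennreal d) * ennreal T)"
      using I2 by (intro add_left_mono mult_left_mono add_mono) auto
    also have "\<dots> \<le> ennreal a' * (Y w + 1)"
    proof (cases "Y w")
      case (real r)
      have "C * \<Lambda> * (r * S) + \<Lambda> * A * ((r + d) * T + (r + d) * T) \<le> a' * (r + 1)"
        using real C A S d assms by (simp add: a'_def algebra_simps)
      then show ?thesis
        using real C A S d assms a'
        by (simp add: ennreal_collect ennreal_1[symmetric] ennreal_leI
            del: ennreal_plus ennreal_1)
    next
      case top
      then show ?thesis using a' by (simp add: ennreal_mult_top)
    qed
    finally have err: "(\<integral>\<^sup>+z. ennreal (err z) \<partial>lborel) \<le> ennreal a' * (Y w + 1)" .
    have "(\<integral>\<^sup>+z. ennreal (good z) \<partial>lborel) = ennreal (c / \<Lambda>) * X w"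
      unfolding X_def good_def using c assms
      by (subst nn_integral_cmult[symmetric]) (auto simp: ennreal_mult[symmetric])
    then have "ennreal (c / \<Lambda>) * X w \<le> ennreal a' * (Y w + 1)"
      using main err by simp
    then have "ennreal (\<Lambda> / c) * (ennreal (c / \<Lambda>) * X w) \<le> ennreal (\<Lambda> / c) * (ennreal a' * (Y w + 1))"
      by (rule mult_left_mono) auto
    moreover have "ennreal (\<Lambda> / c) * ennreal (c / \<Lambda>) = 1"
      using c assms by (simp add: ennreal_mult[symmetric])
    moreover have "ennreal (\<Lambda> / c) * ennreal a' = ennreal a"
      using c assms a' by (simp add: ennreal_mult[symmetric] a_def)
    ultimately show "X w \<le> ennreal a * (Y w + 1)"
      by (simp add: mult.assoc[symmetric])
  qed
qed

end

section \<open>Averaging over small balls and absorption\<close>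

context cutoff_weight
begin

definition V :: "('a \<Rightarrow> real) \<Rightarrow> 'a \<Rightarrow> ennreal" where
  "V w x = (\<integral>\<^sup>+y. ennreal (indicator near (x, y) * (\<bar>w x - w y\<bar> powr p * sing s p x y)) \<partial>lborel)"

lemma X_eq:
  assumes [measurable]: "w \<in> borel_measurable borel"
  shows "X w = (\<integral>\<^sup>+x. ennreal (\<psi> x powr m) * V w x \<partial>lborel)"
proof -
  have km: "(\<lambda>z. ennreal (indicator near z * (\<bar>w (fst z) - w (snd z)\<bar> powr p * sing s p (fst z) (snd z))))
      \<in> borel_measurable borel"
    by measurable
  have "X w = (\<integral>\<^sup>+x. \<integral>\<^sup>+y. ennreal (\<psi> x powr m) *
      ennreal (indicator near (x, y) * (\<bar>w x - w y\<bar> powr p * sing s p x y)) \<partial>lborel \<partial>lborel)"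
    unfolding X_def
    by (subst nn_integral_lborel_prod) (auto simp: ennreal_mult[symmetric] mult_ac)
  also have "\<dots> = (\<integral>\<^sup>+x. ennreal (\<psi> x powr m) * V w x \<partial>lborel)"
    unfolding V_def using borel_measurable_Pair1[OF km]
    by (intro nn_integral_cong nn_integral_cmult) simp
  finally show ?thesis .
qed

text \<open>As s < 1 and \<psi> \<le> 1, the radius \<theta> \<psi>^(1/s) is at most \<psi>/4, so
  the averaging balls see near pairs only.\<close>

lemma near_ball:
  assumes "0 < \<psi> x" "0 < \<theta>" "\<theta> \<le> 1 / 4" "norm (x - y) < \<theta> * \<psi> x powr (1 / s)"
  shows "(x, y) \<in> near"
proof -
  have "\<psi> x powr (1 / s) \<le> \<psi> x powr 1"
    using assms psi_le[of x] s by (intro powr_mono') auto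
  then have "\<theta> * \<psi> x powr (1 / s) \<le> 1 / 4 * \<psi> x"
    using assms by (intro mult_mono) auto
  then show ?thesis using assms by (auto simp: near_def max_def)
qed

text \<open>|w(x)|^p is averaged over the ball of radius r = \<theta> \<psi>(x)^(1/s). The
  oscillation costs r^(sp) = \<theta>^(sp) \<psi>^p, which converts the weight \<psi>^(m-p) of
  \<open>q\<close> into the weight \<psi>^m of \<open>X\<close> with a small factor. The mean of
  |w|^(p-1) is at most T' r^(-n) up to constants and multiplies |w(x)| linearly, so
  \<open>powr_le_of_le_linear\<close> turns it into a constant.\<close>

lemma interpolation_pointwise:
  assumes [measurable]: "w \<in> borel_measurable borel"
    and T': "(\<integral>\<^sup>+y. ennreal (indicator D y * \<bar>w y\<bar> powr (p - 1)) \<partial>lborel) \<le> ennreal T'" "0 \<le> T'"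
    and \<theta>: "0 < \<theta>" "\<theta> \<le> 1 / 4" and x: "0 < \<psi> x" and v: "V w x = ennreal v" "0 \<le> v"
    and \<omega>: "emeasure lborel (ball (0::'a) 1) = ennreal \<omega>" "0 < \<omega>"
  shows "q w x \<le> 2 powr (p + 1) / \<omega> * \<theta> powr (s * p) * (\<psi> x powr m * v)
    + (2 powr p * T' / (\<omega> * \<theta> ^ DIM('a))) powr (p / (p - 1))"
proof -
  define n where "n = real DIM('a)"
  define r where "r = \<theta> * \<psi> x powr (1 / s)"
  have r: "0 < r" using \<theta> x by (simp add: r_def)
  have [measurable]: "ball x r \<in> sets borel" by simp
  have km: "(\<lambda>z. ennreal (indicator near z * (\<bar>w (fst z) - w (snd z)\<bar> powr p * sing s p (fst z) (snd z))))
      \<in> borel_measurable borel"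
    by measurable
  have km' [measurable]: "(\<lambda>y. ennreal (indicator near (x, y) * (\<bar>w x - w y\<bar> powr p * sing s p x y))) \<in> borel_measurable borel"
    using borel_measurable_Pair1[OF km, of x] by simp
  have pt: "indicator (ball x r) y * \<bar>w x\<bar> powr p
      \<le> 2 powr (p - 1) * \<bar>w x\<bar> * (indicator D y * \<bar>w y\<bar> powr (p - 1))
       + 2 powr p * r powr b * (indicator near (x, y) * (\<bar>w x - w y\<bar> powr p * sing s p x y))" for y
  proof (cases "y \<in> ball x r")
    case True
    then have xy: "norm (x - y) < r" by (simp add: dist_norm)
    then have nr: "(x, y) \<in> near" using near_ball[OF x \<theta>] by (simp add: r_def)
    have yD: "y \<in> D" using near_pos(4)[OF nr] by simp
    \<comment> \<open>Inside the ball \<open>r powr b * sing s p x y\<close> is at least 1 off the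
      diagonal. On the diagonal \<open>sing\<close> is 0, but there the left side vanishes
      too.\<close>
    have "\<bar>w x - w y\<bar> powr p \<le> r powr b * (\<bar>w x - w y\<bar> powr p * sing s p x y)"
    proof (cases "x = y")
      case False
      have "norm (x - y) powr b \<le> r powr b" using xy b_pos by (intro powr_mono2) auto
      then have "1 \<le> r powr b * sing s p x y"
        using False by (simp add: sing_def b_def)
      then have "\<bar>w x - w y\<bar> powr p * 1 \<le> \<bar>w x - w y\<bar> powr p * (r powr b * sing s p x y)"
        by (intro mult_left_mono) auto
      then show ?thesis by (simp add: mult_ac)
    qed simp
    then have "2 powr p * \<bar>w x - w y\<bar> powr p \<le> 2 powr p * (r powr b * (\<bar>w x - w y\<bar> powr p * sing s p x y))"
      by (intro mult_left_mono) auto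
    then have "\<bar>w x\<bar> powr p \<le> 2 powr (p - 1) * \<bar>w x\<bar> * \<bar>w y\<bar> powr (p - 1)
        + 2 powr p * (r powr b * (\<bar>w x - w y\<bar> powr p * sing s p x y))"
      using powr_le_average[OF p, of "w x" "w y"] by linarith
    then show ?thesis using True nr yD by (simp add: mult.assoc)
  qed simp
  have "ennreal (\<omega> * r ^ DIM('a) * \<bar>w x\<bar> powr p)
      = (\<integral>\<^sup>+y. ennreal (\<bar>w x\<bar> powr p) * indicator (ball x r) y \<partial>lborel)"
    using r \<omega> by (subst nn_integral_cmult_indicator)
      (auto simp: emeasure_ball_le[of r x] ennreal_mult[symmetric] mult_ac)
  also have "\<dots> \<le> (\<integral>\<^sup>+y. ennreal (2 powr (p - 1) * \<bar>w x\<bar>) * ennreal (indicator D y * \<bar>w y\<bar> powr (p - 1))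
       + ennreal (2 powr p * r powr b) * ennreal (indicator near (x, y) * (\<bar>w x - w y\<bar> powr p * sing s p x y)) \<partial>lborel)"
  proof (intro nn_integral_mono)
    fix y
    have "ennreal (\<bar>w x\<bar> powr p) * indicator (ball x r) y = ennreal (indicator (ball x r) y * \<bar>w x\<bar> powr p)"
      by (auto simp: indicator_def)
    also have "\<dots> \<le> ennreal (2 powr (p - 1) * \<bar>w x\<bar> * (indicator D y * \<bar>w y\<bar> powr (p - 1))
       + 2 powr p * r powr b * (indicator near (x, y) * (\<bar>w x - w y\<bar> powr p * sing s p x y)))"
      by (intro ennreal_leI pt)
    finally show "ennreal (\<bar>w x\<bar> powr p) * indicator (ball x r) y
      \<le> ennreal (2 powr (p - 1) * \<bar>w x\<bar>) * ennreal (indicator D y * \<bar>w y\<bar> powr (p - 1))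
       + ennreal (2 powr p * r powr b) * ennreal (indicator near (x, y) * (\<bar>w x - w y\<bar> powr p * sing s p x y))"
      by (simp add: ennreal_collect del: ennreal_plus)
  qed
  also have "\<dots> = ennreal (2 powr (p - 1) * \<bar>w x\<bar>) * (\<integral>\<^sup>+y. ennreal (indicator D y * \<bar>w y\<bar> powr (p - 1)) \<partial>lborel)
     + ennreal (2 powr p * r powr b) * V w x"
    unfolding V_def by (subst nn_integral_add) (auto simp: nn_integral_cmult)
  also have "\<dots> \<le> ennreal (2 powr (p - 1) * \<bar>w x\<bar>) * ennreal T' + ennreal (2 powr p * r powr b) * ennreal v"
    unfolding v using T' by (intro add_mono mult_left_mono) auto
  also have "\<dots> = ennreal (2 powr (p - 1) * \<bar>w x\<bar> * T' + 2 powr p * r powr b * v)"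
    using T' v by (simp add: ennreal_collect del: ennreal_plus)
  finally have avg: "\<omega> * r ^ DIM('a) * \<bar>w x\<bar> powr p \<le> 2 powr (p - 1) * \<bar>w x\<bar> * T' + 2 powr p * r powr b * v"
    using T' v by (subst (asm) ennreal_le_iff) auto
  \<comment> \<open>Dividing the averaged inequality by the volume \<omega> r^n of the ball gives
    |w(x)|^p \<le> t |w(x)| + v'.\<close>
  define t where "t = 2 powr (p - 1) * T' / (\<omega> * r ^ DIM('a))"
  define v' where "v' = 2 powr p * r powr (s * p) * v / \<omega>"
  have rb: "r powr b = r ^ DIM('a) * r powr (s * p)"
    using r by (simp add: b_def powr_add powr_realpow)
  have "\<bar>w x\<bar> powr p \<le> t * \<bar>w x\<bar> + v'"
  proof -
    have pos: "0 < \<omega> * r ^ DIM('a)" using \<omega> r by simp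
    have "(t * \<bar>w x\<bar> + v') * (\<omega> * r ^ DIM('a)) = 2 powr (p - 1) * \<bar>w x\<bar> * T' + 2 powr p * r powr b * v"
      using \<omega> r by (simp add: t_def v'_def rb field_simps)
    then have "\<bar>w x\<bar> powr p * (\<omega> * r ^ DIM('a)) \<le> (t * \<bar>w x\<bar> + v') * (\<omega> * r ^ DIM('a))"
      using avg by (simp add: mult_ac)
    then show ?thesis using pos by (simp only: mult_le_cancel_right_pos)
  qed
  then have "\<bar>w x\<bar> powr p \<le> (2 * t) powr (p / (p - 1)) + 2 * v'"
    using p T' v \<omega> r by (intro powr_le_of_le_linear) (auto simp: t_def v'_def)
  then have "q w x \<le> ((2 * t) powr (p / (p - 1)) + 2 * v') * \<psi> x powr (m - p)"
    unfolding q_def by (intro mult_right_mono) auto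
  also have "\<dots> = (2 * t) powr (p / (p - 1)) * \<psi> x powr (m - p) + 2 * v' * \<psi> x powr (m - p)"
    by (simp add: distrib_right)
  also have "2 * v' * \<psi> x powr (m - p) = 2 powr (p + 1) / \<omega> * \<theta> powr (s * p) * (\<psi> x powr m * v)"
  proof -
    have "r powr (s * p) = \<theta> powr (s * p) * \<psi> x powr p"
      using \<theta> x s by (simp add: r_def powr_mult powr_powr)
    moreover have "\<psi> x powr p * \<psi> x powr (m - p) = \<psi> x powr m"
      by (simp add: powr_add[symmetric])
    ultimately show ?thesis by (simp add: v'_def powr_add mult_ac)
  qed
  also have "(2 * t) powr (p / (p - 1)) * \<psi> x powr (m - p)
      \<le> (2 powr p * T' / (\<omega> * \<theta> ^ DIM('a))) powr (p / (p - 1))"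
  \<comment> \<open>\<open>t\<close> carries \<psi>^(-n/s), and raising it to p/(p-1) multiplies
    this exponent. The last summand in the definition of \<open>m\<close> was included so that
    \<psi>^(m-p) compensates the result.\<close>
  proof -
    define t0 where "t0 = 2 powr p * T' / (\<omega> * \<theta> ^ DIM('a))"
    have t0: "0 \<le> t0" using T' \<omega> \<theta> by (simp add: t0_def)
    have "r ^ DIM('a) = \<theta> ^ DIM('a) * \<psi> x powr (n / s)"
      using x by (simp add: r_def power_mult_distrib n_def powr_realpow[symmetric] powr_powr)
    then have "2 * t = t0 * \<psi> x powr (- (n / s))"
      using x \<theta> \<omega> by (simp add: t_def t0_def powr_minus powr_diff field_simps)
    then have "(2 * t) powr (p / (p - 1)) = t0 powr (p / (p - 1)) * \<psi> x powr (- (n / s) * (p / (p - 1)))"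
      using t0 by (simp add: powr_mult powr_powr)
    also have "- (n / s) * (p / (p - 1)) = - (n * (p / (p - 1)) / s)" by simp
    finally have "(2 * t) powr (p / (p - 1)) = t0 powr (p / (p - 1)) * \<psi> x powr (- (n * (p / (p - 1)) / s))" .
    then have "(2 * t) powr (p / (p - 1)) * \<psi> x powr (m - p)
        = t0 powr (p / (p - 1)) * (\<psi> x powr (- (n * (p / (p - 1)) / s)) * \<psi> x powr (m - p))"
      by simp
    also have "\<psi> x powr (- (n * (p / (p - 1)) / s)) * \<psi> x powr (m - p)
        = \<psi> x powr (m - p - n * (p / (p - 1)) / s)"
      unfolding powr_add[symmetric] by (rule arg_cong[where f = "\<lambda>r. \<psi> x powr r"]) linarith
    also have "t0 powr (p / (p - 1)) * \<psi> x powr (m - p - n * (p / (p - 1)) / s) \<le> t0 powr (p / (p - 1)) * 1"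
      using m_ge(2) by (intro mult_left_mono psi_powr_le_1) (auto simp: n_def)
    finally show ?thesis by (simp add: t0_def)
  qed
  finally show ?thesis by simp
qed

text \<open>The gain \<theta>^(sp) in front of the energy beats any given \<epsilon>; the price is a
  negative power of \<theta> inside \<beta>, which depends on w only through the tail bound
  T.\<close>

lemma interpolation:
  assumes "0 \<le> T" "0 < \<epsilon>"
  obtains \<beta> where "0 \<le> \<beta>"
    "\<And>w. tested \<Lambda> T w \<Longrightarrow> Y w \<le> ennreal \<epsilon> * X w + ennreal \<beta>"
proof -
  obtain R where R: "0 \<le> R" "\<And>x. x \<in> D \<Longrightarrow> norm x \<le> R"
    using bounded_D by (auto simp: bounded_pos intro: less_imp_le)
  define T' where "T' = (1 + R) powr b * T"
  have T': "0 \<le> T'" using assms by (simp add: T'_def)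
  define d where "d = enn2real (volume D)"
  have d: "volume D = ennreal d" "0 \<le> d"
    using nn_integral_indicator_bounded[OF _ bounded_D] by (auto simp: d_def less_top)
  define \<omega> where "\<omega> = measure lborel (ball (0::'a) 1)"
  have \<omega>: "emeasure lborel (ball (0::'a) 1) = ennreal \<omega>" "0 < \<omega>"
    using emeasure_bounded_finite[OF bounded_ball, of "0::'a" 1] content_ball_pos[of 1 "0::'a"]
    by (auto simp: \<omega>_def emeasure_eq_ennreal_measure less_top)
  define b1 where "b1 = 2 powr (p + 1) / \<omega>"
  have b1: "0 < b1" using \<omega> by (simp add: b1_def)
  \<comment> \<open>Solves b1 \<theta>^(sp) = \<epsilon>, capped at 1/4 so that the averaging balls
    contain near pairs only.\<close>
  define \<theta> where "\<theta> = min (1 / 4) ((\<epsilon> / b1) powr (1 / (s * p)))"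
  have \<theta>: "0 < \<theta>" "\<theta> \<le> 1 / 4" using assms b1 by (auto simp: \<theta>_def)
  have "\<theta> powr (s * p) \<le> ((\<epsilon> / b1) powr (1 / (s * p))) powr (s * p)"
    using \<theta> s p by (intro powr_mono2) (auto simp: \<theta>_def)
  then have \<theta>\<epsilon>: "b1 * \<theta> powr (s * p) \<le> \<epsilon>"
    using assms b1 s p by (simp add: powr_powr field_simps)
  define b0 where "b0 = (2 powr p * T' / (\<omega> * \<theta> ^ DIM('a))) powr (p / (p - 1))"
  show ?thesis
  proof (rule that[of "b0 * d"])
    show "0 \<le> b0 * d" using d by (simp add: b0_def)
    fix w assume "tested \<Lambda> T w"
    then obtain H where [measurable]: "w \<in> borel_measurable borel" "H \<in> borel_measurable borel"
      and wH: "AE x in lborel. \<bar>w x\<bar> \<le> H x"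
      and T: "tail_integral s p H \<le> ennreal T"
      unfolding tested_def by blast
    have wT: "(\<integral>\<^sup>+y. ennreal (indicator D y * \<bar>w y\<bar> powr (p - 1)) \<partial>lborel) \<le> ennreal T'"
    proof -
      have "(\<integral>\<^sup>+y. ennreal (indicator D y * \<bar>w y\<bar> powr (p - 1)) \<partial>lborel)
         \<le> ennreal ((1 + R) powr b) * tail_integral s p H"
      proof (intro nn_integral_le_cmult)
        show "AE y in lborel. indicator D y * \<bar>w y\<bar> powr (p - 1)
            \<le> (1 + R) powr b * (H y powr (p - 1) * tailw s p y)"
          using wH
        proof eventually_elim
          fix y assume h: "\<bar>w y\<bar> \<le> H y"
          show "indicator D y * \<bar>w y\<bar> powr (p - 1) \<le> (1 + R) powr b * (H y powr (p - 1) * tailw s p y)"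
          proof (cases "y \<in> D")
            case True
            have "1 \<le> (1 + R) powr b * tailw s p y"
              unfolding b_def using s p R(2)[OF True] by (intro tailw_lower) auto
            moreover have "\<bar>w y\<bar> powr (p - 1) \<le> H y powr (p - 1)" using h p by (intro powr_mono2) auto
            ultimately have "\<bar>w y\<bar> powr (p - 1) * 1 \<le> H y powr (p - 1) * ((1 + R) powr b * tailw s p y)"
              by (intro mult_mono) auto
            then show ?thesis using True by (simp add: mult_ac)
          qed simp
        qed
      qed auto
      also have "\<dots> \<le> ennreal ((1 + R) powr b) * ennreal T" using T by (intro mult_left_mono) auto
      also have "\<dots> = ennreal T'" using assms by (simp add: T'_def ennreal_mult)
      finally show ?thesis .
    qed
    have Vm [measurable]: "V w \<in> borel_measurable borel"
    proof -
      have "(\<lambda>z. ennreal (indicator near z * (\<bar>w (fst z) - w (snd z)\<bar> powr p * sing s p (fst z) (snd z))))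
          \<in> borel_measurable (lborel \<Otimes>\<^sub>M lborel)"
        by (simp add: lborel_prod)
      from lborel.borel_measurable_nn_integral_fst[OF this] show ?thesis
        by (simp add: V_def[abs_def])
    qed
    have pt: "ennreal (q w x) \<le> ennreal \<epsilon> * (ennreal (\<psi> x powr m) * V w x) + ennreal b0 * ennreal (indicator D x)" for x
    proof (cases "\<psi> x = 0")
      case True
      then show ?thesis by (simp add: q_def)
    next
      case False
      then have x: "0 < \<psi> x" "x \<in> D" using psi_nonneg[of x] psi_zero[of x] by auto
      show ?thesis
      proof (cases "V w x")
        \<comment> \<open>Since \<psi>(x) > 0 and \<epsilon> > 0, an infinite \<open>V w x\<close>
          makes the right side infinite.\<close>
        case top
        then show ?thesis using x assms by (simp add: ennreal_mult_top)
      next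
        case (real v)
        have "q w x \<le> b1 * \<theta> powr (s * p) * (\<psi> x powr m * v) + b0"
          unfolding b1_def b0_def
          using real by (intro interpolation_pointwise wT T' \<theta> x \<omega>) auto
        also have "b1 * \<theta> powr (s * p) * (\<psi> x powr m * v) \<le> \<epsilon> * (\<psi> x powr m * v)"
          using \<theta>\<epsilon> real by (intro mult_right_mono) auto
        finally have "ennreal (q w x) \<le> ennreal (\<epsilon> * (\<psi> x powr m * v) + b0)" by (simp add: ennreal_leI)
        then show ?thesis using real x assms
          by (simp add: ennreal_collect b0_def del: ennreal_plus)
      qed
    qed
    have "Y w \<le> (\<integral>\<^sup>+x. ennreal \<epsilon> * (ennreal (\<psi> x powr m) * V w x) + ennreal b0 * ennreal (indicator D x) \<partial>lborel)"
      unfolding Y_def by (intro nn_integral_mono pt)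
    also have "\<dots> = ennreal \<epsilon> * X w + ennreal b0 * ennreal d"
      by (subst nn_integral_add) (auto simp: nn_integral_cmult X_eq d)
    finally show "Y w \<le> ennreal \<epsilon> * X w + ennreal (b0 * d)"
      using d by (simp add: ennreal_mult b0_def)
  qed
qed

text \<open>The interpolation bound is inserted into the Caccioppoli estimate and X is absorbed on
  the left. Subtracting X requires it to be finite, hence the qualitative hypotheses, which leave no
  trace in \<open>B\<close>.\<close>

lemma uniform_energy_bound:
  assumes "0 \<le> T" "1 \<le> \<Lambda>"
  obtains B where "0 \<le> B"
    "\<And>w. \<lbrakk>tested \<Lambda> T w; X w < \<infinity>; Y w < \<infinity>\<rbrakk> \<Longrightarrow> X w \<le> ennreal B \<and> Y w \<le> ennreal B"
proof -
  obtain a where a: "0 \<le> a" and cac: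
    "\<And>w. tested \<Lambda> T w \<Longrightarrow> X w \<le> ennreal a * (Y w + 1)"
    using caccioppoli[OF assms] by blast
  \<comment> \<open>Gives \<open>a * \<epsilon> \<le> 1 / 2\<close> for the absorption and
    \<open>\<epsilon> \<le> 1\<close> for the bound on Y, also when a = 0.\<close>
  define \<epsilon> where "\<epsilon> = 1 / (2 * (a + 1))"
  have \<epsilon>: "0 < \<epsilon>" using a by (simp add: \<epsilon>_def)
  obtain \<beta> where \<beta>: "0 \<le> \<beta>" and int:
    "\<And>w. tested \<Lambda> T w \<Longrightarrow> Y w \<le> ennreal \<epsilon> * X w + ennreal \<beta>"
    using interpolation[OF assms(1) \<epsilon>] by blast
  show ?thesis
  proof (rule that[of "2 * a * (\<beta> + 1) + \<beta>"])
    show "0 \<le> 2 * a * (\<beta> + 1) + \<beta>" using a \<beta> by simp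
    fix w assume h: "tested \<Lambda> T w" "X w < \<infinity>" "Y w < \<infinity>"
    define x where "x = enn2real (X w)"
    define y where "y = enn2real (Y w)"
    have x: "X w = ennreal x" "0 \<le> x" using h(2) by (auto simp: x_def less_top)
    have y: "Y w = ennreal y" "0 \<le> y" using h(3) by (auto simp: y_def less_top)
    have "ennreal x \<le> ennreal a * (ennreal y + 1)" using cac[OF h(1)] x y by simp
    also have "\<dots> = ennreal (a * (y + 1))"
      using a y by (simp add: ennreal_collect ennreal_1[symmetric] del: ennreal_plus ennreal_1)
    finally have 1: "x \<le> a * (y + 1)" using a y by (subst (asm) ennreal_le_iff) auto
    have "ennreal y \<le> ennreal \<epsilon> * ennreal x + ennreal \<beta>" using int[OF h(1)] x y by simp
    also have "\<dots> = ennreal (\<epsilon> * x + \<beta>)"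
      using \<epsilon> \<beta> x by (simp add: ennreal_collect del: ennreal_plus)
    finally have 2: "y \<le> \<epsilon> * x + \<beta>" using \<epsilon> x \<beta> by (subst (asm) ennreal_le_iff) auto
    have ae: "a * \<epsilon> \<le> 1 / 2" "\<epsilon> \<le> 1" using a by (auto simp: \<epsilon>_def field_simps)
    have "x \<le> a * (\<epsilon> * x + \<beta> + 1)" using 1 mult_left_mono[OF 2 a] by (simp add: algebra_simps)
    also have "\<dots> = (a * \<epsilon>) * x + a * (\<beta> + 1)" by (simp add: algebra_simps)
    also have "\<dots> \<le> 1 / 2 * x + a * (\<beta> + 1)" using ae x by (intro add_right_mono mult_right_mono) auto
    finally have xb: "x \<le> 2 * a * (\<beta> + 1)" by simp
    have "\<epsilon> * x \<le> 1 * x" using ae x by (intro mult_right_mono) auto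
    then have "y \<le> 2 * a * (\<beta> + 1) + \<beta>" using 2 xb by linarith
    then show "X w \<le> ennreal (2 * a * (\<beta> + 1) + \<beta>) \<and> Y w \<le> ennreal (2 * a * (\<beta> + 1) + \<beta>)"
      using xb \<beta> by (auto simp: x y intro!: ennreal_leI)
  qed
qed

end

section \<open>Uniform Sobolev bounds\<close>

text \<open>The exponent p - 1 may be below 1, where the norm inequality fails; the quasi-triangle
  inequality with factor 2^(p-1) covers all p > 1.\<close>

lemma nn_integral_tail_add:
  fixes f g :: "'a::euclidean_space \<Rightarrow> real"
  assumes "1 < p" and [measurable]: "f \<in> borel_measurable borel" "g \<in> borel_measurable borel"
    and nn: "\<And>x. 0 \<le> f x" "\<And>x. 0 \<le> g x"
    and fin: "tail_integral s p f < \<infinity>"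
      "tail_integral s p g < \<infinity>"
  shows "(\<integral>\<^sup>+x. ennreal ((f x + g x) powr (p - 1) * tailw s p x) \<partial>lborel) < \<infinity>"
proof -
  have pt: "(f x + g x) powr (p - 1) * tailw s p x
      \<le> 2 powr (p - 1) * (f x powr (p - 1) * tailw s p x) + 2 powr (p - 1) * (g x powr (p - 1) * tailw s p x)" for x
    using mult_right_mono[OF powr_add_le[OF nn, of "p - 1" x x] tailw_nonneg[of s p x]] assms(1)
    by (simp add: algebra_simps)
  have "(\<integral>\<^sup>+x. ennreal ((f x + g x) powr (p - 1) * tailw s p x) \<partial>lborel)
     \<le> ennreal (2 powr (p - 1)) * tail_integral s p f + ennreal (2 powr (p - 1)) * tail_integral s p g"
    by (intro nn_integral_le_lincomb AE_I2 pt) auto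
  also have "\<dots> < \<infinity>" using fin by (simp add: ennreal_mult_less_top)
  finally show ?thesis .
qed

lemma nn_integral_tail_const:
  assumes "0 < s" "s < 1" "1 < p"
  shows "(\<integral>\<^sup>+(x::'a::euclidean_space). ennreal (c powr (p - 1) * tailw s p x) \<partial>lborel) < \<infinity>"
proof -
  have "(\<integral>\<^sup>+(x::'a). ennreal (c powr (p - 1) * tailw s p x) \<partial>lborel)
      \<le> ennreal (c powr (p - 1)) * (\<integral>\<^sup>+(x::'a). ennreal (tailw s p x) \<partial>lborel)"
    by (intro nn_integral_le_cmult) auto
  also have "\<dots> < \<infinity>"
    using nn_integral_tailw_finite[OF assms, where 'a='a] by (simp add: ennreal_mult_less_top)
  finally show ?thesis .
qed

lemma nn_integral_shift_powr:
  fixes u :: "'a::euclidean_space \<Rightarrow> real"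
  assumes [measurable]: "u \<in> borel_measurable borel" "D \<in> sets borel" and "0 \<le> p"
  shows "(\<integral>\<^sup>+x. ennreal (indicator D x * \<bar>M - u x\<bar> powr p) \<partial>lborel)
    \<le> ennreal (2 powr p * \<bar>M\<bar> powr p) * volume D
     + ennreal (2 powr p) * lp_on p D u"
proof (intro nn_integral_le_lincomb AE_I2)
  fix x
  have "indicator D x * \<bar>M - u x\<bar> powr p \<le> indicator D x * (2 powr p * (\<bar>M\<bar> powr p + \<bar>u x\<bar> powr p))"
    using assms by (intro mult_left_mono powr_abs_diff_le) auto
  then show "indicator D x * \<bar>M - u x\<bar> powr p
      \<le> 2 powr p * \<bar>M\<bar> powr p * indicator D x + 2 powr p * (indicator D x * \<bar>u x\<bar> powr p)"
    by (simp add: algebra_simps)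
qed auto

section \<open>Removing the weights where the cutoff is constant\<close>

lemma (in cutoff_weight) nn_integral_le_Y:
  assumes [measurable]: "w \<in> borel_measurable borel" and D0 [measurable]: "D0 \<in> sets borel"
    and c: "0 < c" "\<And>x. x \<in> D0 \<Longrightarrow> \<psi> x = c"
  shows "lp_on p D0 w \<le> ennreal (c powr (p - m)) * Y w"
  unfolding Y_def
proof (intro nn_integral_le_cmult AE_I2 q_nonneg)
  show "indicator D0 x * \<bar>w x\<bar> powr p \<le> c powr (p - m) * q w x" for x
    using c q_nonneg[of w x] by (cases "x \<in> D0") (auto simp: q_def powr_diff)
qed auto

text \<open>Near pairs in \<open>D0\<close> carry the constant weight c^m and are counted by X. All
  other pairs are at least c/2 apart, so the kernel is bounded there and the p-th powers of the two
  values suffice.\<close>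

lemma (in cutoff_weight) nn_integral_le_X:
  assumes [measurable]: "w \<in> borel_measurable borel" and D0: "open D0"
    and c: "0 < c" "\<And>x. x \<in> D0 \<Longrightarrow> \<psi> x = c"
  shows "gagliardo_on s p D0 w
    \<le> ennreal (c powr (- m)) * X w + ennreal (2 * 2 powr p * (2 / c) powr b) *
      (lp_on p D0 w * volume D0)"
proof -
  have [measurable]: "D0 \<in> sets borel" "D0 \<times> D0 \<in> sets (borel :: ('a \<times> 'a) measure)"
    using D0 by (auto intro: borel_open open_Times)
  define W where "W x = indicator D0 x * \<bar>w x\<bar> powr p" for x
  define N where "N z = indicator near z * (\<psi> (fst z) powr m *
     (\<bar>w (fst z) - w (snd z)\<bar> powr p * sing s p (fst z) (snd z)))" for z
  have [measurable]: "W \<in> borel_measurable borel" "N \<in> borel_measurable borel"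
    unfolding W_def[abs_def] N_def[abs_def] by measurable
  have nn: "0 \<le> W x" "0 \<le> N z" for x z by (auto simp: W_def N_def)
  have pt: "indicator (D0 \<times> D0) z * (\<bar>w (fst z) - w (snd z)\<bar> powr p * sing s p (fst z) (snd z))
     \<le> c powr (- m) * N z + 2 powr p * (2 / c) powr b * (W (fst z) * indicator D0 (snd z))
       + 2 powr p * (2 / c) powr b * (indicator D0 (fst z) * W (snd z))" for z
  proof -
    obtain x y where z: "z = (x, y)" by (cases z)
    show ?thesis
    proof (cases "z \<in> D0 \<times> D0")
      case False
      then show ?thesis using nn by simp
    next
      case True
      then have D: "x \<in> D0" "y \<in> D0" by (auto simp: z)
      show ?thesis
      proof (cases "z \<in> near")
        case True
        then have "c powr (- m) * N z = \<bar>w x - w y\<bar> powr p * sing s p x y"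
          using D c by (simp add: N_def z powr_minus)
        moreover have "0 \<le> 2 powr p * (2 / c) powr b * (W x * indicator D0 y)"
          "0 \<le> 2 powr p * (2 / c) powr b * (indicator D0 x * W y)"
          using nn by auto
        ultimately show ?thesis using D unfolding z by simp
      next
        case False
        then have "c / 2 \<le> norm (x - y)" using D c by (simp add: near_def z not_less)
        then have "(c / 2) powr b \<le> norm (x - y) powr b" using c b_pos by (intro powr_mono2) auto
        moreover have "0 < (c / 2) powr b" using c by simp
        ultimately have "1 / norm (x - y) powr b \<le> 1 / (c / 2) powr b"
          by (intro divide_left_mono mult_pos_pos) linarith+
        then have sg: "sing s p x y \<le> (2 / c) powr b"
          using c by (simp add: sing_def b_def[symmetric] powr_divide)
        have "\<bar>w x - w y\<bar> powr p * sing s p x y \<le> 2 powr p * (\<bar>w x\<bar> powr p + \<bar>w y\<bar> powr p) * (2 / c) powr b"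
          using sg p by (intro mult_mono powr_abs_diff_le) auto
        moreover have "0 \<le> c powr (- m) * N z" using nn by simp
        ultimately show ?thesis using D by (simp add: W_def z algebra_simps)
      qed
    qed
  qed
  have "gagliardo_on s p D0 w
     \<le> (\<integral>\<^sup>+z. ennreal (c powr (- m)) * ennreal (N z)
       + ennreal (2 powr p * (2 / c) powr b) * (ennreal (W (fst z)) * ennreal (indicator D0 (snd z)))
       + ennreal (2 powr p * (2 / c) powr b) * (ennreal (indicator D0 (fst z)) * ennreal (W (snd z))) \<partial>lborel)"
    using pt nn by (intro nn_integral_mono)
      (simp add: ennreal_collect ennreal_leI del: ennreal_plus)
  also have "\<dots> = ennreal (c powr (- m)) * X w
     + ennreal (2 powr p * (2 / c) powr b) * ((\<integral>\<^sup>+x. ennreal (W x) \<partial>lborel) * volume D0)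
     + ennreal (2 powr p * (2 / c) powr b) * (volume D0 * (\<integral>\<^sup>+x. ennreal (W x) \<partial>lborel))"
    by (simp add: nn_integral_add nn_integral_cmult X_def N_def[symmetric]
        nn_integral_lborel_times[of "\<lambda>x. ennreal (W x)" "\<lambda>x. ennreal (indicator D0 x)"]
        nn_integral_lborel_times[of "\<lambda>x. ennreal (indicator D0 x)" "\<lambda>x. ennreal (W x)"])
  also have "\<dots> = ennreal (c powr (- m)) * X w + ennreal (2 * 2 powr p * (2 / c) powr b) *
      ((\<integral>\<^sup>+x. ennreal (W x) \<partial>lborel) * volume D0)"
  proof -
    have "ennreal (2 * 2 powr p * (2 / c) powr b)
        = ennreal (2 powr p * (2 / c) powr b) + ennreal (2 powr p * (2 / c) powr b)"
      by (simp add: ennreal_plus[symmetric] del: ennreal_plus)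
    then show ?thesis by (simp add: distrib_right distrib_left mult.commute add.assoc)
  qed
  finally show ?thesis by (simp add: W_def)
qed

definition dominated_supersolution ::
    "real \<Rightarrow> real \<Rightarrow> ('a::euclidean_space \<Rightarrow> 'a \<Rightarrow> real) \<Rightarrow> 'a set \<Rightarrow> ('a \<Rightarrow> real) \<Rightarrow> 'a set \<Rightarrow> real \<Rightarrow> ('a \<Rightarrow> real) \<Rightarrow> bool"
  where
  "dominated_supersolution s p K \<Omega> G D M u \<longleftrightarrow>
     weak_supersolution s p K \<Omega> u \<and> u \<in> borel_measurable borel \<and>
     (AE x in lborel. \<bar>u x\<bar> \<le> G x) \<and> (AE x in lborel. x \<in> D \<longrightarrow> u x \<le> M)"

text \<open>The order of the quantifiers is essential: D is fixed from \<open>D0\<close> and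
  \<Omega> alone, then the upper bound M is read off on D, and B depends on M but on no individual
  u.\<close>

lemma supersolution_uniform_sobolev:
  fixes G :: "'a::euclidean_space \<Rightarrow> real"
  assumes p: "1 < p" "0 < s" "s < 1" and K: "admissible_kernel s p \<Lambda> K" "1 \<le> \<Lambda>"
    and \<Omega>: "open \<Omega>" and D0: "open D0" "compactly_inside D0 \<Omega>"
    and G [measurable]: "G \<in> borel_measurable borel" and G0: "\<And>x. 0 \<le> G x"
    and Gi: "tail_integral s p G < \<infinity>"
  shows "\<exists>D. open D \<and> compactly_inside D \<Omega> \<and> (\<forall>M. \<exists>B::real. \<forall>u.
    dominated_supersolution s p K \<Omega> G D M u \<longrightarrow>
    lp_on p D0 u \<le> ennreal B \<and>
    gagliardo_on s p D0 u \<le> ennreal B)"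
proof (cases "D0 = {}")
  case True
  \<comment> \<open>Treated separately because \<open>infdist\<close> to the empty set is 0, so the
    cutoff below would not vanish outside D.\<close>
  then show ?thesis
    by (intro exI[of _ "{}"]) (auto simp: compactly_inside_def)
next
  case ne: False
  define S where "S = closure D0"
  have S: "compact S" "S \<subseteq> \<Omega>" "S \<noteq> {}" "D0 \<subseteq> S"
    using D0 ne closure_subset[of D0] by (auto simp: compactly_inside_def S_def)
  obtain R where R: "0 < R" "R \<le> 1" "nbhd S R \<subseteq> \<Omega>"
    using nbhd_subset_open[OF S(1) \<Omega> S(2)] by blast
  define D where "D = nbhd S (R / 2)"
  define c where "c = R / 4"
  \<comment> \<open>A truncated distance is 1-Lipschitz by itself. It equals \<open>c\<close> on the
    closure of \<open>D0\<close> and vanishes at distance R/4, hence outside the R/2-neighbourhood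
    D.\<close>
  define \<psi> where "\<psi> x = max 0 (c - infdist x S)" for x
  have c: "0 < c" "c \<le> 1" using R by (auto simp: c_def)
  have DO: "open D" unfolding D_def by (rule open_nbhd)
  have DI: "compactly_inside D \<Omega>"
    unfolding D_def using S R by (intro compactly_inside_nbhd[of S _ R]) auto
  have DB: "bounded D" unfolding D_def using S by (intro bounded_nbhd compact_imp_bounded)
  interpret cw: cutoff_weight s p \<psi> D
  proof
    show "0 \<le> \<psi> x" "\<psi> x \<le> 1" for x using c infdist_nonneg[of x S] by (auto simp: \<psi>_def)
    show "\<bar>\<psi> x - \<psi> y\<bar> \<le> norm (x - y)" for x y
      using infdist_triangle_abs[of x S y] by (auto simp: \<psi>_def dist_norm max_def)
    show "\<psi> x = 0" if "x \<notin> D" for x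
    proof -
      obtain y where "y \<in> S" "infdist x S = dist x y"
        using infdist_attains_inf[OF compact_imp_closed[OF S(1)] S(3)] by blast
      then have "R / 2 \<le> infdist x S" using that by (auto simp: D_def nbhd_def dist_commute not_less)
      then show ?thesis using R by (simp add: \<psi>_def c_def)
    qed
  qed (use p DO DB in auto)
  have \<psi>c: "\<psi> x = c" if "x \<in> D0" for x
    using that S c by (auto simp: \<psi>_def)
  have [measurable]: "D \<in> sets borel" "D0 \<in> sets borel" using DO D0 by auto
  have [measurable]: "D \<times> D \<in> sets (borel :: ('a \<times> 'a) measure)"
    using DO by (intro borel_open open_Times)
  have finD: "volume D < \<infinity>"
    using nn_integral_indicator_bounded[OF _ DB] by simp
  define d where "d = enn2real (volume D0)"
  have "bounded D0" using S by (meson bounded_subset compact_imp_bounded)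
  then have d: "volume D0 = ennreal d" "0 \<le> d"
    using nn_integral_indicator_bounded[of D0] by (auto simp: d_def less_top)
  have "\<exists>B::real. \<forall>u.
    dominated_supersolution s p K \<Omega> G D M u \<longrightarrow>
    lp_on p D0 u \<le> ennreal B \<and>
    gagliardo_on s p D0 u \<le> ennreal B" for M
  proof -
    \<comment> \<open>Dominates |M - u| for every admissible u, so that T depends only on M and
      G.\<close>
    define H where "H x = \<bar>M\<bar> + G x" for x
    have [measurable]: "H \<in> borel_measurable borel" unfolding H_def[abs_def] by measurable
    define T where "T = enn2real (tail_integral s p H)"
    have T: "tail_integral s p H \<le> ennreal T" "0 \<le> T"
      using nn_integral_tail_add[OF p(1), of "\<lambda>_. \<bar>M\<bar>" G s]
        nn_integral_tail_const[OF p(2,3,1), where 'a='a and c = "\<bar>M\<bar>"] Gi G0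
      by (auto simp: T_def H_def less_top)
    obtain B0 where B0: "0 \<le> B0" and bd:
      "\<And>w. \<lbrakk>cw.tested \<Lambda> T w; cw.X w < \<infinity>; cw.Y w < \<infinity>\<rbrakk> \<Longrightarrow> cw.X w \<le> ennreal B0 \<and> cw.Y w \<le> ennreal B0"
      using cw.uniform_energy_bound[OF T(2) K(2)] by blast
    define B1 where "B1 = c powr (p - cw.m) * B0"
    define B2 where "B2 = 2 powr p * \<bar>M\<bar> powr p * d + 2 powr p * B1"
    define B3 where "B3 = c powr (- cw.m) * B0 + 2 * 2 powr p * (2 / c) powr cw.b * (B1 * d)"
    have Bnn: "0 \<le> B1" "0 \<le> B2" "0 \<le> B3" using B0 d by (auto simp: B1_def B2_def B3_def)
    show ?thesis
    proof (intro exI[of _ "B2 + B3"] allI impI)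
      fix u
      assume "dominated_supersolution s p K \<Omega> G D M u"
      note h = this[unfolded dominated_supersolution_def]
      from h have um [measurable]: "u \<in> borel_measurable borel" and uG: "AE x in lborel. \<bar>u x\<bar> \<le> G x" by auto
      define w where "w x = M - u x" for x
      \<comment> \<open>Off D the function \<open>w\<close> may be negative, and on D it is
        nonnegative only almost everywhere; the positive part makes \<eta> a nonnegative function
        throughout.\<close>
      define \<eta> where "\<eta> x = max (w x) 0 * \<psi> x powr cw.m" for x
      have wm [measurable]: "w \<in> borel_measurable borel" unfolding w_def[abs_def] by measurable
      have \<eta>m [measurable]: "\<eta> \<in> borel_measurable borel" unfolding \<eta>_def[abs_def] by measurable
      have wd: "w x - w y = - (u x - u y)" for x y by (simp add: w_def)
      have uS: "u \<in> sobolev s p D"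
        using h DO DI by (auto simp: weak_supersolution_def sobolev_loc_def)
      have w1: "lp_on p D w < \<infinity>"
      proof -
        have "ennreal (2 powr p * \<bar>M\<bar> powr p) * volume D
          + ennreal (2 powr p) * lp_on p D u < \<infinity>"
          using finD sobolev_lp[OF uS] by (simp add: ennreal_mult_less_top)
        then show ?thesis
          unfolding w_def using nn_integral_shift_powr[OF um \<open>D \<in> sets borel\<close>, of p M] p
          by (simp add: le_less_trans)
      qed
      have w2: "gagliardo_on s p D w < \<infinity>"
        unfolding wd abs_minus_cancel by (rule sobolev_seminorm[OF uS])
      have \<xi>lip: "\<bar>\<psi> x powr cw.m - \<psi> y powr cw.m\<bar> \<le> cw.m * min 1 (norm (x - y))" for x y
      proof -
        have "\<bar>\<psi> x powr cw.m - \<psi> y powr cw.m\<bar> \<le> cw.m * \<bar>\<psi> x - \<psi> y\<bar>"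
          using cw.m_ge(3) cw.psi_nonneg cw.psi_le by (intro powr_diff_le_unit) auto
        also have "\<dots> \<le> cw.m * min 1 (norm (x - y))"
          using cw.psi_lip[of x y] cw.psi_nonneg[of x] cw.psi_nonneg[of y] cw.psi_le[of x] cw.psi_le[of y] cw.m_ge(3)
          by (intro mult_left_mono) auto
        finally show ?thesis .
      qed
      have \<xi>1: "\<psi> x powr cw.m \<le> 1" for x
        using cw.m_ge(3) by (intro cw.psi_powr_le_1) simp
      have gag: "gagliardo s p \<eta> < \<infinity>" and lp: "(\<integral>\<^sup>+x. ennreal (\<eta> x powr p) \<partial>lborel) < \<infinity>"
        unfolding \<eta>_def
        using cw.m_ge(3) cw.psi_zero
        by (intro gagliardo_cutoff[OF p(2,3,1) wm _ DO _ _ \<xi>1 \<xi>lip _ w1 w2]; simp)+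
      have \<eta>D: "{x. \<eta> x \<noteq> 0} \<subseteq> closure D"
        using cw.psi_zero closure_subset[of D] by (auto simp: \<eta>_def)
      have \<eta>0: "0 \<le> \<eta> x" for x by (simp add: \<eta>_def)
      have Dc: "compact (closure D)" "closure D \<subseteq> \<Omega>" using DI by (auto simp: compactly_inside_def)
      note test = weak_supersolution_test[OF p K \<Omega> conjunct1[OF h] um G uG Gi Dc \<eta>m \<eta>0 \<eta>D lp gag]
      \<comment> \<open>Passing from u to M - u flips the sign of the nonlinearity while the test
        function is kept, so the supersolution inequality for u becomes energy \<le> 0 for
        \<open>w\<close>.\<close>
      have en: "energy_integrand p K w \<eta> = (\<lambda>z. - energy_integrand p K u \<eta> z)"
        by (rule ext) (simp add: energy_integrand_eq wd signed_pow_minus del: minus_diff_eq)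
      have e1: "integrable lebesgue (energy_integrand p K w \<eta>)"
        and e2: "integral\<^sup>L lebesgue (energy_integrand p K w \<eta>) \<le> 0"
        unfolding en using test by auto
      have wH: "AE x in lborel. \<bar>w x\<bar> \<le> H x"
        using uG by eventually_elim (auto simp: w_def H_def)
      have w0: "AE x in lborel. x \<in> D \<longrightarrow> 0 \<le> w x"
        using h by (auto simp: w_def)
      \<comment> \<open>Finiteness before absorption: the weights are at most 1 and supported over
        D, where \<open>w\<close> inherits local Sobolev regularity from u.\<close>
      have Xf: "cw.X w < \<infinity>"
      proof -
        have "cw.X w \<le> gagliardo_on s p D w"
          unfolding cw.X_def
        proof (intro nn_integral_mono ennreal_leI)
          fix z
          show "indicator cw.near z * (\<psi> (fst z) powr cw.m * (\<bar>w (fst z) - w (snd z)\<bar> powr p * sing s p (fst z) (snd z)))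
            \<le> indicator (D \<times> D) z * (\<bar>w (fst z) - w (snd z)\<bar> powr p * sing s p (fst z) (snd z))"
            using cw.near_pos(3,4)[of z] \<xi>1[of "fst z"]
            by (cases "z \<in> cw.near") (auto simp: mem_Times_iff intro!: mult_left_le_one_le)
        qed
        then show ?thesis using w2 by (rule le_less_trans)
      qed
      have Yf: "cw.Y w < \<infinity>"
      proof -
        have "cw.Y w \<le> lp_on p D w"
          unfolding cw.Y_def
        proof (intro nn_integral_mono ennreal_leI)
          fix x
          have "\<psi> x powr (cw.m - p) \<le> 1"
            using cw.m_ge(1) cw.b_pos p by (intro cw.psi_powr_le_1) (smt (verit) divide_nonneg_pos)
          then show "cw.q w x \<le> indicator D x * \<bar>w x\<bar> powr p"
            using cw.psi_zero[of x] by (cases "x \<in> D") (auto simp: cw.q_def intro!: mult_right_le_one_le)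
        qed
        then show ?thesis using w1 by (rule le_less_trans)
      qed
      have XY: "cw.X w \<le> ennreal B0" "cw.Y w \<le> ennreal B0"
      proof -
        have "cw.tested \<Lambda> T w"
          unfolding cw.tested_def using K(1) wm \<open>H \<in> borel_measurable borel\<close> wH w0 T(1)
            e1[unfolded \<eta>_def] e2[unfolded \<eta>_def] by blast
        from bd[OF this Xf Yf] show "cw.X w \<le> ennreal B0" "cw.Y w \<le> ennreal B0" by auto
      qed
      have L1: "lp_on p D0 w \<le> ennreal B1"
      proof -
        have "lp_on p D0 w \<le> ennreal (c powr (p - cw.m)) * cw.Y w"
          using c \<psi>c by (intro cw.nn_integral_le_Y) auto
        also have "\<dots> \<le> ennreal (c powr (p - cw.m)) * ennreal B0" using XY by (intro mult_left_mono) auto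
        finally show ?thesis by (simp add: B1_def ennreal_mult[symmetric] B0)
      qed
      have "lp_on p D0 u
          \<le> ennreal (2 powr p * \<bar>M\<bar> powr p) * ennreal d
           + ennreal (2 powr p) * lp_on p D0 w"
        using nn_integral_shift_powr[OF wm \<open>D0 \<in> sets borel\<close>, of p M] p d by (simp add: w_def)
      also have "\<dots> \<le> ennreal (2 powr p * \<bar>M\<bar> powr p) * ennreal d + ennreal (2 powr p) * ennreal B1"
        using L1 by (intro add_left_mono mult_left_mono) auto
      also have "\<dots> = ennreal B2"
        using d Bnn by (simp add: B2_def ennreal_collect del: ennreal_plus)
      also have "\<dots> \<le> ennreal (B2 + B3)" using Bnn by (intro ennreal_leI) simp
      finally have fin1: "lp_on p D0 u \<le> ennreal (B2 + B3)" .
      have "gagliardo_on s p D0 u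
         = gagliardo_on s p D0 w"
        unfolding wd abs_minus_cancel ..
      also have "\<dots> \<le> ennreal (c powr (- cw.m)) * cw.X w + ennreal (2 * 2 powr p * (2 / c) powr cw.b) *
      (lp_on p D0 w * volume D0)"
        using c \<psi>c D0 by (intro cw.nn_integral_le_X) auto
      also have "\<dots> \<le> ennreal (c powr (- cw.m)) * ennreal B0 + ennreal (2 * 2 powr p * (2 / c) powr cw.b) *
          (ennreal B1 * ennreal d)"
        unfolding d(1) using XY L1 by (intro add_mono mult_left_mono mult_right_mono) auto
      also have "\<dots> = ennreal B3"
        using d Bnn B0 by (simp add: B3_def ennreal_collect del: ennreal_plus)
      also have "\<dots> \<le> ennreal (B2 + B3)" using Bnn by (intro ennreal_leI) simp
      finally show "lp_on p D0 u \<le> ennreal (B2 + B3) \<and>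
        gagliardo_on s p D0 u \<le> ennreal (B2 + B3)"
        using fin1 by blast
    qed
  qed
  then show ?thesis using DO DI by blast
qed

section \<open>Almost everywhere modifications\<close>

lemma borel_version:
  fixes f :: "'a::euclidean_space \<Rightarrow> real"
  assumes "f \<in> borel_measurable lebesgue"
  obtains f' where "f' \<in> borel_measurable borel" "AE x in lborel. f x = f' x"
proof -
  obtain f' where "f' \<in> borel_measurable lborel" "AE x in lborel. f x = f' x"
    using completion_ex_borel_measurable_real[OF assms] by blast
  then show ?thesis by (intro that[of f']) auto
qed

lemma sobolev_cong_AE:
  fixes u v :: "'a::euclidean_space \<Rightarrow> real"
  assumes eq: "AE x in lborel. u x = v x" and v: "v \<in> borel_measurable lebesgue" and u: "u \<in> sobolev s p D"
  shows "v \<in> sobolev s p D"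
proof -
  have "lp_on p D v
      = lp_on p D u"
    by (rule nn_integral_cong_AE, use eq in eventually_elim) simp
  then have 1: "lp_on p D v < \<infinity>"
    using sobolev_lp[OF u] by simp
  have "gagliardo_on s p D v
      = gagliardo_on s p D u"
    by (rule nn_integral_cong_AE, use AE_lborel_fst[OF eq] AE_lborel_snd[OF eq] in eventually_elim) simp
  then have 2: "gagliardo_on s p D v < \<infinity>"
    using sobolev_seminorm[OF u] by simp
  show ?thesis
    using 1 2 measurable_restrict_space1[OF v, of D]
    by (simp add: sobolev_def nn_set_integral_lebesgue_eq sing_def)
qed

lemma tail_space_mono_AE:
  fixes f h :: "'a::euclidean_space \<Rightarrow> real"
  assumes "1 < p" and f: "f \<in> borel_measurable lebesgue" and h: "h \<in> tail_space s p"
    and le: "AE x in lborel. \<bar>f x\<bar> \<le> \<bar>h x\<bar>"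
  shows "f \<in> tail_space s p"
proof -
  have le': "AE x in lborel. \<bar>f x\<bar> powr (p - 1) \<le> \<bar>h x\<bar> powr (p - 1)"
    using le by eventually_elim (use assms(1) in \<open>auto intro: powr_mono2\<close>)
  have "(\<integral>\<^sup>+x\<in>D. ennreal (\<bar>f x\<bar> powr (p - 1)) \<partial>lebesgue) \<le> (\<integral>\<^sup>+x\<in>D. ennreal (\<bar>h x\<bar> powr (p - 1)) \<partial>lebesgue)" for D
    unfolding nn_integral_completion
    by (rule nn_integral_mono_AE, use le' in eventually_elim) (auto simp: indicator_def intro: ennreal_leI)
  moreover have "(\<integral>\<^sup>+x. ennreal (\<bar>f x\<bar> powr (p - 1) * (1 + norm x) powr (- real DIM('a) - s * p)) \<partial>lebesgue)
      \<le> (\<integral>\<^sup>+x. ennreal (\<bar>h x\<bar> powr (p - 1) * (1 + norm x) powr (- real DIM('a) - s * p)) \<partial>lebesgue)"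
    unfolding nn_integral_completion
    by (rule nn_integral_mono_AE, use le' in eventually_elim) (auto intro!: ennreal_leI mult_right_mono)
  ultimately show ?thesis
    using f h unfolding tail_space_def by (auto intro: le_less_trans)
qed

lemma energy_cong_AE:
  assumes eq: "AE x in lborel. u x = v x"
  shows "AE z in lebesgue. energy_integrand p K u \<eta> z = energy_integrand p K v \<eta> z"
  unfolding AE_completion_iff using AE_lborel_fst[OF eq] AE_lborel_snd[OF eq]
  by eventually_elim (simp add: energy_integrand_eq)

text \<open>Justifies working with Borel representatives: they make expressions in two variables
  measurable on the product, and every clause of the notion only sees the almost everywhere
  class.\<close>

lemma weak_supersolution_cong_AE:
  fixes u v :: "'a::euclidean_space \<Rightarrow> real"
  assumes p: "1 < p" and eq: "AE x in lborel. u x = v x" and u: "weak_supersolution s p K \<Omega> u"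
  shows "weak_supersolution s p K \<Omega> v"
proof -
  have v: "v \<in> borel_measurable lebesgue"
    using u eq by (intro borel_measurable_AE[of u v]) (auto simp: weak_supersolution_def AE_completion_iff)
  have "v \<in> sobolev_loc s p \<Omega>"
    using u sobolev_cong_AE[OF eq v] by (auto simp: weak_supersolution_def sobolev_loc_def)
  moreover have "(\<lambda>x. max (- v x) 0) \<in> tail_space s p"
  proof (rule tail_space_mono_AE[OF p])
    show "(\<lambda>x. max (- v x) 0) \<in> borel_measurable lebesgue" using v by measurable
    show "(\<lambda>x. max (- u x) 0) \<in> tail_space s p" using u by (simp add: weak_supersolution_def)
    show "AE x in lborel. \<bar>max (- v x) 0\<bar> \<le> \<bar>max (- u x) 0\<bar>" using eq by eventually_elim simp
  qed
  moreover have "integrable lebesgue (energy_integrand p K v \<eta>) \<and> 0 \<le> integral\<^sup>L lebesgue (energy_integrand p K v \<eta>)"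
    if "\<eta> \<in> test_functions \<Omega>" "\<forall>x. 0 \<le> \<eta> x" for \<eta>
  proof -
    have i: "integrable lebesgue (energy_integrand p K u \<eta>)" "0 \<le> integral\<^sup>L lebesgue (energy_integrand p K u \<eta>)"
      using u that by (auto simp: weak_supersolution_def)
    note ae = energy_cong_AE[OF eq, of p K \<eta>]
    have m: "energy_integrand p K v \<eta> \<in> borel_measurable lebesgue"
      using i ae by (intro borel_measurable_AE[OF _ ae]) auto
    show ?thesis
      using i integrable_cong_AE[OF _ m ae] integral_cong_AE[OF _ m ae] by auto
  qed
  ultimately show ?thesis using v by (auto simp: weak_supersolution_def)
qed

section \<open>Convergence of supersolutions\<close>

text \<open>The seminorm is finite by \<open>gagliardo_cutoff\<close> with w = 1. A smooth function
  with bounded support is Lipschitz for short distances and bounded for long ones, which combine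
  into the required modulus L min(1, |x-y|).\<close>

lemma test_function_properties:
  fixes \<eta> :: "'a::euclidean_space \<Rightarrow> real"
  assumes p: "1 < p" "0 < s" "s < 1" and \<eta>: "\<eta> \<in> test_functions \<Omega>" "\<And>x. 0 \<le> \<eta> x"
  shows "continuous_on UNIV \<eta>" "\<exists>B\<ge>0. \<forall>x. \<eta> x \<le> B" "gagliardo s p \<eta> < \<infinity>"
proof -
  have ck: "Ck k \<eta>" for k using \<eta> by (simp add: test_functions_def)
  show cont: "continuous_on UNIV \<eta>" using ck[of 0] by simp
  have "compact (closure {x. \<eta> x \<noteq> 0})"
    using \<eta> by (simp add: test_functions_def compactly_inside_def)
  then have "bounded {x. \<eta> x \<noteq> 0}" by (rule bounded_subset[OF compact_imp_bounded closure_subset])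
  then obtain R where R: "0 < R" "{x. \<eta> x \<noteq> 0} \<subseteq> ball 0 R" using bounded_subset_ballD by blast
  have \<eta>R: "\<eta> x = 0" if "R < norm x" for x
  proof (rule ccontr)
    assume "\<eta> x \<noteq> 0"
    then have "x \<in> ball 0 R" using R by blast
    then show False using that by simp
  qed
  obtain B where B: "0 \<le> B" "\<And>x. \<bar>\<eta> x\<bar> \<le> B" using Ck_0_bounded[of \<eta> R] cont \<eta>R by auto
  then show "\<exists>B\<ge>0. \<forall>x. \<eta> x \<le> B" by (intro exI[of _ B]) (auto intro: order_trans[OF abs_ge_self])
  obtain L where L: "0 \<le> L" "\<And>x h. \<bar>frechet_derivative \<eta> (at x) h\<bar> \<le> L * norm h"
    "\<And>x y. \<bar>\<eta> x - \<eta> y\<bar> \<le> L * norm (x - y)"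
    using smooth_lipschitz[OF ck \<eta>R] by blast
  have lip: "\<bar>\<eta> x - \<eta> y\<bar> \<le> max L (2 * B) * min 1 (norm (x - y))" for x y
  proof (cases "norm (x - y) \<le> 1")
    case True
    have "L * norm (x - y) \<le> max L (2 * B) * norm (x - y)" by (intro mult_right_mono) auto
    then show ?thesis using L(3)[of x y] True by simp
  next
    case False
    then show ?thesis using B(2)[of x] B(2)[of y] by simp
  qed
  have m: "\<eta> \<in> borel_measurable borel" using cont by (rule borel_measurable_continuous_onI)
  have "gagliardo s p (\<lambda>x. max ((\<lambda>_. 1) x) 0 * \<eta> x) < \<infinity>"
  proof (rule gagliardo_cutoff[where D = "ball 0 R" and b = B and L = "max L (2 * B)"])
    show "\<eta> x \<le> B" for x using B(2)[of x] by simp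
    show "\<eta> x = 0" if "x \<notin> ball 0 R" for x using R that by blast
    show "(\<integral>\<^sup>+x. ennreal (indicator (ball (0::'a) R) x * \<bar>1\<bar> powr p) \<partial>lborel) < \<infinity>"
      using nn_integral_indicator_bounded[of "ball (0::'a) R"] by simp
  qed (use p \<eta> lip L m in auto)
  then show "gagliardo s p \<eta> < \<infinity>" by simp
qed

text \<open>The mirror image of the mollification argument: in \<open>energy_limit\<close> the test
  function is now the constant sequence and the supersolutions vary. Their uniform seminorm bound on
  \<open>D2\<close> supplies \<open>P\<close>, and the energy of \<eta> supplies
  \<open>Q\<close>.\<close>

lemma weak_supersolution_limit_borel:
  fixes u :: "nat \<Rightarrow> 'a::euclidean_space \<Rightarrow> real"
  assumes p: "1 < p" "0 < s" "s < 1" and K: "admissible_kernel s p \<Lambda> K" "1 \<le> \<Lambda>" and \<Omega>: "open \<Omega>"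
    and um [measurable]: "\<And>j. u j \<in> borel_measurable borel" and vm [measurable]: "v \<in> borel_measurable borel"
    and Gm [measurable]: "G \<in> borel_measurable borel" and G0: "\<And>x. 0 \<le> G x"
    and Gi: "tail_integral s p G < \<infinity>"
    and u: "\<And>j. weak_supersolution s p K \<Omega> (u j)" and uG: "\<And>j. AE x in lborel. \<bar>u j x\<bar> \<le> G x"
    and bd: "unif_loc_ess_bdd_above \<Omega> u" and lim: "AE x in lborel. (\<lambda>j. u j x) \<longlonglongrightarrow> v x"
    and tail: "(\<lambda>x. max (- v x) 0) \<in> tail_space s p"
  shows "weak_supersolution s p K \<Omega> v"
proof -
  have unif: "\<exists>B::real. \<forall>j. lp_on p D0 (u j) \<le> ennreal B \<and>
    gagliardo_on s p D0 (u j) \<le> ennreal B"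
    if D0: "open D0" "compactly_inside D0 \<Omega>" for D0
  proof -
    obtain D where D: "open D" "compactly_inside D \<Omega>" and *: "\<And>M. \<exists>B::real. \<forall>u.
      dominated_supersolution s p K \<Omega> G D M u \<longrightarrow>
      lp_on p D0 u \<le> ennreal B \<and>
      gagliardo_on s p D0 u \<le> ennreal B"
      using supersolution_uniform_sobolev[OF p K \<Omega> D0 Gm G0 Gi] by blast
    \<comment> \<open>The ceiling M can be taken uniformly in j only after D is known.\<close>
    obtain M where M: "\<And>j. AE x in lborel. x \<in> D \<longrightarrow> u j x \<le> M"
      using bd D unfolding unif_loc_ess_bdd_above_def AE_completion_iff by blast
    obtain B :: real where B: "\<And>u.
      dominated_supersolution s p K \<Omega> G D M u \<longrightarrow>
      lp_on p D0 u \<le> ennreal B \<and>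
      gagliardo_on s p D0 u \<le> ennreal B"
      using *[of M] by blast
    show ?thesis
      by (intro exI[of _ B] allI B[rule_format]) (simp add: dominated_supersolution_def u um uG M)
  qed
  \<comment> \<open>Stated over an arbitrary measure because it is used once for points and once for
    pairs.\<close>
  have fatou: "(\<integral>\<^sup>+x. ennreal (F x) \<partial>M) \<le> ennreal B"
    if "\<And>j. f j \<in> borel_measurable M" "AE x in M. (\<lambda>j. f j x) \<longlonglongrightarrow> F x"
      "\<And>j. (\<integral>\<^sup>+x. ennreal (f j x) \<partial>M) \<le> ennreal B" for f :: "nat \<Rightarrow> 'b \<Rightarrow> real" and F M B
  proof -
    have "(\<integral>\<^sup>+x. ennreal (F x) \<partial>M) = (\<integral>\<^sup>+x. liminf (\<lambda>j. ennreal (f j x)) \<partial>M)"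
    proof (rule nn_integral_cong_AE, use that(2) in eventually_elim)
      fix x assume "(\<lambda>j. f j x) \<longlonglongrightarrow> F x"
      then have "(\<lambda>j. ennreal (f j x)) \<longlonglongrightarrow> ennreal (F x)" by (rule tendsto_ennrealI)
      then show "ennreal (F x) = liminf (\<lambda>j. ennreal (f j x))"
        by (intro lim_imp_Liminf[symmetric] trivial_limit_sequentially)
    qed
    also have "\<dots> \<le> liminf (\<lambda>j. \<integral>\<^sup>+x. ennreal (f j x) \<partial>M)"
      using that(1) by (intro nn_integral_liminf) auto
    also have "\<dots> \<le> liminf (\<lambda>j::nat. ennreal B)" using that(3) by (intro Liminf_mono) auto
    also have "\<dots> = ennreal B" by (intro lim_imp_Liminf) auto
    finally show ?thesis .
  qed
  have vl: "v \<in> borel_measurable lebesgue" by (rule borel_measurable_lebesgueI[OF vm])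
  have "v \<in> sobolev s p D" if D: "open D" "compactly_inside D \<Omega>" for D
  proof -
    have [measurable]: "D \<in> sets borel" using D by simp
    have [measurable]: "D \<times> D \<in> sets (borel :: ('a \<times> 'a) measure)" using D by (intro borel_open open_Times)
    obtain B :: real where B: "\<And>j. lp_on p D (u j) \<le> ennreal B"
      "\<And>j. gagliardo_on s p D (u j) \<le> ennreal B"
      using unif[OF D] by blast
    have pw: "(\<lambda>j. \<bar>a j\<bar> powr p) \<longlonglongrightarrow> \<bar>b\<bar> powr p" if "a \<longlonglongrightarrow> b" for a :: "nat \<Rightarrow> real" and b
      using that p by (intro tendsto_powr2 tendsto_rabs tendsto_const) auto
    have "lp_on p D v \<le> ennreal B"
    proof (rule fatou[OF _ _ B(1)])
      show "AE x in lborel. (\<lambda>j. indicator D x * \<bar>u j x\<bar> powr p) \<longlonglongrightarrow> indicator D x * \<bar>v x\<bar> powr p"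
        using lim by eventually_elim (intro tendsto_mult tendsto_const pw)
    qed measurable
    moreover have "gagliardo_on s p D v \<le> ennreal B"
    proof (rule fatou[OF _ _ B(2)])
      show "AE z in lborel. (\<lambda>j. indicator (D \<times> D) z * (\<bar>u j (fst z) - u j (snd z)\<bar> powr p * sing s p (fst z) (snd z)))
        \<longlonglongrightarrow> indicator (D \<times> D) z * (\<bar>v (fst z) - v (snd z)\<bar> powr p * sing s p (fst z) (snd z))"
        using AE_lborel_fst[OF lim] AE_lborel_snd[OF lim]
        by eventually_elim (intro tendsto_mult tendsto_const pw tendsto_diff)
    qed measurable
    ultimately show ?thesis
      using measurable_restrict_space1[OF vl, of D]
      by (simp add: sobolev_def nn_set_integral_lebesgue_eq sing_def le_less_trans)
  qed
  then have "v \<in> sobolev_loc s p \<Omega>" by (simp add: sobolev_loc_def)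
  moreover have "integrable lebesgue (energy_integrand p K v \<eta>) \<and> 0 \<le> integral\<^sup>L lebesgue (energy_integrand p K v \<eta>)"
    if \<eta>: "\<eta> \<in> test_functions \<Omega>" and \<eta>0: "\<And>x. 0 \<le> \<eta> x" for \<eta>
  proof -
    define S where "S = closure {x. \<eta> x \<noteq> 0}"
    have S: "compact S" "S \<subseteq> \<Omega>" "\<And>x. x \<notin> S \<Longrightarrow> \<eta> x = 0"
      using \<eta> closure_subset[of "{x. \<eta> x \<noteq> 0}"]
      by (auto simp: S_def test_functions_def compactly_inside_def)
    obtain R where R: "0 < R" "R \<le> 1" "nbhd S R \<subseteq> \<Omega>"
      using nbhd_subset_open[OF S(1) \<Omega> S(2)] by blast
    define r where "r = R / 3"
    define D1 where "D1 = nbhd S r"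
    define D2 where "D2 = nbhd S (2 * r)"
    have r: "0 < r" "r \<le> 1" using R by (auto simp: r_def)
    have D2: "open D2" "compactly_inside D2 \<Omega>"
      unfolding D2_def using S R by (auto intro!: open_nbhd compactly_inside_nbhd[of S _ R] simp: r_def)
    have D1m [measurable]: "D1 \<in> sets borel" unfolding D1_def by (intro borel_open open_nbhd)
    have D2m [measurable]: "D2 \<times> D2 \<in> sets (borel :: ('a \<times> 'a) measure)"
      using D2 by (intro borel_open open_Times)
    have b1: "bounded D1" unfolding D1_def using S by (intro bounded_nbhd compact_imp_bounded)
    then obtain N where N: "\<And>x. x \<in> D1 \<Longrightarrow> norm x \<le> N" by (auto simp: bounded_iff)
    note tp = test_function_properties[OF p \<eta> \<eta>0]
    have \<eta>m [measurable]: "\<eta> \<in> borel_measurable borel" by (rule borel_measurable_continuous_onI[OF tp(1)])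
    obtain b where b: "0 \<le> b" "\<And>x. \<eta> x \<le> b" using tp(2) by blast
    have \<zeta>1: "(\<integral>\<^sup>+x. ennreal (indicator D1 x * \<eta> x) \<partial>lborel) < \<infinity>"
    proof -
      have "(\<integral>\<^sup>+x. ennreal (indicator D1 x * \<eta> x) \<partial>lborel) \<le> ennreal b * volume D1"
        using b by (intro nn_integral_le_cmult) (auto simp: indicator_def)
      also have "\<dots> < \<infinity>"
        using nn_integral_indicator_bounded[OF _ b1] by (simp add: ennreal_mult_less_top)
      finally show ?thesis .
    qed
    \<comment> \<open>\<eta> is bounded and \<open>D1\<close> is bounded, so \<open>G\<close> itself
      can serve as the local majorant \<open>U\<close>.\<close>
    have \<zeta>2: "(\<integral>\<^sup>+x. ennreal (indicator D1 x * \<eta> x * G x powr (p - 1)) \<partial>lborel) < \<infinity>"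
    proof -
      define c where "c = b * (1 + N) powr (real DIM('a) + s * p)"
      have "indicator D1 x * \<eta> x * G x powr (p - 1) \<le> c * (G x powr (p - 1) * tailw s p x)" for x
      proof (cases "x \<in> D1")
        case True
        have "\<eta> x * G x powr (p - 1) * 1
            \<le> b * G x powr (p - 1) * ((1 + N) powr (real DIM('a) + s * p) * tailw s p x)"
          using b tailw_lower[OF p(2,1) N[OF True]] by (intro mult_mono) auto
        then show ?thesis using True by (simp add: c_def mult_ac)
      qed (use b in \<open>simp add: c_def\<close>)
      then have "(\<integral>\<^sup>+x. ennreal (indicator D1 x * \<eta> x * G x powr (p - 1)) \<partial>lborel)
          \<le> ennreal c * tail_integral s p G"
        using b by (intro nn_integral_le_cmult) (auto simp: c_def)
      also have "\<dots> < \<infinity>" using Gi by (simp add: ennreal_mult_less_top)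
      finally show ?thesis .
    qed
    obtain B :: real where B: "\<And>j. gagliardo_on s p D2 (u j) \<le> ennreal B"
      using unif[OF D2] by blast
    define P where "P j z = indicator (D2 \<times> D2) z *
         (\<bar>u j (fst z) - u j (snd z)\<bar> powr p * sing s p (fst z) (snd z))" for j z
    have Pm: "P j \<in> borel_measurable borel" for j unfolding P_def[abs_def] by measurable
    have Pnn: "0 \<le> P j z" for j z by (simp add: P_def)
    have PB: "(\<integral>\<^sup>+z. ennreal (P j z) \<partial>lborel) \<le> ennreal B" for j unfolding P_def by (rule B)
    have dom: "\<exists>Q. Q \<in> borel_measurable borel \<and> (\<integral>\<^sup>+z. ennreal (Q z) \<partial>lborel) < \<infinity> \<and>
       (\<forall>j::nat. AE z in lborel. z \<in> D2 \<times> D2 \<longrightarrow>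
          \<bar>u j (fst z) - u j (snd z)\<bar> powr (p - 1) * \<bar>\<eta> (fst z) - \<eta> (snd z)\<bar> * sing s p (fst z) (snd z)
          \<le> \<epsilon> * P j z + Q z)" if \<epsilon>: "0 < \<epsilon>" for \<epsilon>
    proof -
      define C where "C = \<epsilon> powr (1 - p)"
      define Q where "Q z = C * (\<bar>\<eta> (fst z) - \<eta> (snd z)\<bar> powr p * sing s p (fst z) (snd z))" for z
      have C: "0 \<le> C" by (simp add: C_def)
      have Qm: "Q \<in> borel_measurable borel" unfolding Q_def[abs_def] by measurable
      have "(\<integral>\<^sup>+z. ennreal (Q z) \<partial>lborel) = ennreal C * gagliardo s p \<eta>"
        unfolding Q_def gagliardo_def using C by (subst nn_integral_cmult[symmetric]) (auto simp: ennreal_mult)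
      also have "\<dots> < \<infinity>" using tp(3) by (simp add: ennreal_mult_less_top)
      finally have Qf: "(\<integral>\<^sup>+z. ennreal (Q z) \<partial>lborel) < \<infinity>" .
      have "\<bar>u j (fst z) - u j (snd z)\<bar> powr (p - 1) * \<bar>\<eta> (fst z) - \<eta> (snd z)\<bar> * sing s p (fst z) (snd z)
          \<le> \<epsilon> * P j z + Q z" if "z \<in> D2 \<times> D2" for j z
      proof -
        have "\<bar>u j (fst z) - u j (snd z)\<bar> powr (p - 1) * \<bar>\<eta> (fst z) - \<eta> (snd z)\<bar>
            \<le> \<epsilon> * \<bar>u j (fst z) - u j (snd z)\<bar> powr p + C * \<bar>\<eta> (fst z) - \<eta> (snd z)\<bar> powr p"
          unfolding C_def using p \<epsilon> by (intro young_powr) auto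
        then have "\<bar>u j (fst z) - u j (snd z)\<bar> powr (p - 1) * \<bar>\<eta> (fst z) - \<eta> (snd z)\<bar> * sing s p (fst z) (snd z)
            \<le> (\<epsilon> * \<bar>u j (fst z) - u j (snd z)\<bar> powr p + C * \<bar>\<eta> (fst z) - \<eta> (snd z)\<bar> powr p) * sing s p (fst z) (snd z)"
          by (intro mult_right_mono) auto
        then show ?thesis using that by (simp add: P_def Q_def algebra_simps)
      qed
      then show ?thesis using Qm Qf by (intro exI[of _ Q]) auto
    qed
    have sep: "r \<le> dist x y" if "x \<in> D1" "y \<notin> D2" for x y
      using nbhd_separated[of x S r y "2 * r"] that by (simp add: D1_def D2_def)
    have e0: "\<eta> x = 0" if "x \<notin> D1" for x
      using that r by (intro S(3)) (auto simp: D1_def nbhd_def)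
    have l2: "AE x in lborel. (\<lambda>j::nat. \<eta> x) \<longlonglongrightarrow> \<eta> x" by simp
    have e\<zeta>: "AE x in lborel. \<bar>\<eta> x\<bar> \<le> \<eta> x" using \<eta>0 by simp
    have uU: "AE x in lborel. x \<in> D1 \<longrightarrow> \<bar>u j x\<bar> \<le> G x" for j using uG[of j] by eventually_elim simp
    note L = energy_limit[OF p K um vm \<eta>m \<eta>m lim l2 D1m b1 r sep e0 Gm \<eta>m Gm uG e\<zeta> uU Gi \<zeta>1 \<zeta>2 Pm Pnn PB dom]
    have "integrable lebesgue (energy_integrand p K v \<eta>)" by (rule L(1))
    moreover have "0 \<le> integral\<^sup>L lebesgue (energy_integrand p K (u j) \<eta>)" for j
      using u[of j] \<eta> \<eta>0 by (auto simp: weak_supersolution_def)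
    then have "0 \<le> integral\<^sup>L lebesgue (energy_integrand p K v \<eta>)"
      by (intro LIMSEQ_le_const[OF L(2)]) auto
    ultimately show ?thesis by blast
  qed
  ultimately show ?thesis using vl tail by (auto simp: weak_supersolution_def)
qed

lemma nn_integral_tail_space:
  fixes f f' :: "'a::euclidean_space \<Rightarrow> real"
  assumes "f \<in> tail_space s p" and eq: "AE x in lborel. f x = f' x"
  shows "(\<integral>\<^sup>+x. ennreal (\<bar>f' x\<bar> powr (p - 1) * tailw s p x) \<partial>lborel) < \<infinity>"
proof -
  have "(\<integral>\<^sup>+x. ennreal (\<bar>f' x\<bar> powr (p - 1) * tailw s p x) \<partial>lborel)
      = (\<integral>\<^sup>+x. ennreal (\<bar>f x\<bar> powr (p - 1) * tailw s p x) \<partial>lborel)"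
    by (rule nn_integral_cong_AE, use eq in eventually_elim) simp
  then show ?thesis using assms(1) by (simp add: tail_space_def nn_integral_completion tailw_def)
qed

theorem theorem10:
  fixes s p \<Lambda> :: real
    and K :: "real ^ 'n \<Rightarrow> real ^ 'n \<Rightarrow> real"
    and \<Omega> :: "(real ^ 'n) set"
    and g h v :: "real ^ 'n \<Rightarrow> real"
    and u :: "nat \<Rightarrow> real ^ 'n \<Rightarrow> real"
  assumes "0 < s" "s < 1" "1 < p" "1 \<le> \<Lambda>"
    and "admissible_kernel s p \<Lambda> K"
    and "open \<Omega>"
    and "g \<in> tail_space s p" "h \<in> tail_space s p"
    and "\<forall>x. h x \<le> g x"
    and "\<forall>j. weak_supersolution s p K \<Omega> (u j)"
    and "\<forall>j. AE x in lebesgue. h x \<le> u j x \<and> u j x \<le> g x"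
    and "unif_loc_ess_bdd_above \<Omega> u"
    and "AE x in lebesgue. (\<lambda>j. u j x) \<longlonglongrightarrow> v x"
  shows "weak_supersolution s p K \<Omega> v"
proof -
  have u: "weak_supersolution s p K \<Omega> (u j)" for j using assms(10) by simp
  have bds: "AE x in lborel. h x \<le> u j x \<and> u j x \<le> g x" for j
    using assms(11) by (simp add: AE_completion_iff)
  have lim: "AE x in lborel. (\<lambda>j. u j x) \<longlonglongrightarrow> v x"
    using assms(13) by (simp add: AE_completion_iff)
  have ul: "u j \<in> borel_measurable lebesgue" for j using u by (simp add: weak_supersolution_def)
  have vl: "v \<in> borel_measurable lebesgue"
  proof -
    \<comment> \<open>The limit is given only almost everywhere, so its measurability is obtained
      from the measurable function \<open>lim\<close> and completeness of the measure.\<close>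
    have "(\<lambda>x. lim (\<lambda>j. u j x)) \<in> borel_measurable lebesgue" using ul by measurable
    moreover have "AE x in lebesgue. lim (\<lambda>j. u j x) = v x"
      using assms(13) by eventually_elim (rule limI)
    ultimately show ?thesis by (rule borel_measurable_AE)
  qed
  have "\<exists>f. f \<in> borel_measurable borel \<and> (AE x in lborel. u j x = f x)" for j
    using borel_version[OF ul] by metis
  then obtain u' where u': "\<And>j. u' j \<in> borel_measurable borel" "\<And>j. AE x in lborel. u j x = u' j x"
    by metis
  obtain v' where v': "v' \<in> borel_measurable borel" "AE x in lborel. v x = v' x"
    by (rule borel_version[OF vl])
  have "g \<in> borel_measurable lebesgue" "h \<in> borel_measurable lebesgue"
    using assms(7,8) by (auto simp: tail_space_def)
  then obtain g' h' where g': "g' \<in> borel_measurable borel" "AE x in lborel. g x = g' x"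
    and h': "h' \<in> borel_measurable borel" "AE x in lborel. h x = h' x"
    using borel_version by metis
  \<comment> \<open>A common majorant of all |u_j|: a value between h and g is at most |g| + |h| in
    modulus.\<close>
  define G where "G x = \<bar>g' x\<bar> + \<bar>h' x\<bar>" for x
  \<comment> \<open>The lower bound passes to the limit, so the negative part of v is dominated by
    |h| and lies in the tail space.\<close>
  have hv: "AE x in lborel. h x \<le> v x"
  proof -
    have "AE x in lborel. \<forall>j. h x \<le> u j x \<and> u j x \<le> g x" using bds by (simp add: AE_all_countable)
    then show ?thesis using lim
      by eventually_elim (auto intro: LIMSEQ_le_const)
  qed
  have "weak_supersolution s p K \<Omega> v'"
  proof (rule weak_supersolution_limit_borel[OF assms(3,1,2,5,4,6) u'(1) v'(1), of G])
    show "G \<in> borel_measurable borel" unfolding G_def[abs_def] using g' h' by measurable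
    show "0 \<le> G x" for x by (simp add: G_def)
    show "tail_integral s p G < \<infinity>"
      unfolding G_def using g' h' assms(3) nn_integral_tail_space[OF assms(7) g'(2)]
        nn_integral_tail_space[OF assms(8) h'(2)]
      by (intro nn_integral_tail_add) auto
    show "weak_supersolution s p K \<Omega> (u' j)" for j
      by (rule weak_supersolution_cong_AE[OF assms(3) u'(2) u])
    show "AE x in lborel. \<bar>u' j x\<bar> \<le> G x" for j
      using bds[of j] u'(2)[of j] g'(2) h'(2) by eventually_elim (auto simp: G_def)
    show "unif_loc_ess_bdd_above \<Omega> u'"
      unfolding unif_loc_ess_bdd_above_def AE_completion_iff
    proof (intro allI impI)
      fix D assume "open D \<and> compactly_inside D \<Omega>"
      then obtain M where M: "\<And>j. AE x in lborel. x \<in> D \<longrightarrow> u j x \<le> M"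
        using assms(12) unfolding unif_loc_ess_bdd_above_def AE_completion_iff by blast
      have "AE x in lborel. x \<in> D \<longrightarrow> u' j x \<le> M" for j
        using M[of j] u'(2)[of j] by eventually_elim simp
      then show "\<exists>M::real. \<forall>j. AE x in lborel. x \<in> D \<longrightarrow> u' j x \<le> M" by blast
    qed
    show "AE x in lborel. (\<lambda>j. u' j x) \<longlonglongrightarrow> v' x"
    proof -
      have "AE x in lborel. \<forall>j. u j x = u' j x" using u'(2) by (simp add: AE_all_countable)
      then show ?thesis using lim v'(2) by eventually_elim simp
    qed
    show "(\<lambda>x. max (- v' x) 0) \<in> tail_space s p"
    proof (rule tail_space_mono_AE[OF assms(3) _ assms(8)])
      have "(\<lambda>x. max (- v' x) 0) \<in> borel_measurable borel" using v' by measurable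
      then show "(\<lambda>x. max (- v' x) 0) \<in> borel_measurable lebesgue" by (rule borel_measurable_lebesgueI)
      show "AE x in lborel. \<bar>max (- v' x) 0\<bar> \<le> \<bar>h x\<bar>"
        using hv v'(2) by eventually_elim auto
    qed
  qed
  moreover have "AE x in lborel. v' x = v x" using v'(2) by eventually_elim simp
  ultimately show ?thesis using weak_supersolution_cong_AE[OF assms(3)] by blast
qed

end
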